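(* Let $a,c:\mathbb{R}\to\mathbb{R}$ be smooth, $\varphi\in H^s(\mathbb{R})$ with $s\geq 3$, let $t_c$ be the critical time of the Cauchy problem $v^0_t=a(v^0)\,v^0_x$, $v^0(0)=\varphi$, and let $v^0(x,t)$, $(x,t)\in\mathbb{R}\times[0,t_c)$, be its unique classical solution. Then the solution of the linear transport problem $$v^1_t=\partial_x\Big(a\,v^1+c\,a'\,v^0_{xx}+\tfrac12(c\,a''+c'\,a')(v^0_x)^2\Big),\qquad v^1|_{t=0}=0,$$ on $\mathbb{R}\times[0,t_c)$ is $$v^1=\frac{t}{2}\,\frac{\partial}{\partial x}\left(\frac{(c\,a')'(v^0_x)^2+2c\,a'\,v^0_{xx}+t\,c\,(a')^2v^0_xv^0_{xx}+t\,c'(a')^2(v^0_x)^3}{(1+t\,a'\,v^0_x)^2}\right),$$ where $a,c$ and their derivatives are evaluated at $v^0(x,t)$. Equivalently, $v^1(x,t)=\partial_x\Big(\frac{\delta\tilde K_t[u]}{\delta u(x)}\Big|_{u=v^0(\cdot,t)}\Big)$, where $\tilde K_t[u]=-\frac12\int_{\mathbb{R}}c(u)\,u_x\log\big(1+t\,a'(u)\,u_x\big)\,dx$.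
   Context: Primes on $a,c$ denote derivatives with respect to their argument. The critical time $t_c\in(0,\infty]$ is the supremum of the times up to which the classical solution of $v_t=a(v)v_x$, $v(0)=\varphi$, exists (time of gradient catastrophe); on $[0,t_c)$ one has $1+t\,a'(v^0)v^0_x>0$. For a local functional $K=\int k(u,u_x,\dots)\,dx$, $\frac{\delta K}{\delta u(x)}=\sum_{j\geq 0}(-1)^j\frac{d^j}{dx^j}\frac{\partial k}{\partial u^{(j)}_x}$. *)

theory Defs
  imports "HOL-Analysis.Analysis"
begin

definition smooth_fun :: "(real \<Rightarrow> real) \<Rightarrow> bool" where
  "smooth_fun f \<longleftrightarrow>
     (\<forall>n x. ((deriv ^^ n) f has_real_derivative (deriv ^^ Suc n) f x) (at x))"

definition test_fun1 :: "(real \<Rightarrow> real) \<Rightarrow> bool" where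
  "test_fun1 \<psi> \<longleftrightarrow> smooth_fun \<psi> \<and> (\<exists>R. \<forall>x. R < \<bar>x\<bar> \<longrightarrow> \<psi> x = 0)"

definition px :: "(real \<times> real \<Rightarrow> real) \<Rightarrow> real \<times> real \<Rightarrow> real" where
  "px \<psi> = (\<lambda>(x,t). deriv (\<lambda>y. \<psi> (y,t)) x)"

definition pt :: "(real \<times> real \<Rightarrow> real) \<Rightarrow> real \<times> real \<Rightarrow> real" where
  "pt \<psi> = (\<lambda>(x,t). deriv (\<lambda>s. \<psi> (x,s)) t)"

definition smooth2 :: "(real \<times> real \<Rightarrow> real) \<Rightarrow> bool" where
  "smooth2 \<psi> \<longleftrightarrow>
     (\<forall>ds :: bool list. let f = fold (\<lambda>b g. if b then px g else pt g) ds \<psi> in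
        (\<forall>p. f differentiable (at p)) \<and> continuous_on UNIV f)"

definition test_fun2 :: "(real \<times> real \<Rightarrow> real) \<Rightarrow> bool" where
  "test_fun2 \<psi> \<longleftrightarrow> smooth2 \<psi> \<and> (\<exists>R. \<forall>p. \<psi> p \<noteq> 0 \<longrightarrow> norm p \<le> R)"

section \<open>Sobolev spaces H^s(R) (Sobolev--Slobodeckij, via weak derivatives)\<close>

definition sq_integrable :: "(real \<Rightarrow> real) \<Rightarrow> bool" where
  "sq_integrable f \<longleftrightarrow> f \<in> borel_measurable lborel \<and> integrable lborel (\<lambda>x. (f x)^2)"

definition weak_deriv1 :: "(real \<Rightarrow> real) \<Rightarrow> (real \<Rightarrow> real) \<Rightarrow> bool" where
  "weak_deriv1 f g \<longleftrightarrow>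
     (\<forall>\<psi>. test_fun1 \<psi> \<longrightarrow>
        (LINT x|lborel. f x * deriv \<psi> x) = - (LINT x|lborel. g x * \<psi> x))"

definition sobolevH :: "real \<Rightarrow> (real \<Rightarrow> real) \<Rightarrow> bool" where
  "sobolevH s f \<longleftrightarrow> 0 \<le> s \<and>
     (\<exists>g :: nat \<Rightarrow> real \<Rightarrow> real. g 0 = f \<and>
        (\<forall>j \<le> nat \<lfloor>s\<rfloor>. sq_integrable (g j)) \<and>
        (\<forall>j < nat \<lfloor>s\<rfloor>. weak_deriv1 (g j) (g (Suc j))) \<and>
        (s \<noteq> of_int \<lfloor>s\<rfloor> \<longrightarrow>
           integrable (lborel :: (real \<times> real) measure)
             (\<lambda>(x,y). (g (nat \<lfloor>s\<rfloor>) x - g (nat \<lfloor>s\<rfloor>) y)^2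
                       / \<bar>x - y\<bar> powr (1 + 2 * (s - of_int \<lfloor>s\<rfloor>)))))"

definition strip :: "ereal \<Rightarrow> (real \<times> real) set" where
  "strip T = {(x,t). 0 \<le> t \<and> ereal t < T}"

definition open_strip :: "ereal \<Rightarrow> (real \<times> real) set" where
  "open_strip T = {(x,t). 0 < t \<and> ereal t < T}"

definition classical_sol ::
  "(real \<Rightarrow> real) \<Rightarrow> (real \<Rightarrow> real) \<Rightarrow> ereal \<Rightarrow> (real \<Rightarrow> real \<Rightarrow> real) \<Rightarrow> bool" where
  "classical_sol a \<phi> T v \<longleftrightarrow>
     (\<exists>vx vt :: real \<Rightarrow> real \<Rightarrow> real.
        (\<forall>x t. 0 \<le> t \<and> ereal t < T \<longrightarrow>
            ((\<lambda>y. v y t) has_real_derivative vx x t) (at x) \<and>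
            ((\<lambda>s. v x s) has_real_derivative vt x t) (at t within {0..}) \<and>
            vt x t = a (v x t) * vx x t) \<and>
        continuous_on (strip T) (\<lambda>(x,t). v x t) \<and>
        continuous_on (strip T) (\<lambda>(x,t). vx x t) \<and>
        continuous_on (strip T) (\<lambda>(x,t). vt x t)) \<and>
     (\<forall>x. v x 0 = \<phi> x)"

definition critical_time :: "(real \<Rightarrow> real) \<Rightarrow> (real \<Rightarrow> real) \<Rightarrow> ereal" where
  "critical_time a \<phi> = Sup {ereal T | T. 0 < T \<and> (\<exists>v. classical_sol a \<phi> (ereal T) v)}"

text \<open>Weak solution of v_t = d/dx (A v + S), v|_{t=0} = 0, on R x [0,T).\<close>
definition weak_sol_transport ::
  "(real \<Rightarrow> real \<Rightarrow> real) \<Rightarrow> (real \<Rightarrow> real \<Rightarrow> real) \<Rightarrow> ereal \<Rightarrow> (real \<Rightarrow> real \<Rightarrow> real) \<Rightarrow> bool" where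
  "weak_sol_transport A S T v \<longleftrightarrow>
     (\<forall>K. compact K \<and> K \<subseteq> strip T \<longrightarrow> set_integrable lborel K (\<lambda>(x,t). v x t)) \<and>
     (\<forall>\<psi> T'. test_fun2 \<psi> \<and> ereal T' < T \<and> (\<forall>p. \<psi> p \<noteq> 0 \<longrightarrow> snd p \<le> T') \<longrightarrow>
        (LINT p:strip T|lborel.
            (\<lambda>(x,t). v x t * pt \<psi> (x,t) - (A x t * v x t + S x t) * px \<psi> (x,t)) p) = 0)"

definition dist_dx_eq :: "(real \<Rightarrow> real \<Rightarrow> real) \<Rightarrow> (real \<Rightarrow> real \<Rightarrow> real) \<Rightarrow> ereal \<Rightarrow> bool" where
  "dist_dx_eq v H T \<longleftrightarrow>
     (\<forall>\<psi> \<delta> T'. test_fun2 \<psi> \<and> 0 < \<delta> \<and> ereal T' < T \<and>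
        (\<forall>p. \<psi> p \<noteq> 0 \<longrightarrow> \<delta> \<le> snd p \<and> snd p \<le> T') \<longrightarrow>
        (LINT p:open_strip T|lborel. (\<lambda>(x,t). v x t * \<psi> (x,t)) p)
          = - (LINT p:open_strip T|lborel. (\<lambda>(x,t). H x t * px \<psi> (x,t)) p))"

definition dx :: "(real \<Rightarrow> real \<Rightarrow> real) \<Rightarrow> real \<Rightarrow> real \<Rightarrow> real" where
  "dx v x t = deriv (\<lambda>y. v y t) x"

definition dxx :: "(real \<Rightarrow> real \<Rightarrow> real) \<Rightarrow> real \<Rightarrow> real \<Rightarrow> real" where
  "dxx v x t = deriv (\<lambda>y. deriv (\<lambda>z. v z t) y) x"

definition source_term ::
  "(real \<Rightarrow> real) \<Rightarrow> (real \<Rightarrow> real) \<Rightarrow> (real \<Rightarrow> real \<Rightarrow> real) \<Rightarrow> real \<Rightarrow> real \<Rightarrow> real" where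
  "source_term a c v x t =
     (let u = v x t in
      c u * deriv a u * dxx v x t
      + 1/2 * (c u * deriv (deriv a) u + deriv c u * deriv a u) * (dx v x t)^2)"

definition formula_H ::
  "(real \<Rightarrow> real) \<Rightarrow> (real \<Rightarrow> real) \<Rightarrow> (real \<Rightarrow> real \<Rightarrow> real) \<Rightarrow> real \<Rightarrow> real \<Rightarrow> real" where
  "formula_H a c v x t =
     (let u = v x t; w = dx v x t; w2 = dxx v x t in
      t / 2 * ((deriv (\<lambda>y. c y * deriv a y) u * w^2 + 2 * c u * deriv a u * w2
                + t * c u * (deriv a u)^2 * w * w2 + t * deriv c u * (deriv a u)^2 * w^3)
               / (1 + t * deriv a u * w)^2))"

definition Kdens :: "(real \<Rightarrow> real) \<Rightarrow> (real \<Rightarrow> real) \<Rightarrow> real \<Rightarrow> real \<Rightarrow> real \<Rightarrow> real" where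
  "Kdens a c t u p = - 1/2 * c u * p * ln (1 + t * deriv a u * p)"

text \<open>Variational derivative of a first-order local functional int k(u,u_x) dx:
  dK/du(x) = dk/du - d/dx (dk/du_x).\<close>
definition var_deriv1 :: "(real \<Rightarrow> real \<Rightarrow> real) \<Rightarrow> (real \<Rightarrow> real) \<Rightarrow> real \<Rightarrow> real" where
  "var_deriv1 k u x =
     deriv (\<lambda>w. k w (deriv u x)) (u x)
     - deriv (\<lambda>y. deriv (\<lambda>p. k (u y) p) (deriv u y)) x"

end

theory Submission
  imports Defs
begin

text \<open>The classical solution is constant along the characteristics \<open>X \<xi> t = \<xi> - t * a (\<phi> \<xi>)\<close>, so in
  the coordinates \<open>(\<xi>, t)\<close> everything is explicit in \<open>\<phi>\<close> and the Jacobian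
  \<open>J \<xi> t = 1 - t * (a \<circ> \<phi>)' \<xi>\<close>, which stays positive before the critical time. There the
  operator \<open>\<partial>\<^sub>t - a(v) \<partial>\<^sub>x\<close> becomes \<open>\<partial>\<^sub>t\<close>, the source term becomes a function \<open>\<sigma>\<close>, and the potential in the
  claimed formula becomes the function \<open>h\<close> with \<open>\<partial>\<^sub>t h = \<sigma>\<close> and \<open>h = 0\<close> at time 0.

  Every weak solution is \<open>\<partial>\<^sub>x H\<close>: given a test function \<open>\<eta>\<close>, solve the dual problem \<open>\<psi>\<^sub>t - a(v) \<psi>\<^sub>x = \<eta>\<close> backwards
  in time and use \<open>\<psi>\<close> in the weak formulation; this gives \<open>\<integral> v1 \<eta> = \<integral> S \<psi>\<^sub>x\<close>, and an integration by parts in time along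
  characteristics turns the right-hand side into \<open>- \<integral> H \<eta>\<^sub>x\<close>. As \<open>\<psi>\<close> is only \<open>C\<^sup>1\<close>, the weak formulation is first extended
  to such test functions by mollification.

  A weak solution exists: for \<open>\<phi> \<in> H\<^sup>3\<close> the du Bois-Reymond lemma makes \<open>\<phi>\<close> twice continuously differentiable with
  \<open>\<phi>''\<close> weakly differentiable, and \<open>h\<close> is affine in \<open>\<phi>''\<close>, so \<open>\<partial>\<^sub>x H\<close> is a locally integrable
  function.\<close>

section \<open>Smooth kernels\<close>


text \<open>The equation for \<open>v1\<close> is the space derivative of H_t - a(v) H_x = S with H
  = 0 at time 0. Along a characteristic the left-hand side is the total time derivative of H, so H
  accumulates S over the past of a point; this is the origin of the closed formula. Differentiating
  \<phi>(\<xi>) = v(X, t) in \<xi> gives 1 + t a'(v) v_x = 1/J, which accounts for the denominator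
  of the formula and for the logarithm in the functional.

  The obstacle is regularity. For \<open>s = 3\<close> the second derivative of \<phi> is continuous
  but need not be differentiable, and H contains v_xx. Hence H_x need not exist classically and
  \<open>v1\<close> is only a locally integrable weak solution: all derivatives must be moved to the
  dual solution, and changes of variables must hold for merely measurable functions. The initial
  condition is encoded by test functions that need not vanish at t = 0, so the dual solution has to
  be approximated by smooth functions up to the boundary of the half plane, where its time
  derivative is one-sided.\<close>

lemma compact_continuous_bounded:
  fixes f :: "'a::topological_space \<Rightarrow> real"
  assumes "compact K" "continuous_on K f"
  obtains B where "\<And>x. x \<in> K \<Longrightarrow> \<bar>f x\<bar> \<le> B"
  using compact_imp_bounded[OF compact_continuous_image[OF assms(2,1)]] by (metis bounded_iff imageI real_norm_def)

text \<open>Closes the approximation arguments: \<open>M\<close> is a fixed integral over an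
  enlarged support, while \<open>e\<close> is the accuracy of the smooth approximation.\<close>

lemma abs_le_all_mult_imp_zero:
  fixes D M :: real
  assumes "\<And>e. e > 0 \<Longrightarrow> \<bar>D\<bar> \<le> e * M" shows "D = 0"
proof -
  have "0 \<le> M" using assms[of 1] by simp
  have "\<bar>D\<bar> \<le> 0 + e" if "e > 0" for e
  proof -
    have "\<bar>D\<bar> \<le> e / (M + 1) * M" using \<open>0 \<le> M\<close> that by (intro assms) auto
    also have "\<dots> \<le> e" using \<open>0 \<le> M\<close> that by (simp add: field_simps)
    finally show ?thesis by simp
  qed
  then have "\<bar>D\<bar> \<le> 0" by (rule field_le_epsilon)
  then show ?thesis by simp
qed

text \<open>Membership in \<open>C\<close> is an invariant of \<open>deriv\<close>: the derivative
  supplied by \<open>C\<close> is unique, so all iterates of \<open>deriv\<close> stay in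
  \<open>C\<close> and no explicit n-th derivative has to be known.\<close>

lemma smooth_fun_coinduct:
  assumes f: "f \<in> C"
    and C: "\<And>g. g \<in> C \<Longrightarrow> \<exists>g'\<in>C. \<forall>x. (g has_real_derivative g' x) (at x)"
  shows "smooth_fun f"
proof -
  have step: "deriv g \<in> C \<and> (\<forall>x. (g has_real_derivative deriv g x) (at x))" if g: "g \<in> C" for g
  proof -
    obtain g' where g': "g' \<in> C" "\<forall>x. (g has_real_derivative g' x) (at x)"
      using C[OF g] by blast
    then have "deriv g = g'" by (auto intro: DERIV_imp_deriv)
    with g' show ?thesis by simp
  qed
  have "(deriv ^^ n) f \<in> C" for n
    by (induction n) (auto simp: f step)
  then show ?thesis unfolding smooth_fun_def using step by auto
qed

lemma smooth_fun_deriv: "smooth_fun f \<Longrightarrow> smooth_fun (deriv f)"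
  unfolding smooth_fun_def by (metis comp_apply funpow_Suc_right)

lemma smooth_fun_DERIV: "smooth_fun f \<Longrightarrow> (f has_real_derivative deriv f x) (at x)"
  unfolding smooth_fun_def by (metis comp_apply funpow_0 funpow_Suc_right)

lemma smooth_fun_continuous: "smooth_fun f \<Longrightarrow> continuous_on S f"
  by (meson DERIV_isCont continuous_at_imp_continuous_on smooth_fun_DERIV)

lemma smooth_fun_cmult:
  assumes "smooth_fun f" shows "smooth_fun (\<lambda>x. c * f x)"
proof (rule smooth_fun_coinduct[where C="{\<lambda>x. c * g x | g. smooth_fun g}"])
  fix g assume "g \<in> {\<lambda>x. c * g x | g. smooth_fun g}"
  then obtain f where f: "g = (\<lambda>x. c * f x)" "smooth_fun f" by blast
  then show "\<exists>g'\<in>{\<lambda>x. c * g x | g. smooth_fun g}. \<forall>x. (g has_real_derivative g' x) (at x)"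
    by (intro bexI[of _ "\<lambda>x. c * deriv f x"])
      (auto intro!: DERIV_cmult smooth_fun_DERIV smooth_fun_deriv)
qed (use assms in auto)

text \<open>The family is closed under differentiation, which yields smoothness of the bump function \<open>k = 0\<close>, \<open>p = 1\<close>.\<close>
definition bump_family :: "real \<Rightarrow> nat \<Rightarrow> real poly \<Rightarrow> real \<Rightarrow> real" where
  "bump_family \<epsilon> k p x = (if 0 < x \<and> x < \<epsilon>
     then poly p x / (x * (\<epsilon> - x)) ^ k * exp (- 1 / (x * (\<epsilon> - x))) else 0)"

text \<open>This bound forces derivative 0 at the endpoints of the support and beyond. It holds
  because exp(-1/z) beats every power of z = x(\<epsilon> - x), and z is at most the distance from x
  to any point outside the interval, as \<epsilon> \<le> 1.\<close>

lemma bump_family_quadratic: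
  assumes "0 < \<epsilon>" "\<epsilon> \<le> 1"
  shows "\<exists>M\<ge>0. \<forall>x x0. \<not> (0 < x0 \<and> x0 < \<epsilon>) \<longrightarrow> \<bar>bump_family \<epsilon> k p x\<bar> \<le> M * (x - x0)^2"
proof -
  obtain C where C: "\<And>x. x \<in> {0..\<epsilon>} \<Longrightarrow> \<bar>poly p x\<bar> \<le> C"
    by (rule compact_continuous_bounded[of "{0..\<epsilon>}" "poly p"]) (auto intro: continuous_intros)
  then have C0: "C \<ge> 0" using assms by (meson abs_ge_zero atLeastAtMost_iff less_imp_le order_trans order_refl)
  show ?thesis
  proof (intro exI[of _ "C * fact (k + 2)"] conjI allI impI)
    fix x x0 :: real assume x0: "\<not> (0 < x0 \<and> x0 < \<epsilon>)"
    show "\<bar>bump_family \<epsilon> k p x\<bar> \<le> C * fact (k + 2) * (x - x0)^2"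
    proof (cases "0 < x \<and> x < \<epsilon>")
      case True
      define z where "z = x * (\<epsilon> - x)"
      have z: "z > 0" using True by (simp add: z_def)
      have zx: "z \<le> \<bar>x - x0\<bar>"
      proof (cases "x0 \<le> 0")
        case True': True
        have "z \<le> x" unfolding z_def using True assms by (simp add: mult_left_le)
        then show ?thesis using True' by linarith
      next
        case False
        then have "x0 \<ge> \<epsilon>" using x0 by auto
        moreover have "z \<le> \<epsilon> - x" unfolding z_def using True assms by (simp add: mult_left_le_one_le)
        ultimately show ?thesis by linarith
      qed
      \<comment> \<open>One term of the exponential series suffices; the exponent
        \<open>k + 2\<close> leaves two powers of \<open>z\<close> after the division by
        \<open>z ^ k\<close>.\<close>
      have "(1/z) ^ (k+2) / fact (k+2) \<le> exp (1/z)"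
      proof -
        have "(\<lambda>n. (1/z) ^ n / fact n) sums exp (1/z)"
          using exp_converges[of "1/z"] by (simp add: divide_inverse mult.commute)
        then show ?thesis
          using sum_le_suminf[of "\<lambda>n. (1/z) ^ n / fact n" "{k+2}"] z
          by (simp add: sums_iff)
      qed
      then have "exp (- 1 / z) \<le> fact (k+2) * z ^ (k+2)"
        using z by (simp add: exp_minus field_simps power_divide del: fact_Suc power_Suc power_add)
      then have e: "exp (- 1 / z) / z ^ k \<le> fact (k+2) * z ^ 2"
        using z by (simp add: field_simps power2_eq_square del: fact_Suc)
      have "\<bar>bump_family \<epsilon> k p x\<bar> = \<bar>poly p x\<bar> * (exp (- 1 / z) / z ^ k)"
        using True z by (simp add: bump_family_def z_def abs_mult)
      also have "\<dots> \<le> C * (fact (k+2) * z ^ 2)"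
        using True z e C0 by (intro mult_mono C) auto
      also have "\<dots> \<le> C * (fact (k+2) * (x - x0) ^ 2)"
        using zx z C0 by (intro mult_left_mono) (auto intro: power2_le_iff_abs_le[THEN iffD2] simp: abs_le_square_iff[symmetric])
      finally show ?thesis by (simp add: mult.assoc)
    qed (use C0 in \<open>auto simp: bump_family_def\<close>)
  qed (use C0 in auto)
qed

text \<open>Inside the interval this is (p z^{-k} e^{-1/z})' = (p' z^2 - k p z' z + p z') z^{-k-2}
  e^{-1/z}, with x(\<epsilon> - x) written as a polynomial so that the new numerator is again one.
  Elsewhere the quadratic bound gives derivative 0.\<close>

lemma bump_family_DERIV:
  assumes "0 < \<epsilon>" "\<epsilon> \<le> 1"
  defines "z \<equiv> [:0, \<epsilon>, -1:]" 
  shows "(bump_family \<epsilon> k p has_real_derivative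
      bump_family \<epsilon> (k + 2) (pderiv p * z^2 - smult (of_nat k) (p * pderiv z * z) + p * pderiv z) x) (at x)"
    (is "(_ has_real_derivative bump_family \<epsilon> _ ?q x) _")
proof (cases "0 < x \<and> x < \<epsilon>")
  case True
  have zx: "poly z y = y * (\<epsilon> - y)" for y by (simp add: z_def algebra_simps)
  have z'x: "poly (pderiv z) y = \<epsilon> - 2 * y" for y by (simp add: z_def pderiv_pCons algebra_simps)
  have pos: "poly z x > 0" using True by (simp add: zx)
  have "((\<lambda>y. poly p y / poly z y ^ k * exp (- 1 / poly z y)) has_real_derivative
      bump_family \<epsilon> (k + 2) ?q x) (at x)"
  proof -
    have "bump_family \<epsilon> (k + 2) ?q x = 
     (poly (pderiv p) x * poly z x ^ k - poly p x * (of_nat k * poly z x ^ (k - 1) * poly (pderiv z) x)) / (poly z x ^ k * poly z x ^ k) * exp (- 1 / poly z x)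
      + (poly p x / poly z x ^ k) * (exp (- 1 / poly z x) * (poly (pderiv z) x / (poly z x * poly z x)))"
      using True pos unfolding bump_family_def zx[symmetric]
      apply (cases k)
      apply (simp_all add: field_simps power2_eq_square)
      done
    moreover have "((\<lambda>y. poly p y / poly z y ^ k * exp (- 1 / poly z y)) has_real_derivative
      (poly (pderiv p) x * poly z x ^ k - poly p x * (of_nat k * poly z x ^ (k - 1) * poly (pderiv z) x)) / (poly z x ^ k * poly z x ^ k) * exp (- 1 / poly z x)
      + (poly p x / poly z x ^ k) * (exp (- 1 / poly z x) * (poly (pderiv z) x / (poly z x * poly z x)))) (at x)"
      using pos by (auto intro!: derivative_eq_intros poly_DERIV simp: power2_eq_square)
         (simp add: algebra_simps add_divide_distrib diff_divide_distrib)
    ultimately show ?thesis by simp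
  qed
  then show ?thesis
  proof (rule has_field_derivative_transform_within_open[where S="{0<..<\<epsilon>}"])
    show "poly p y / poly z y ^ k * exp (- 1 / poly z y) = bump_family \<epsilon> k p y" if "y \<in> {0<..<\<epsilon>}" for y
      using that by (simp add: bump_family_def zx)
  qed (use True in auto)
next
  case False
  obtain M where M: "M \<ge> 0" "\<And>y. \<bar>bump_family \<epsilon> k p y\<bar> \<le> M * (y - x)^2"
    using bump_family_quadratic[OF assms(1,2), of k p] False by blast
  have "((\<lambda>y. (bump_family \<epsilon> k p y - bump_family \<epsilon> k p x) / (y - x)) \<longlongrightarrow> 0) (at x)"
  proof (rule Lim_null_comparison[where g="\<lambda>y. M * \<bar>y - x\<bar>"])
    show "\<forall>\<^sub>F y in at x. norm ((bump_family \<epsilon> k p y - bump_family \<epsilon> k p x) / (y - x)) \<le> M * \<bar>y - x\<bar>"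
    proof (intro always_eventually allI)
      fix y
      have "bump_family \<epsilon> k p x = 0" using False by (auto simp: bump_family_def)
      then show "norm ((bump_family \<epsilon> k p y - bump_family \<epsilon> k p x) / (y - x)) \<le> M * \<bar>y - x\<bar>"
        using M(2)[of y] by (cases "y = x") (auto simp: divide_simps power2_eq_square abs_mult mult.assoc)
    qed
    show "((\<lambda>y. M * \<bar>y - x\<bar>) \<longlongrightarrow> 0) (at x)"
      by (auto intro!: tendsto_eq_intros)
  qed
  then show ?thesis using False
    by (auto simp: has_field_derivative_iff bump_family_def)
qed

lemma smooth_fun_bump_family:
  assumes "0 < \<epsilon>" "\<epsilon> \<le> 1" shows "smooth_fun (bump_family \<epsilon> k p)"
proof (rule smooth_fun_coinduct[where C="{bump_family \<epsilon> k p | k p. True}"])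
  fix g assume "g \<in> {bump_family \<epsilon> k p | k p. True}"
  then show "\<exists>g'\<in>{bump_family \<epsilon> k p | k p. True}. \<forall>x. (g has_real_derivative g' x) (at x)"
    using bump_family_DERIV[OF assms] by blast
qed auto

text \<open>The support lies strictly to the right of 0, so averaging against such a kernel looks
  only ahead.\<close>

lemma exists_smooth_kernel:
  assumes "0 < \<epsilon>" "\<epsilon> \<le> 1"
  shows "\<exists>\<rho>. smooth_fun \<rho> \<and> (\<forall>x. 0 \<le> \<rho> x) \<and> (\<forall>x. \<rho> x \<noteq> 0 \<longrightarrow> 0 < x \<and> x < \<epsilon>) \<and> integral {0..\<epsilon>} \<rho> = 1"
proof -
  define b where "b = bump_family \<epsilon> 0 1"
  have b: "smooth_fun b" "\<And>x. 0 \<le> b x" "\<And>x. b x \<noteq> 0 \<Longrightarrow> 0 < x \<and> x < \<epsilon>"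
    using smooth_fun_bump_family[OF assms] by (auto simp: b_def bump_family_def split: if_splits)
  define I where "I = integral {0..\<epsilon>} b"
  have "I \<noteq> 0"
  proof
    assume "I = 0"
    have "(b has_integral I) (cbox 0 \<epsilon>)"
      unfolding I_def using b(1) by (auto intro!: integrable_integral integrable_continuous_interval smooth_fun_continuous)
    then have "b (\<epsilon>/2) = 0" using \<open>I = 0\<close> b assms
      by (intro has_integral_0_cbox_imp_0[of 0 \<epsilon> b]) (auto intro: smooth_fun_continuous)
    then show False using assms by (simp add: b_def bump_family_def)
  qed
  moreover have "I \<ge> 0" unfolding I_def using b
    by (intro integral_nonneg integrable_continuous_interval smooth_fun_continuous) auto
  ultimately show ?thesis using b smooth_fun_cmult[OF b(1), of "1/I"]
    by (intro exI[of _ "\<lambda>x. (1/I) * b x"]) (auto simp: I_def[symmetric])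
qed

section \<open>Mollification\<close>


text \<open>The kernel enters as \<open>q - p\<close>, not \<open>p - q\<close>: with kernels on the
  positive axis the value at \<open>p\<close> averages \<psi> over points to the right of and later
  than \<open>p\<close>. Two independent factors make the family closed under both partial
  derivatives, up to sign.\<close>

definition mollify2 ::
  "real \<times> real \<Rightarrow> real \<times> real \<Rightarrow> (real \<times> real \<Rightarrow> real) \<Rightarrow> (real \<Rightarrow> real) \<Rightarrow> (real \<Rightarrow> real) \<Rightarrow> real \<times> real \<Rightarrow> real" where
  "mollify2 l u \<psi> \<alpha> \<beta> p = integral (cbox l u) (\<lambda>q. \<psi> q * (\<alpha> (fst q - fst p) * \<beta> (snd q - snd p)))"

lemma mollify2_has_derivative:
  assumes \<psi>: "continuous_on (cbox l u) \<psi>" and \<alpha>: "smooth_fun \<alpha>" and \<beta>: "smooth_fun \<beta>"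
  shows "(mollify2 l u \<psi> \<alpha> \<beta> has_derivative
     (\<lambda>v. - mollify2 l u \<psi> (deriv \<alpha>) \<beta> p * fst v - mollify2 l u \<psi> \<alpha> (deriv \<beta>) p * snd v)) (at p)"
proof -
  note c = continuous_on_compose2[OF smooth_fun_continuous[OF \<alpha>, of UNIV]]
    continuous_on_compose2[OF smooth_fun_continuous[OF \<beta>, of UNIV]]
    continuous_on_compose2[OF smooth_fun_continuous[OF smooth_fun_deriv[OF \<alpha>], of UNIV]]
    continuous_on_compose2[OF smooth_fun_continuous[OF smooth_fun_deriv[OF \<beta>], of UNIV]]
    continuous_on_compose2[OF \<psi>]
  define fx where "fx p q = blinfun_inner_right 
      (- (\<psi> q * (deriv \<alpha> (fst q - fst p) * \<beta> (snd q - snd p))),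
       - (\<psi> q * (\<alpha> (fst q - fst p) * deriv \<beta> (snd q - snd p))))" for p q :: "real \<times> real"
  have "((\<lambda>p. integral (cbox l u) (\<lambda>q. \<psi> q * (\<alpha> (fst q - fst p) * \<beta> (snd q - snd p)))) has_derivative
      blinfun_apply (integral (cbox l u) (fx p))) (at p within UNIV)"
  proof (rule leibniz_rule)
    fix p q :: "real \<times> real"
    have "((\<lambda>p. \<alpha> (fst q - fst p)) has_derivative (\<lambda>v. - (deriv \<alpha> (fst q - fst p) * fst v))) (at p)"
      by (rule has_derivative_eq_rhs, rule DERIV_compose_FDERIV[OF smooth_fun_DERIV[OF \<alpha>]])
        (auto intro!: derivative_eq_intros simp: fun_eq_iff)
    moreover have "((\<lambda>p. \<beta> (snd q - snd p)) has_derivative (\<lambda>v. - (deriv \<beta> (snd q - snd p) * snd v))) (at p)"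
      by (rule has_derivative_eq_rhs, rule DERIV_compose_FDERIV[OF smooth_fun_DERIV[OF \<beta>]])
        (auto intro!: derivative_eq_intros simp: fun_eq_iff)
    ultimately have "((\<lambda>p. \<psi> q * (\<alpha> (fst q - fst p) * \<beta> (snd q - snd p))) has_derivative 
      (\<lambda>v. \<psi> q * (\<alpha> (fst q - fst p) * - (deriv \<beta> (snd q - snd p) * snd v) + - (deriv \<alpha> (fst q - fst p) * fst v) * \<beta> (snd q - snd p)))) (at p)"
      by (intro has_derivative_mult_right has_derivative_mult)
    then show "((\<lambda>p. \<psi> q * (\<alpha> (fst q - fst p) * \<beta> (snd q - snd p))) has_derivative blinfun_apply (fx p q)) (at p)"
      by (rule has_derivative_eq_rhs) (auto simp: fx_def algebra_simps inner_prod_def fun_eq_iff)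
  next
    show "continuous_on (UNIV \<times> cbox l u) (\<lambda>(p, q). fx p q)"
      unfolding fx_def case_prod_beta by (intro continuous_intros c) auto
  qed (auto intro!: integrable_continuous continuous_intros c)
  moreover have "blinfun_apply (integral (cbox l u) (fx p)) = (\<lambda>v. - mollify2 l u \<psi> (deriv \<alpha>) \<beta> p * fst v - mollify2 l u \<psi> \<alpha> (deriv \<beta>) p * snd v)"
  proof
    fix v
    have i: "(\<lambda>q. \<psi> q * (deriv \<alpha> (fst q - fst p) * \<beta> (snd q - snd p))) integrable_on cbox l u"
      "(\<lambda>q. \<psi> q * (\<alpha> (fst q - fst p) * deriv \<beta> (snd q - snd p))) integrable_on cbox l u"
      by (auto intro!: integrable_continuous continuous_intros c)
    have "fx p integrable_on cbox l u" unfolding fx_def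
      by (auto intro!: integrable_continuous continuous_intros c)
    then have "blinfun_apply (integral (cbox l u) (fx p)) v = integral (cbox l u) (\<lambda>q. fx p q v)"
      by (rule blinfun_apply_integral)
    also have "\<dots> = integral (cbox l u) (\<lambda>q. (\<psi> q * (deriv \<alpha> (fst q - fst p) * \<beta> (snd q - snd p))) * (- fst v)
        + (\<psi> q * (\<alpha> (fst q - fst p) * deriv \<beta> (snd q - snd p))) * (- snd v))"
      by (simp add: fx_def inner_prod_def algebra_simps)
    also have "\<dots> = - mollify2 l u \<psi> (deriv \<alpha>) \<beta> p * fst v - mollify2 l u \<psi> \<alpha> (deriv \<beta>) p * snd v"
      unfolding mollify2_def using i by (subst integral_add) (simp_all add: integrable_on_mult_left integrable_neg)
    finally show "blinfun_apply (integral (cbox l u) (fx p)) v = \<dots>" .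
  qed
  ultimately show ?thesis by (simp add: mollify2_def[abs_def])
qed

lemma has_derivative_imp_DERIV_fst:
  fixes f :: "real \<times> real \<Rightarrow> real"
  assumes "(f has_derivative (\<lambda>v. A * fst v + B * snd v)) (at (x,t))"
  shows "((\<lambda>y. f (y,t)) has_real_derivative A) (at x)" 
proof -
  have "((\<lambda>y. (y,t)) has_derivative (\<lambda>h. (h,0))) (at x)"
    by (auto intro!: derivative_eq_intros)
  from has_derivative_compose[OF this assms] show ?thesis
    by (simp add: has_field_derivative_def)
qed

lemma has_derivative_imp_DERIV_snd:
  fixes f :: "real \<times> real \<Rightarrow> real"
  assumes "(f has_derivative (\<lambda>v. A * fst v + B * snd v)) (at (x,t))"
  shows "((\<lambda>s. f (x,s)) has_real_derivative B) (at t)" 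
proof -
  have "((\<lambda>s. (x,s)) has_derivative (\<lambda>h. (0,h))) (at t)"
    by (auto intro!: derivative_eq_intros)
  from has_derivative_compose[OF this assms] show ?thesis
    by (simp add: has_field_derivative_def)
qed

lemma smooth2_mollify2:
  assumes \<psi>: "continuous_on (cbox l u) \<psi>" and \<alpha>: "smooth_fun \<alpha>" and \<beta>: "smooth_fun \<beta>"
  shows "smooth2 (mollify2 l u \<psi> \<alpha> \<beta>)"
proof -
  \<comment> \<open>The scalar \<open>c\<close> absorbs the sign that each differentiation
    produces.\<close>
  define C where "C = {\<lambda>p. c * mollify2 l u \<psi> \<alpha> \<beta> p | c \<alpha> \<beta>. smooth_fun \<alpha> \<and> smooth_fun \<beta>}"
  have d: "((\<lambda>p. c * mollify2 l u \<psi> \<alpha> \<beta> p) has_derivative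
     (\<lambda>v. (-c * mollify2 l u \<psi> (deriv \<alpha>) \<beta> p) * fst v + (-c * mollify2 l u \<psi> \<alpha> (deriv \<beta>) p) * snd v)) (at p)"
    if "smooth_fun \<alpha>" "smooth_fun \<beta>" for c \<alpha> \<beta> p
    by (rule has_derivative_eq_rhs[OF has_derivative_mult_right[OF mollify2_has_derivative[OF \<psi> that]]])
       (auto simp: algebra_simps)
  have C1: "px g \<in> C \<and> pt g \<in> C \<and> (\<forall>p. g differentiable (at p))" if "g \<in> C" for g
  proof -
    obtain c \<alpha> \<beta> where g: "g = (\<lambda>p. c * mollify2 l u \<psi> \<alpha> \<beta> p)" and s: "smooth_fun \<alpha>" "smooth_fun \<beta>"
      using \<open>g \<in> C\<close> unfolding C_def by blast
    have "px g p = (-c) * mollify2 l u \<psi> (deriv \<alpha>) \<beta> p \<and> pt g p = (-c) * mollify2 l u \<psi> \<alpha> (deriv \<beta>) p" for p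
    proof (cases p)
      case (Pair x t)
      show ?thesis
        using DERIV_imp_deriv[OF has_derivative_imp_DERIV_fst[OF d[OF s, of c "(x,t)"]]]
          DERIV_imp_deriv[OF has_derivative_imp_DERIV_snd[OF d[OF s, of c "(x,t)"]]]
        by (simp add: px_def pt_def g Pair)
    qed
    then have "px g = (\<lambda>p. (-c) * mollify2 l u \<psi> (deriv \<alpha>) \<beta> p)" "pt g = (\<lambda>p. (-c) * mollify2 l u \<psi> \<alpha> (deriv \<beta>) p)"
      by blast+
    then have "px g \<in> C" "pt g \<in> C" using s smooth_fun_deriv unfolding C_def by blast+
    moreover have "g differentiable (at p)" for p using d[OF s] unfolding g differentiable_def by blast
    ultimately show ?thesis by auto
  qed
  have "fold (\<lambda>b g. if b then px g else pt g) ds g \<in> C" if "g \<in> C" for ds g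
    using that by (induction ds arbitrary: g) (auto simp: C1)
  moreover have "mollify2 l u \<psi> \<alpha> \<beta> \<in> C" unfolding C_def using \<alpha> \<beta>
    by (intro CollectI exI[of _ "1::real"] exI[of _ \<alpha>] exI[of _ \<beta>]) simp
  ultimately have "\<forall>p. fold (\<lambda>b g. if b then px g else pt g) ds (mollify2 l u \<psi> \<alpha> \<beta>) differentiable (at p)" for ds
    using C1 by blast
  then show ?thesis unfolding smooth2_def Let_def
    by (auto intro!: continuous_at_imp_continuous_on differentiable_imp_continuous_within)
qed

lemma uniform_continuity_half_plane:
  fixes g :: "real \<times> real \<Rightarrow> real"
  assumes g: "continuous_on (UNIV \<times> {0..}) g"
    and supp: "\<And>x t. 0 \<le> t \<Longrightarrow> R < \<bar>x\<bar> \<or> T < t \<Longrightarrow> g (x,t) = 0" and "0 < e"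
  shows "\<exists>d>0. d \<le> 1 \<and> (\<forall>x t y s. 0 \<le> t \<longrightarrow> 0 \<le> y \<longrightarrow> y \<le> d \<longrightarrow> 0 \<le> s \<longrightarrow> s \<le> d \<longrightarrow> \<bar>g (x + y, t + s) - g (x,t)\<bar> \<le> e)"
proof -
  \<comment> \<open>Shifts are at most 1: a point with |x| \<le> R + 1 and t \<le> T + 1 stays in
    \<open>K\<close> when shifted, and for any other point both values of \<open>g\<close> are
    0.\<close>
  define K where "K = {-R-2..R+2} \<times> {0..T+2}"
  have "uniformly_continuous_on K g" 
    by (rule compact_uniformly_continuous) (auto simp: K_def intro!: compact_Times continuous_on_subset[OF g])
  then obtain d where d: "d > 0" "\<And>p q. p \<in> K \<Longrightarrow> q \<in> K \<Longrightarrow> dist p q < d \<Longrightarrow> dist (g p) (g q) < e"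
    unfolding uniformly_continuous_on_def using \<open>0 < e\<close> by metis
  show ?thesis
  proof (intro exI[of _ "min 1 (d/3)"] conjI allI impI)
    fix x t y s :: real assume a: "0 \<le> t" "0 \<le> y" "y \<le> min 1 (d/3)" "0 \<le> s" "s \<le> min 1 (d/3)"
    show "\<bar>g (x + y, t + s) - g (x,t)\<bar> \<le> e"
    proof (cases "\<bar>x\<bar> \<le> R + 1 \<and> t \<le> T + 1")
      case True
      have "dist (x+y,t+s) (x,t) \<le> \<bar>y\<bar> + \<bar>s\<bar>"
        by (simp add: dist_Pair_Pair dist_real_def sqrt_sum_squares_le_sum_abs)
      also have "\<dots> < d" using a \<open>d > 0\<close> by auto
      finally have "dist (g (x+y,t+s)) (g (x,t)) < e"
        using True a by (intro d) (auto simp: K_def abs_le_iff)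
      then show ?thesis by (simp add: dist_real_def)
    next
      case False
      then have "g (x,t) = 0" "g (x+y,t+s) = 0" using a by (auto intro!: supp)
      then show ?thesis using \<open>0 < e\<close> by simp
    qed
  qed (use \<open>d > 0\<close> in auto)
qed

text \<open>After translation by (x, t) the kernel confines the variable to the square of side
  \<epsilon>, so for nonnegative t only values of \<psi> at nonnegative times occur. In this form
  derivatives can be put on \<psi> instead of on the kernel.\<close>

lemma mollify2_half_plane:
  assumes \<psi>: "continuous_on (UNIV \<times> {0..}) \<psi>"
    and supp: "\<And>x t. 0 \<le> t \<Longrightarrow> R < \<bar>x\<bar> \<or> T < t \<Longrightarrow> \<psi> (x,t) = 0"
    and \<rho>: "\<And>x. \<rho> x \<noteq> 0 \<Longrightarrow> 0 < x \<and> x < \<epsilon>" and t: "0 \<le> t"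
  shows "mollify2 (-R,0) (R,T) \<psi> \<rho> \<rho> (x,t) = 
    integral (cbox (0,0) (\<epsilon>,\<epsilon>)) (\<lambda>q. \<psi> (x + fst q, t + snd q) * (\<rho> (fst q) * \<rho> (snd q)))"
proof -
  \<comment> \<open>At negative times \<psi> is unconstrained. Cutting it off there changes nothing
    in the box and makes the integrand vanish outside the box.\<close>
  define G where "G q = (if 0 \<le> snd q then \<psi> q * (\<rho> (fst q - x) * \<rho> (snd q - t)) else 0)" for q
  have "mollify2 (-R,0) (R,T) \<psi> \<rho> \<rho> (x,t) = integral (cbox (-R,0) (R,T)) G"
    unfolding mollify2_def by (intro integral_cong) (auto simp: G_def)
  also have "\<dots> = integral UNIV G"
  proof -
    have "G q = 0" if "q \<notin> cbox (-R,0) (R,T)" for q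
    proof (cases q)
      case (Pair a b)
      then have "0 \<le> b \<Longrightarrow> R < \<bar>a\<bar> \<or> T < b" using that by (auto simp: abs_if split: if_splits)
      then show ?thesis using supp[of b a] by (auto simp: G_def Pair)
    qed
    then have "(\<lambda>q. if q \<in> cbox (-R,0) (R,T) then G q else 0) = G" by auto
    then show ?thesis by (metis integral_restrict_UNIV)
  qed
  also have "\<dots> = integral (cbox (x,t) (x+\<epsilon>,t+\<epsilon>)) G"
  proof -
    have "G q = 0" if "q \<notin> cbox (x,t) (x+\<epsilon>,t+\<epsilon>)" for q
    proof (cases q)
      case (Pair a b)
      then have "\<not> (0 < a - x \<and> a - x < \<epsilon>) \<or> \<not> (0 < b - t \<and> b - t < \<epsilon>)" using that by auto
      then have "\<rho> (a - x) = 0 \<or> \<rho> (b - t) = 0" using \<rho> by blast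
      then show ?thesis by (auto simp: G_def Pair)
    qed
    then have "(\<lambda>q. if q \<in> cbox (x,t) (x+\<epsilon>,t+\<epsilon>) then G q else 0) = G" by auto
    then show ?thesis by (metis integral_restrict_UNIV)
  qed
  also have "\<dots> = integral (cbox (0,0) (\<epsilon>,\<epsilon>)) (\<lambda>q. G (q + (x,t)))"
    using integral_shift_cbox[of "(x,t)" "(x,t)" "(x+\<epsilon>,t+\<epsilon>)" G] by (simp add: zero_prod_def)
  also have "\<dots> = integral (cbox (0,0) (\<epsilon>,\<epsilon>)) (\<lambda>q. \<psi> (x + fst q, t + snd q) * (\<rho> (fst q) * \<rho> (snd q)))"
  proof (rule integral_cong)
    fix q assume "q \<in> cbox (0::real,0::real) (\<epsilon>,\<epsilon>)"
    then show "G (q + (x,t)) = \<psi> (x + fst q, t + snd q) * (\<rho> (fst q) * \<rho> (snd q))"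
      using t by (cases q) (auto simp: G_def add.commute)
  qed
  finally show ?thesis .
qed

lemma has_field_derivative_unique_within:
  fixes f :: "real \<Rightarrow> real"
  assumes "(f has_field_derivative A) (at x within S)" "(f has_field_derivative B) (at x within S)"
    "at x within S \<noteq> bot"
  shows "A = B"
  using assms tendsto_unique unfolding has_field_derivative_iff by blast

lemma at_within_atLeast_neq_bot: "0 \<le> t \<Longrightarrow> at t within {0::real..} \<noteq> bot"
proof -
  assume "0 \<le> t"
  then have "at_right t \<le> at t within {0..}" by (intro at_le) auto
  then show ?thesis by (metis bot.extremum_uniqueI trivial_limit_at_right_real)
qed

text \<open>The kernel is supported in positive times, so the approximation on the closed half plane
  only sees values of \<open>\<psi>\<close> there and needs no extension of \<open>\<psi>\<close> to negative times.\<close>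
lemma smooth_approximation_half_plane:
  fixes \<psi> \<psi>x \<psi>t :: "real \<times> real \<Rightarrow> real"
  assumes c: "continuous_on (UNIV \<times> {0..}) \<psi>" "continuous_on (UNIV \<times> {0..}) \<psi>x" "continuous_on (UNIV \<times> {0..}) \<psi>t"
    and dx: "\<And>x t. 0 \<le> t \<Longrightarrow> ((\<lambda>y. \<psi> (y,t)) has_real_derivative \<psi>x (x,t)) (at x)"
    and dt: "\<And>x t. 0 \<le> t \<Longrightarrow> ((\<lambda>s. \<psi> (x,s)) has_real_derivative \<psi>t (x,t)) (at t within {0..})"
    and supp: "\<And>x t. 0 \<le> t \<Longrightarrow> R < \<bar>x\<bar> \<or> T < t \<Longrightarrow> \<psi> (x,t) = 0"
      "\<And>x t. 0 \<le> t \<Longrightarrow> R < \<bar>x\<bar> \<or> T < t \<Longrightarrow> \<psi>x (x,t) = 0"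
      "\<And>x t. 0 \<le> t \<Longrightarrow> R < \<bar>x\<bar> \<or> T < t \<Longrightarrow> \<psi>t (x,t) = 0"
    and "0 < e"
  shows "\<exists>f. test_fun2 f \<and> (\<forall>p. f p \<noteq> 0 \<longrightarrow> \<bar>fst p\<bar> \<le> R + 1 \<and> snd p \<le> T) \<and>
    (\<forall>x t. 0 \<le> t \<longrightarrow> \<bar>f (x,t) - \<psi> (x,t)\<bar> \<le> e \<and> \<bar>px f (x,t) - \<psi>x (x,t)\<bar> \<le> e \<and> \<bar>pt f (x,t) - \<psi>t (x,t)\<bar> \<le> e)"
proof -
  obtain d1 where d1: "d1 > 0" "d1 \<le> 1" "\<And>x t y s. 0 \<le> t \<Longrightarrow> 0 \<le> y \<Longrightarrow> y \<le> d1 \<Longrightarrow> 0 \<le> s \<Longrightarrow> s \<le> d1 \<Longrightarrow> \<bar>\<psi> (x + y, t + s) - \<psi> (x,t)\<bar> \<le> e"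
    using uniform_continuity_half_plane[OF c(1) supp(1) \<open>0 < e\<close>] by blast
  obtain d2 where d2: "d2 > 0" "d2 \<le> 1" "\<And>x t y s. 0 \<le> t \<Longrightarrow> 0 \<le> y \<Longrightarrow> y \<le> d2 \<Longrightarrow> 0 \<le> s \<Longrightarrow> s \<le> d2 \<Longrightarrow> \<bar>\<psi>x (x + y, t + s) - \<psi>x (x,t)\<bar> \<le> e"
    using uniform_continuity_half_plane[OF c(2) supp(2) \<open>0 < e\<close>] by blast
  obtain d3 where d3: "d3 > 0" "d3 \<le> 1" "\<And>x t y s. 0 \<le> t \<Longrightarrow> 0 \<le> y \<Longrightarrow> y \<le> d3 \<Longrightarrow> 0 \<le> s \<Longrightarrow> s \<le> d3 \<Longrightarrow> \<bar>\<psi>t (x + y, t + s) - \<psi>t (x,t)\<bar> \<le> e"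
    using uniform_continuity_half_plane[OF c(3) supp(3) \<open>0 < e\<close>] by blast
  define \<epsilon> where "\<epsilon> = min d1 (min d2 d3)"
  have \<epsilon>: "0 < \<epsilon>" "\<epsilon> \<le> 1" using d1 d2 d3 by (auto simp: \<epsilon>_def)
  obtain \<rho> where \<rho>: "smooth_fun \<rho>" "\<And>x. 0 \<le> \<rho> x" "\<And>x. \<rho> x \<noteq> 0 \<Longrightarrow> 0 < x \<and> x < \<epsilon>" "integral {0..\<epsilon>} \<rho> = 1"
    using exists_smooth_kernel[OF \<epsilon>] by blast
  have c\<rho>: "continuous_on S (\<lambda>q. \<rho> (g q))" if "continuous_on S g" for S and g :: "real \<times> real \<Rightarrow> real"
    using continuous_on_compose2[OF smooth_fun_continuous[OF \<rho>(1), of UNIV] that] by auto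
  define K where "K q = \<rho> (fst q) * \<rho> (snd q)" for q
  have K: "continuous_on S K" "\<And>q. 0 \<le> K q" for S 
    using \<rho>(2) by (auto simp: K_def intro!: continuous_intros c\<rho>)
  let ?B = "cbox (0::real,0::real) (\<epsilon>,\<epsilon>)"
  have K1: "(K has_integral 1) ?B"
  proof -
    have "integral ?B K = integral (cbox 0 \<epsilon>) (\<lambda>x. integral (cbox 0 \<epsilon>) (\<lambda>y. K (x, y)))"
      by (rule integral_prod_continuous) (rule K)
    also have "\<dots> = 1" using \<rho>(4) by (simp add: K_def)
    finally show ?thesis using K by (metis integrable_continuous integrable_integral)
  qed
  define f where "f = mollify2 (-R,0) (R,T) \<psi> \<rho> \<rho>"
  have cB: "continuous_on (cbox (-R,0) (R,T)) \<psi>"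
    by (rule continuous_on_subset[OF c(1)]) auto
  have f_diff: "(f has_derivative (\<lambda>v. - mollify2 (-R,0) (R,T) \<psi> (deriv \<rho>) \<rho> p * fst v + - mollify2 (-R,0) (R,T) \<psi> \<rho> (deriv \<rho>) p * snd v)) (at p)" for p
    using mollify2_has_derivative[OF cB \<rho>(1) \<rho>(1), of p] by (simp add: f_def)
  \<comment> \<open>The kernel is a probability density, so an average differs from the value at the
    corner (x, t) by at most the oscillation over the square.\<close>
  have avg: "\<bar>integral ?B (\<lambda>q. g (x + fst q, t + snd q) * K q) - g (x,t)\<bar> \<le> e"
    if g: "continuous_on (UNIV \<times> {0..}) g" "0 \<le> t"
      "\<And>y s. 0 \<le> y \<Longrightarrow> y \<le> \<epsilon> \<Longrightarrow> 0 \<le> s \<Longrightarrow> s \<le> \<epsilon> \<Longrightarrow> \<bar>g (x + y, t + s) - g (x,t)\<bar> \<le> e" for g x t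
  proof -
    have i: "(\<lambda>q. g (x + fst q, t + snd q) * K q) integrable_on ?B"
      using \<open>0 \<le> t\<close> by (auto intro!: integrable_continuous continuous_intros K continuous_on_compose2[OF g(1)])
    have "((\<lambda>q. g (x + fst q, t + snd q) * K q - g (x,t) * K q) has_integral
       integral ?B (\<lambda>q. g (x + fst q, t + snd q) * K q) - g (x,t) * 1) ?B"
      by (intro has_integral_diff integrable_integral i has_integral_mult_right K1)
    moreover have "((\<lambda>q. e * K q) has_integral e * 1) ?B" by (intro has_integral_mult_right K1)
    moreover have "norm (g (x + fst q, t + snd q) * K q - g (x,t) * K q) \<le> e * K q" if "q \<in> ?B" for q
    proof -
      have "\<bar>g (x + fst q, t + snd q) - g (x,t)\<bar> * K q \<le> e * K q"
        using that K(2) by (cases q) (auto intro!: mult_right_mono g(3))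
      then show ?thesis using K(2)[of q] by (simp add: abs_mult flip: left_diff_distrib)
    qed
    ultimately show ?thesis
      using integral_norm_bound_integral[of "\<lambda>q. g (x + fst q, t + snd q) * K q - g (x,t) * K q" ?B "\<lambda>q. e * K q"]
      using integral_unique[OF K1] by (simp add: has_integral_iff)
  qed
  have f_eq: "f (x,t) = integral ?B (\<lambda>q. \<psi> (x + fst q, t + snd q) * K q)" if "0 \<le> t" for x t
    unfolding f_def K_def by (rule mollify2_half_plane[OF c(1) supp(1) \<rho>(3) that])
  have i\<psi>: "(\<lambda>q. \<psi> (x + fst q, t + snd q) * K q) integrable_on ?B" if "0 \<le> t" for x t
    using \<open>0 \<le> t\<close> by (auto intro!: integrable_continuous continuous_intros K continuous_on_compose2[OF c(1)])
  have px_f: "px f (x,t) = integral ?B (\<lambda>q. \<psi>x (x + fst q, t + snd q) * K q)" if t: "0 \<le> t" for x t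
  proof -
    have "((\<lambda>x. integral ?B (\<lambda>q. \<psi> (x + fst q, t + snd q) * K q)) has_real_derivative
       integral ?B (\<lambda>q. \<psi>x (x + fst q, t + snd q) * K q)) (at x within UNIV)"
    proof (rule leibniz_rule_field_derivative)
      fix x q assume "q \<in> ?B"
      then have "0 \<le> t + snd q" using t by (cases q) auto
      from DERIV_shift[THEN iffD1, OF dx[OF this, of "x + fst q"]]
      show "((\<lambda>x. \<psi> (x + fst q, t + snd q) * K q) has_real_derivative \<psi>x (x + fst q, t + snd q) * K q) (at x within UNIV)"
        by (intro DERIV_cmult_right) simp
    next
      show "continuous_on (UNIV \<times> ?B) (\<lambda>(x, q). \<psi>x (x + fst q, t + snd q) * K q)"
        unfolding case_prod_beta using t
        by (intro continuous_intros continuous_on_compose2[OF K(1)[of UNIV]] continuous_on_compose2[OF c(2)]) auto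
    qed (use i\<psi> t in auto)
    then show ?thesis using t by (auto simp: px_def f_eq intro: DERIV_imp_deriv)
  qed
  have pt_f: "pt f (x,t) = integral ?B (\<lambda>q. \<psi>t (x + fst q, t + snd q) * K q)" if t: "0 \<le> t" for x t
  proof -
    have "((\<lambda>t. integral ?B (\<lambda>q. \<psi> (x + fst q, t + snd q) * K q)) has_real_derivative
       integral ?B (\<lambda>q. \<psi>t (x + fst q, t + snd q) * K q)) (at t within {0..})"
    proof (rule leibniz_rule_field_derivative)
      fix t q assume "q \<in> ?B" and t: "t \<in> {0::real..}"
      then have nn: "0 \<le> snd q" by (cases q) auto
      have "((\<lambda>s. \<psi> (x + fst q, s)) has_real_derivative \<psi>t (x + fst q, t + snd q)) (at (t + snd q) within (\<lambda>t. t + snd q) ` {0..})"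
        using nn t by (intro DERIV_subset[OF dt]) auto
      moreover have "((\<lambda>t. t + snd q) has_real_derivative 1) (at t within {0..})"
        by (auto intro!: derivative_eq_intros)
      ultimately have "((\<lambda>t. \<psi> (x + fst q, t + snd q)) has_real_derivative \<psi>t (x + fst q, t + snd q) * 1) (at t within {0..})"
        using DERIV_image_chain[unfolded o_def, of "\<lambda>s. \<psi> (x + fst q, s)" _ "\<lambda>t. t + snd q" t "{0..}" 1] by blast
      then have "((\<lambda>t. \<psi> (x + fst q, t + snd q)) has_real_derivative \<psi>t (x + fst q, t + snd q)) (at t within {0..})"
        by simp
      then show "((\<lambda>t. \<psi> (x + fst q, t + snd q) * K q) has_real_derivative \<psi>t (x + fst q, t + snd q) * K q) (at t within {0..})"
        by (intro DERIV_cmult_right)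
    next
      show "continuous_on ({0..} \<times> ?B) (\<lambda>(t, q). \<psi>t (x + fst q, t + snd q) * K q)"
        unfolding case_prod_beta using t
        by (intro continuous_intros continuous_on_compose2[OF K(1)[of UNIV]] continuous_on_compose2[OF c(3)]) auto
    qed (use i\<psi> t in auto)
    \<comment> \<open>Differentiation under the integral is available only one-sidedly in time. As
      \<open>f\<close> is differentiable on the whole plane, its full time derivative coincides with
      the one-sided one, also at t = 0.\<close>
    then have 1: "((\<lambda>t. f (x,t)) has_real_derivative
       integral ?B (\<lambda>q. \<psi>t (x + fst q, t + snd q) * K q)) (at t within {0..})"
      by (rule has_field_derivative_transform_within[where d=1]) (use t f_eq in auto)
    have "((\<lambda>t. f (x,t)) has_real_derivative pt f (x,t)) (at t)"
      using has_derivative_imp_DERIV_snd[OF f_diff[of "(x,t)"]] by (simp add: pt_def DERIV_imp_deriv)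
    then have 2: "((\<lambda>t. f (x,t)) has_real_derivative pt f (x,t)) (at t within {0..})"
      by (rule has_field_derivative_at_within)
    show ?thesis by (rule has_field_derivative_unique_within[OF 2 1 at_within_atLeast_neq_bot[OF t]])
  qed
  have f_supp: "\<bar>fst p\<bar> \<le> R + 1 \<and> -1 \<le> snd p \<and> snd p \<le> T" if "f p \<noteq> 0" for p
  proof (rule ccontr)
    assume not: "\<not> ?thesis"
    have "f p = integral (cbox (-R,0) (R,T)) (\<lambda>q. 0)"
      unfolding f_def mollify2_def
    proof (rule integral_cong)
      fix q assume "q \<in> cbox (-R,0) (R,T)"
      then show "\<psi> q * (\<rho> (fst q - fst p) * \<rho> (snd q - snd p)) = 0"
        using not \<rho>(3)[of "fst q - fst p"] \<rho>(3)[of "snd q - snd p"] \<epsilon> by (cases q; cases p) force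
    qed
    with \<open>f p \<noteq> 0\<close> show False by simp
  qed
  have "test_fun2 f"
    unfolding test_fun2_def
  proof (intro conjI exI[of _ "R + 1 + (1 + \<bar>T\<bar>)"] allI impI)
    show "smooth2 f" unfolding f_def by (intro smooth2_mollify2 cB \<rho>)
    fix p assume "f p \<noteq> 0"
    then show "norm p \<le> R + 1 + (1 + \<bar>T\<bar>)"
      using f_supp[of p] norm_Pair_le[of "fst p" "snd p"] by (simp; arith)
  qed
  moreover have "\<bar>f (x,t) - \<psi> (x,t)\<bar> \<le> e \<and> \<bar>px f (x,t) - \<psi>x (x,t)\<bar> \<le> e \<and> \<bar>pt f (x,t) - \<psi>t (x,t)\<bar> \<le> e" if t: "0 \<le> t" for x t
    unfolding f_eq[OF t] px_f[OF t] pt_f[OF t] using t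
    by (intro conjI avg c d1(3) d2(3) d3(3)) (auto simp: \<epsilon>_def)
  ultimately show ?thesis using f_supp by (intro exI[of _ f]) auto
qed

section \<open>Weak derivatives on the line\<close>


lemma smooth_fun_slice:
  assumes "smooth2 f" shows "smooth_fun (\<lambda>x. f (x,t))"
proof (rule smooth_fun_coinduct[where C="{\<lambda>x. (px ^^ n) f (x,t) | n. True}"])
  fix g assume "g \<in> {\<lambda>x. (px ^^ n) f (x,t) | n. True}"
  then obtain n where g: "g = (\<lambda>x. (px ^^ n) f (x,t))" by blast
  have fold: "fold (\<lambda>b g. if b then px g else pt g) (replicate n True) h = (px ^^ n) h" for h
    by (induction n arbitrary: h) (auto simp: funpow_swap1)
  have "(px ^^ n) f differentiable (at (x,t))" for x
    using assms[unfolded smooth2_def, rule_format, of "replicate n True"] by (simp add: fold Let_def)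
  then have "(\<lambda>x. (px ^^ n) f (x,t)) differentiable (at x)" for x
    using differentiable_compose[of "(px ^^ n) f" "\<lambda>x. (x,t)" x UNIV] by (auto intro!: derivative_intros)
  then have "(g has_real_derivative deriv g x) (at x)" for x
    unfolding g by (simp add: DERIV_deriv_iff_real_differentiable)
  moreover have "deriv g = (\<lambda>x. (px ^^ (Suc n)) f (x,t))"
    by (auto simp: g px_def)
  ultimately show "\<exists>g'\<in>{\<lambda>x. (px ^^ n) f (x,t) | n. True}. \<forall>x. (g has_real_derivative g' x) (at x)"
    by (intro bexI[of _ "deriv g"]) blast+
qed (auto intro: exI[of _ 0])

text \<open>The half-plane approximation is applied to b(x) \<rho>(t)/\<rho>(t0) and restricted to
  the line t = t0, where the second factor is 1.\<close>

lemma smooth_approximation_real: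
  fixes b b' :: "real \<Rightarrow> real"
  assumes d: "\<And>x. (b has_real_derivative b' x) (at x)" and c: "continuous_on UNIV b'"
    and supp: "\<And>x. R < \<bar>x\<bar> \<Longrightarrow> b x = 0" "\<And>x. R < \<bar>x\<bar> \<Longrightarrow> b' x = 0"
    and "0 < e"
  shows "\<exists>f. test_fun1 f \<and> (\<forall>x. f x \<noteq> 0 \<longrightarrow> \<bar>x\<bar> \<le> R + 1) \<and> (\<forall>x. \<bar>f x - b x\<bar> \<le> e \<and> \<bar>deriv f x - b' x\<bar> \<le> e)"
proof -
  obtain \<rho> where \<rho>: "smooth_fun \<rho>" "\<And>x. \<rho> x \<noteq> 0 \<Longrightarrow> 0 < x \<and> x < 1" "integral {0..1} \<rho> = 1"
    using exists_smooth_kernel[of 1] by auto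
  obtain t0 where t0: "\<rho> t0 \<noteq> 0" "0 < t0" 
  proof (rule ccontr)
    assume "\<not> thesis"
    then have "\<rho> = (\<lambda>_. 0)" using \<rho>(2) that by blast
    then show False using \<rho>(3) by simp
  qed
  have b: "continuous_on UNIV b" using d by (meson DERIV_isCont continuous_at_imp_continuous_on)
  note c\<rho> = smooth_fun_continuous[OF \<rho>(1)] smooth_fun_continuous[OF smooth_fun_deriv[OF \<rho>(1)]]
  have d\<rho>0: "deriv \<rho> t = 0" if "1 < t" for t
  proof -
    have "((\<lambda>_. 0) has_real_derivative 0) (at t)" by simp
    then have "(\<rho> has_real_derivative 0) (at t)"
      by (rule has_field_derivative_transform_within_open[where S="{1<..}"]) (use that \<rho>(2) in force)+
    then show ?thesis by (rule DERIV_imp_deriv)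
  qed
  have "\<exists>f. test_fun2 f \<and> (\<forall>p. f p \<noteq> 0 \<longrightarrow> \<bar>fst p\<bar> \<le> R + 1 \<and> snd p \<le> 1) \<and>
    (\<forall>x t. 0 \<le> t \<longrightarrow> \<bar>f (x,t) - (\<lambda>(x,t). b x * (\<rho> t / \<rho> t0)) (x,t)\<bar> \<le> e \<and> \<bar>px f (x,t) - (\<lambda>(x,t). b' x * (\<rho> t / \<rho> t0)) (x,t)\<bar> \<le> e \<and> \<bar>pt f (x,t) - (\<lambda>(x,t). b x * (deriv \<rho> t / \<rho> t0)) (x,t)\<bar> \<le> e)"
  proof (rule smooth_approximation_half_plane)
    show "((\<lambda>y. case (y, t) of (x, t) \<Rightarrow> b x * (\<rho> t / \<rho> t0)) has_real_derivative (case (x, t) of (x, t) \<Rightarrow> b' x * (\<rho> t / \<rho> t0))) (at x)" for x t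
      by (auto intro!: derivative_eq_intros d simp del: times_divide_eq_right)
    show "((\<lambda>s. case (x, s) of (x, t) \<Rightarrow> b x * (\<rho> t / \<rho> t0)) has_real_derivative (case (x, t) of (x, t) \<Rightarrow> b x * (deriv \<rho> t / \<rho> t0))) (at t within {0..})" for x t
      using t0 smooth_fun_DERIV[OF \<rho>(1), THEN has_field_derivative_at_within]
      by (auto intro!: derivative_eq_intros)
    show "continuous_on (UNIV \<times> {0..}) (\<lambda>(x,t). b x * (\<rho> t / \<rho> t0))"
      "continuous_on (UNIV \<times> {0..}) (\<lambda>(x,t). b' x * (\<rho> t / \<rho> t0))"
      "continuous_on (UNIV \<times> {0..}) (\<lambda>(x,t). b x * (deriv \<rho> t / \<rho> t0))"
      unfolding case_prod_beta using t0
      by (intro continuous_intros continuous_on_compose2[OF b] continuous_on_compose2[OF c]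
         continuous_on_compose2[OF c\<rho>(1)[of UNIV]] continuous_on_compose2[OF c\<rho>(2)[of UNIV]]; simp)+
    fix x t :: real assume "R < \<bar>x\<bar> \<or> 1 < t"
    moreover have "\<rho> t = 0" if "1 < t" using \<rho>(2)[of t] that by (meson less_asym)
    ultimately show "(\<lambda>(x,t). b x * (\<rho> t / \<rho> t0)) (x, t) = 0" "(\<lambda>(x,t). b' x * (\<rho> t / \<rho> t0)) (x, t) = 0"
      "(\<lambda>(x,t). b x * (deriv \<rho> t / \<rho> t0)) (x, t) = 0"
      using supp[of x] d\<rho>0[of t] by auto
  qed (rule \<open>0 < e\<close>)
  then obtain f where f': "test_fun2 f" "\<forall>p. f p \<noteq> 0 \<longrightarrow> \<bar>fst p\<bar> \<le> R + 1 \<and> snd p \<le> 1"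
    "\<forall>x t. 0 \<le> t \<longrightarrow> \<bar>f (x,t) - (\<lambda>(x,t). b x * (\<rho> t / \<rho> t0)) (x,t)\<bar> \<le> e \<and>
       \<bar>px f (x,t) - (\<lambda>(x,t). b' x * (\<rho> t / \<rho> t0)) (x,t)\<bar> \<le> e \<and> \<bar>pt f (x,t) - (\<lambda>(x,t). b x * (deriv \<rho> t / \<rho> t0)) (x,t)\<bar> \<le> e"
    by (elim exE conjE)
  have f: "test_fun2 f" "\<And>p. f p \<noteq> 0 \<Longrightarrow> \<bar>fst p\<bar> \<le> R + 1 \<and> snd p \<le> 1"
    using f'(1,2) by blast+
  have f3: "\<bar>f (x,t0) - b x\<bar> \<le> e \<and> \<bar>px f (x,t0) - b' x\<bar> \<le> e" for x
    using f'(3)[rule_format, of t0 x] t0 by simp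
  show ?thesis
  proof (intro exI[of _ "\<lambda>x. f (x,t0)"] conjI allI impI)
    have "f (x,t0) = 0" if "R + 1 < \<bar>x\<bar>" for x using f(2)[of "(x,t0)"] that by auto
    then show "test_fun1 (\<lambda>x. f (x,t0))" using smooth_fun_slice[of f t0] f(1) by (auto simp: test_fun1_def test_fun2_def)
    show "\<bar>x\<bar> \<le> R + 1" if "f (x,t0) \<noteq> 0" for x using f(2)[OF that] by simp
  qed (use f3 in \<open>auto simp: px_def\<close>)
qed

section \<open>Local integrability and continuously differentiable test functions on the
  line\<close>

definition locally_integrable :: "(real \<Rightarrow> real) \<Rightarrow> bool" where
  "locally_integrable f \<longleftrightarrow> f \<in> borel_measurable borel \<and> (\<forall>R. integrable lborel (\<lambda>x. indicator {-R..R} x * f x))"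

lemma indicator_symmetric_interval: "indicator {-R..R} x = (if \<bar>x\<bar> \<le> R then 1 else (0::real))" for x R :: real
  by (auto simp: indicator_def)

lemma integrable_indicator_Icc: "integrable lborel (indicator {a..b} :: real \<Rightarrow> real)"
  by (intro integrable_real_indicator) (auto simp: emeasure_lborel_Icc_eq)

lemma integrable_mult_bounded_measurable:
  fixes F w :: "'a \<Rightarrow> real"
  assumes "integrable M F" "w \<in> borel_measurable M" "\<And>x. \<bar>w x\<bar> \<le> C"
  shows "integrable M (\<lambda>x. F x * w x)"
proof (rule Bochner_Integration.integrable_bound)
  show "integrable M (\<lambda>x. C * F x)" using assms by simp
  show "(\<lambda>x. F x * w x) \<in> borel_measurable M" using assms by measurable
  show "AE x in M. norm (F x * w x) \<le> norm (C * F x)"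
    using assms(3) abs_ge_self by (auto simp: abs_mult mult.commute[of C] intro!: AE_I2 mult_left_mono intro: order_trans)
qed

lemma continuous_vanishing_bounded:
  fixes g :: "real \<Rightarrow> real"
  assumes "continuous_on UNIV g" "\<And>x. R < \<bar>x\<bar> \<Longrightarrow> g x = 0"
  obtains B where "0 \<le> B" "\<And>x. \<bar>g x\<bar> \<le> B"
proof -
  obtain B where B: "\<And>x. x \<in> {-R..R} \<Longrightarrow> \<bar>g x\<bar> \<le> B"
    by (rule compact_continuous_bounded[OF compact_Icc continuous_on_subset[OF assms(1)]]) auto
  have "\<bar>g x\<bar> \<le> max 0 B" for x
  proof (cases "R < \<bar>x\<bar>")
    case False
    then have "x \<in> {-R..R}" by (simp; arith)
    from B[OF this] show ?thesis by simp
  qed (use assms(2) in simp)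
  then show ?thesis using that[of "max 0 B"] by auto
qed

lemma continuous_imp_locally_integrable:
  assumes "continuous_on UNIV f" shows "locally_integrable f"
  using borel_integrable_atLeastAtMost'[OF continuous_on_subset[OF assms]] borel_measurable_continuous_onI[OF assms]
  by (auto simp: locally_integrable_def set_integrable_def)

lemma locally_integrable_mult:
  assumes f: "locally_integrable f" and g: "continuous_on UNIV g" "\<And>x. R < \<bar>x\<bar> \<Longrightarrow> g x = 0"
  shows "integrable lborel (\<lambda>x. f x * g x)"
proof -
  obtain B where "0 \<le> B" and B: "\<And>x. \<bar>g x\<bar> \<le> B" using continuous_vanishing_bounded[OF g] by blast
  have "integrable lborel (\<lambda>x. indicator {-R..R} x * f x * g x)"
    using f borel_measurable_continuous_onI[OF g(1)] B
    by (intro integrable_mult_bounded_measurable[where C=B and F="\<lambda>x. indicator {-R..R} x * f x"]) (auto simp: locally_integrable_def)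
  moreover have "indicator {-R..R} x * f x * g x = f x * g x" for x
    using g(2)[of x] by (auto simp: indicator_symmetric_interval)
  ultimately show ?thesis by simp
qed

text \<open>Testing against all compactly supported C^1 functions rather than smooth ones makes the
  notion stable under C^1 coefficients: the product of a test function with such a coefficient is
  again admissible.\<close>

definition C1_weak_derivative :: "(real \<Rightarrow> real) \<Rightarrow> (real \<Rightarrow> real) \<Rightarrow> bool" where
  "C1_weak_derivative f g \<longleftrightarrow>
     (\<forall>b b' R. (\<forall>x. (b has_real_derivative b' x) (at x)) \<longrightarrow> continuous_on UNIV b' \<longrightarrow>
       (\<forall>x. R < \<bar>x\<bar> \<longrightarrow> b x = 0) \<longrightarrow> (\<forall>x. R < \<bar>x\<bar> \<longrightarrow> b' x = 0) \<longrightarrow>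
       (LINT x|lborel. f x * b' x) = - (LINT x|lborel. g x * b x))"

lemma C1_weak_derivativeI:
  assumes "\<And>b b' R. (\<And>x. (b has_real_derivative b' x) (at x)) \<Longrightarrow> continuous_on UNIV b' \<Longrightarrow>
      (\<And>x. R < \<bar>x\<bar> \<Longrightarrow> b x = 0) \<Longrightarrow> (\<And>x. R < \<bar>x\<bar> \<Longrightarrow> b' x = 0) \<Longrightarrow>
      (LINT x|lborel. f x * b' x) = - (LINT x|lborel. g x * b x)"
  shows "C1_weak_derivative f g"
  unfolding C1_weak_derivative_def
proof (intro allI impI)
  fix b b' R
  assume "\<forall>x. (b has_real_derivative b' x) (at x)" "continuous_on UNIV b'"
    "\<forall>x. R < \<bar>x\<bar> \<longrightarrow> b x = 0" "\<forall>x. R < \<bar>x\<bar> \<longrightarrow> b' x = 0"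
  then show "(LINT x|lborel. f x * b' x) = - (LINT x|lborel. g x * b x)"
    by (intro assms[where R=R]) auto
qed

lemma C1_weak_derivativeD:
  assumes "C1_weak_derivative f g" "\<And>x. (b has_real_derivative b' x) (at x)" "continuous_on UNIV b'"
    "\<And>x. R < \<bar>x\<bar> \<Longrightarrow> b x = 0" "\<And>x. R < \<bar>x\<bar> \<Longrightarrow> b' x = 0"
  shows "(LINT x|lborel. f x * b' x) = - (LINT x|lborel. g x * b x)"
  by (rule assms(1)[unfolded C1_weak_derivative_def, rule_format]) (use assms(2-) in auto)

text \<open>The smooth approximations are uniformly close together with their derivatives and share
  the window \<open>R + 1\<close>, so the defect \<open>D\<close> is at most \<open>e\<close> times
  a constant independent of \<open>e\<close>.\<close>

lemma weak_deriv1_imp_C1_weak_derivative: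
  assumes w: "weak_deriv1 f g" and f: "locally_integrable f" and g: "locally_integrable g"
  shows "C1_weak_derivative f g"
proof (rule C1_weak_derivativeI)
  fix b b' R
  assume d: "\<And>x. (b has_real_derivative b' x) (at x)" and c: "continuous_on UNIV b'"
    and supp: "\<And>x. R < \<bar>x\<bar> \<Longrightarrow> b x = 0" "\<And>x. R < \<bar>x\<bar> \<Longrightarrow> b' x = 0"
  let ?I = "indicator {-(R+1)..R+1} :: real \<Rightarrow> real"
  define M where "M = (LINT x|lborel. ?I x * \<bar>f x\<bar> + ?I x * \<bar>g x\<bar>)"
  have intM: "integrable lborel (\<lambda>x. ?I x * \<bar>f x\<bar>)" "integrable lborel (\<lambda>x. ?I x * \<bar>g x\<bar>)"
    using f[unfolded locally_integrable_def, THEN conjunct2, rule_format, of "R+1", THEN integrable_abs]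
      g[unfolded locally_integrable_def, THEN conjunct2, rule_format, of "R+1", THEN integrable_abs]
    by (auto simp: abs_mult)
  have b: "continuous_on UNIV b" using d by (meson DERIV_isCont continuous_at_imp_continuous_on)
  define D where "D = (LINT x|lborel. f x * b' x) + (LINT x|lborel. g x * b x)"
  have "\<bar>D\<bar> \<le> e * M" if "e > 0" for e
  proof -
    obtain h where h: "test_fun1 h" "\<And>x. h x \<noteq> 0 \<Longrightarrow> \<bar>x\<bar> \<le> R + 1" "\<And>x. \<bar>h x - b x\<bar> \<le> e" "\<And>x. \<bar>deriv h x - b' x\<bar> \<le> e"
      using smooth_approximation_real[OF d c supp \<open>e > 0\<close>] by blast
    have sm: "smooth_fun h" using h(1) by (simp add: test_fun1_def)
    have h0: "h x = 0" if "R + 1 < \<bar>x\<bar>" for x using h(2)[of x] that by auto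
    have h0': "deriv h x = 0" if "R + 1 < \<bar>x\<bar>" for x
    proof -
      have "((\<lambda>_. 0) has_real_derivative 0) (at x)" by simp
      then have "(h has_real_derivative 0) (at x)"
        by (rule has_field_derivative_transform_within_open[where S="{y. R + 1 < \<bar>y\<bar>}"])
           (use that h0 in \<open>auto intro!: open_Collect_less continuous_intros\<close>)
      then show ?thesis by (rule DERIV_imp_deriv)
    qed
    have i: "integrable lborel (\<lambda>x. f x * deriv h x)" "integrable lborel (\<lambda>x. g x * h x)"
      "integrable lborel (\<lambda>x. f x * b' x)" "integrable lborel (\<lambda>x. g x * b x)"
      by (auto intro!: locally_integrable_mult[where R="R+1"] f g c b smooth_fun_continuous sm smooth_fun_deriv simp: supp h0 h0')
    have "(LINT x|lborel. f x * deriv h x) + (LINT x|lborel. g x * h x) = 0"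
      using w h(1) by (simp add: weak_deriv1_def)
    then have D: "D = (LINT x|lborel. (f x * b' x - f x * deriv h x) + (g x * b x - g x * h x))"
      unfolding D_def using i by simp
    have "norm (LINT x|lborel. (f x * b' x - f x * deriv h x) + (g x * b x - g x * h x))
        \<le> (LINT x|lborel. e * (?I x * \<bar>f x\<bar> + ?I x * \<bar>g x\<bar>))"
    proof (rule Bochner_Integration.integral_norm_bound_integral)
      fix x :: real
      show "norm ((f x * b' x - f x * deriv h x) + (g x * b x - g x * h x)) \<le> e * (?I x * \<bar>f x\<bar> + ?I x * \<bar>g x\<bar>)"
      proof (cases "R + 1 < \<bar>x\<bar>")
        case False
        have "norm ((f x * b' x - f x * deriv h x) + (g x * b x - g x * h x)) \<le> \<bar>f x\<bar> * \<bar>deriv h x - b' x\<bar> + \<bar>g x\<bar> * \<bar>h x - b x\<bar>"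
          unfolding real_norm_def by (rule order_trans[OF abs_triangle_ineq]) (simp add: abs_minus_commute flip: right_diff_distrib abs_mult)
        also have "\<dots> \<le> \<bar>f x\<bar> * e + \<bar>g x\<bar> * e" by (intro add_mono mult_left_mono h) auto
        finally have "norm ((f x * b' x - f x * deriv h x) + (g x * b x - g x * h x)) \<le> \<bar>f x\<bar> * e + \<bar>g x\<bar> * e" .
        moreover have "?I x = 1" using False by (subst indicator_symmetric_interval) simp
        ultimately show ?thesis by (simp add: algebra_simps)
      qed (use \<open>e > 0\<close> in \<open>simp add: h0 h0' supp add_nonneg_nonneg\<close>)
    qed (use i intM in auto)
    then show ?thesis by (simp add: D M_def)
  qed
  then have "D = 0" by (rule abs_le_all_mult_imp_zero)
  then show "(LINT x|lborel. f x * b' x) = - (LINT x|lborel. g x * b x)" by (simp add: D_def)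
qed

section \<open>The du Bois-Reymond lemma\<close>

lemma integral_continuous_compact_support:
  fixes k :: "real \<Rightarrow> real"
  assumes k: "continuous_on UNIV k" "\<And>x. R < \<bar>x\<bar> \<Longrightarrow> k x = 0"
  shows "integrable lborel k" "(LINT x|lborel. k x) = integral {-R..R} k"
proof -
  have 1: "indicator {-R..R} x * k x = k x" for x
    using k(2)[of x] by (auto simp: indicator_symmetric_interval)
  have si: "set_integrable lborel {-R..R} k"
    by (rule borel_integrable_atLeastAtMost') (rule continuous_on_subset[OF k(1)], simp)
  then show "integrable lborel k" by (simp add: set_integrable_def 1)
  show "(LINT x|lborel. k x) = integral {-R..R} k"
    using set_borel_integral_eq_integral(2)[OF si] by (simp add: set_lebesgue_integral_def 1)
qed

lemma integral_superset_zero: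
  fixes k :: "real \<Rightarrow> real"
  assumes "S \<subseteq> T" "\<And>x. x \<in> T \<Longrightarrow> x \<notin> S \<Longrightarrow> k x = 0"
  shows "integral T k = integral S k"
proof -
  have "(\<lambda>x. if x \<in> T then k x else 0) = (\<lambda>x. if x \<in> S then k x else 0)"
  proof
    fix x show "(if x \<in> T then k x else 0) = (if x \<in> S then k x else 0)"
      using assms(1) assms(2)[of x] by (cases "x \<in> S") auto
  qed
  then show ?thesis by (metis integral_restrict_UNIV)
qed

text \<open>Mean zero is what makes the primitive vanish to the right of the support as
  well.\<close>

lemma compactly_supported_primitive:
  fixes k :: "real \<Rightarrow> real"
  assumes k: "continuous_on UNIV k" "\<And>x. R < \<bar>x\<bar> \<Longrightarrow> k x = 0" and k0: "(LINT x|lborel. k x) = 0"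
  shows "\<exists>b. (\<forall>x. (b has_real_derivative k x) (at x)) \<and> (\<forall>x. R < \<bar>x\<bar> \<longrightarrow> b x = 0)"
proof -
  \<comment> \<open>Starting one unit to the left of the support makes every x \<ge> -R interior to
    an interval of integration.\<close>
  define b where "b x = integral {-R-1..x} k" for x
  have left: "b x = 0" if "x < -R" for x
  proof -
    have "b x = integral {-R-1..x} (\<lambda>_. 0)"
      unfolding b_def by (rule integral_cong) (use that k(2) in auto)
    then show ?thesis by simp
  qed
  have right: "b x = 0" if "R < x" for x
  proof -
    have "b x = integral {-R..R} k"
      unfolding b_def by (rule integral_superset_zero) (use that k(2) in \<open>auto simp: abs_if\<close>)
    then show ?thesis using integral_continuous_compact_support(2)[OF k] k0 by simp
  qed
  have "(b has_real_derivative k x) (at x)" for x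
  proof (cases "x < -R")
    case True
    have "((\<lambda>_. 0) has_real_derivative k x) (at x)" using k(2)[of x] True by simp
    then show ?thesis
      by (rule has_field_derivative_transform_within_open[where S="{..<-R}"]) (use True left in auto)
  next
    case False
    have "(b has_real_derivative k x) (at x within {-R-1..x+1})"
      unfolding b_def by (rule integral_has_real_derivative) (use False continuous_on_subset[OF k(1)] in auto)
    moreover have "at x within {-R-1..x+1} = at x" using False by (intro at_within_interior) auto
    ultimately show ?thesis by simp
  qed
  then show ?thesis using left right by (intro exI[of _ b]) (auto simp: abs_if split: if_splits)
qed

text \<open>Integrals of \<open>w - C\<close> against continuous compactly supported functions vanish for a suitable \<open>C\<close>; the sign of
  \<open>w - C\<close> is an almost everywhere limit of such functions, up to a cutoff.\<close>
lemma weak_derivative_zero_imp_constant: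
  assumes w: "locally_integrable w"
    and z: "C1_weak_derivative w (\<lambda>_. 0)"
  shows "\<exists>C. AE x in lborel. w x = C"
proof -
  obtain \<rho> where \<rho>: "smooth_fun \<rho>" "\<And>x. \<rho> x \<noteq> 0 \<Longrightarrow> 0 < x \<and> x < 1" "integral {0..1} \<rho> = 1"
    using exists_smooth_kernel[of 1] by auto
  have \<rho>1: "\<rho> x = 0" if "1 < \<bar>x\<bar>" for x
  proof (rule ccontr)
    assume "\<rho> x \<noteq> 0"
    from \<rho>(2)[OF this] that show False by auto
  qed
  have c\<rho>: "continuous_on UNIV \<rho>" by (rule smooth_fun_continuous[OF \<rho>(1)])
  have I\<rho>: "(LINT x|lborel. \<rho> x) = 1"
  proof -
    have "integral {-1..1} \<rho> = integral {0..1} \<rho>"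
    proof (rule integral_superset_zero)
      fix x :: real assume "x \<notin> {0..1}"
      then have "\<not> (0 < x \<and> x < 1)" by auto
      then show "\<rho> x = 0" using \<rho>(2) by blast
    qed simp
    then show ?thesis unfolding \<rho>(3) using integral_continuous_compact_support(2)[OF c\<rho> \<rho>1] by (simp only:)
  qed
  define C where "C = (LINT x|lborel. w x * \<rho> x)"
  \<comment> \<open>Subtracting \<open>m * \<rho>\<close> from \<open>k\<close> leaves mean zero,
    hence a compactly supported primitive. Testing the vanishing weak derivative with this primitive
    shows that \<open>w\<close> and the constant \<open>C\<close> have the same pairing with
    \<open>k\<close>.\<close>
  have orth: "(LINT x|lborel. (w x - C) * k x) = 0"
    if k: "continuous_on UNIV k" "\<And>x. R < \<bar>x\<bar> \<Longrightarrow> k x = 0" for k R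
  proof -
    define m where "m = (LINT x|lborel. k x)"
    note ik = integral_continuous_compact_support(1)[OF k] integral_continuous_compact_support(1)[OF c\<rho> \<rho>1]
      locally_integrable_mult[OF w k] locally_integrable_mult[OF w c\<rho> \<rho>1]
    have "(LINT x|lborel. k x - m * \<rho> x) = 0"
      using ik I\<rho> by (simp add: m_def)
    moreover have "continuous_on UNIV (\<lambda>x. k x - m * \<rho> x)" by (intro continuous_intros k c\<rho>)
    moreover have zz: "k x - m * \<rho> x = 0" if "max R 1 < \<bar>x\<bar>" for x using that k(2) \<rho>1 by auto
    ultimately obtain b where "\<And>x. (b has_real_derivative k x - m * \<rho> x) (at x)" "\<And>x. max R 1 < \<bar>x\<bar> \<Longrightarrow> b x = 0"
      using compactly_supported_primitive[of "\<lambda>x. k x - m * \<rho> x" "max R 1"] by blast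
    from C1_weak_derivativeD[OF z, where R="max R 1", OF this(1) \<open>continuous_on UNIV (\<lambda>x. k x - m * \<rho> x)\<close> this(2) zz]
    have "(LINT x|lborel. w x * (k x - m * \<rho> x)) = 0" by simp
    then have "(LINT x|lborel. w x * k x - m * (w x * \<rho> x)) = 0" by (simp add: algebra_simps)
    then have "(LINT x|lborel. w x * k x) = m * C" using ik by (simp add: C_def)
    then have "(LINT x|lborel. w x * k x - C * k x) = 0" using ik by (simp add: m_def)
    then show ?thesis by (simp add: algebra_simps)
  qed
  have wm: "w \<in> borel_measurable borel" using w by (simp add: locally_integrable_def)
  define s where "s x = sgn (w x - C)" for x
  have sm: "s \<in> borel_measurable borel" unfolding s_def using wm by measurable
  then have "s \<in> borel_measurable lebesgue" by (intro measurable_completion) simp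
  then have "s measurable_on UNIV" by (simp add: lebesgue_measurable_imp_measurable_on)
  then obtain N g where g: "negligible N" "\<And>n. continuous_on UNIV (g n)" "\<And>x. x \<notin> N \<Longrightarrow> (\<lambda>n. g n x) \<longlonglongrightarrow> s x"
    unfolding measurable_on_def by auto
  have "AE x in completion lborel. x \<notin> N" using g(1) by (simp add: negligible_iff_null_sets AE_not_in)
  then have aeN: "AE x in lborel. x \<notin> N" by (simp only: AE_completion_iff)
  have "AE x in lborel. \<bar>x\<bar> \<le> real R \<longrightarrow> w x = C" for R :: nat
  proof -
    define cut where "cut x = max 0 (min 1 (real R + 1 - \<bar>x\<bar>))" for x :: real
    have cut: "continuous_on UNIV cut" "\<And>x. real R + 1 < \<bar>x\<bar> \<Longrightarrow> cut x = 0" "\<And>x. 0 \<le> cut x" "\<And>x. \<bar>x\<bar> \<le> real R \<Longrightarrow> cut x = 1"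
      by (auto simp: cut_def[abs_def] intro!: continuous_intros)
    \<comment> \<open>Clamping to [-1, 1] does not alter the limit, a sign, and supplies the
      dominating function; \<open>cut\<close> gives compact support.\<close>
    define k where "k n x = max (-1) (min 1 (g n x)) * cut x" for n x
    have k: "continuous_on UNIV (k n)" "\<And>x. real R + 1 < \<bar>x\<bar> \<Longrightarrow> k n x = 0" for n
      using cut(1,2) g(2) by (auto simp: k_def[abs_def] intro!: continuous_intros)
    have wC: "integrable lborel (\<lambda>x. \<bar>(w x - C) * cut x\<bar>)"
    proof -
      have "integrable lborel (\<lambda>x. w x * cut x - C * cut x)"
        using locally_integrable_mult[OF w cut(1,2)] integral_continuous_compact_support(1)[OF cut(1,2)] by simp
      then show ?thesis by (simp add: left_diff_distrib)
    qed
    have km: "k n \<in> borel_measurable borel" for n using k(1) by (rule borel_measurable_continuous_onI)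
    have cm: "cut \<in> borel_measurable borel" using cut(1) by (rule borel_measurable_continuous_onI)
    have "(\<lambda>n. (LINT x|lborel. (w x - C) * k n x)) \<longlonglongrightarrow> (LINT x|lborel. (w x - C) * (s x * cut x))"
    proof (rule integral_dominated_convergence[OF _ _ wC])
      show "AE x in lborel. (\<lambda>n. (w x - C) * k n x) \<longlonglongrightarrow> (w x - C) * (s x * cut x)"
        using aeN
      proof eventually_elim
        case (elim x)
        have "(\<lambda>n. (w x - C) * (max (-1) (min 1 (g n x)) * cut x)) \<longlonglongrightarrow> (w x - C) * (max (-1) (min 1 (s x)) * cut x)"
          by (intro tendsto_intros g(3) elim)
        moreover have "max (-1) (min 1 (s x)) = s x" by (simp add: s_def sgn_if)
        ultimately show ?case by (simp add: k_def)
      qed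
      show "AE x in lborel. norm ((w x - C) * k n x) \<le> \<bar>(w x - C) * cut x\<bar>" for n
      proof (rule AE_I2)
        fix x
        have "\<bar>k n x\<bar> \<le> 1 * cut x" unfolding k_def abs_mult using cut(3) by (intro mult_mono) auto
        then show "norm ((w x - C) * k n x) \<le> \<bar>(w x - C) * cut x\<bar>" using cut(3)[of x]
          by (auto simp: abs_mult intro!: mult_left_mono)
      qed
    qed (use wm km cm sm in measurable)
    moreover have "(LINT x|lborel. (w x - C) * k n x) = 0" for n using orth[OF k] .
    ultimately have "(LINT x|lborel. (w x - C) * (s x * cut x)) = 0" by (simp add: LIMSEQ_const_iff)
    moreover have "(w x - C) * (s x * cut x) = \<bar>(w x - C) * cut x\<bar>" for x
      using cut(3)[of x] by (simp add: s_def abs_mult sgn_if)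
    ultimately have "(LINT x|lborel. \<bar>(w x - C) * cut x\<bar>) = 0" by simp
    then have "AE x in lborel. \<bar>(w x - C) * cut x\<bar> = 0"
      using integral_nonneg_eq_0_iff_AE[OF wC] by simp
    then show ?thesis by eventually_elim (use cut(4) in force)
  qed
  then have "AE x in lborel. \<forall>R::nat. \<bar>x\<bar> \<le> real R \<longrightarrow> w x = C" unfolding AE_all_countable by blast
  then have "AE x in lborel. w x = C" by eventually_elim (meson real_arch_simple)
  then show ?thesis by blast
qed

section \<open>Primitives of locally integrable functions and continuous representatives\<close>

lemma integrable_prod_mult:
  fixes f g :: "real \<Rightarrow> real"
  assumes "integrable lborel f" "integrable lborel g"
  shows "integrable (lborel \<Otimes>\<^sub>M lborel) (\<lambda>(x, y). f x * g y)"
proof (rule lborel_pair.Fubini_integrable)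
  have [measurable]: "f \<in> borel_measurable borel" "g \<in> borel_measurable borel" using assms by auto
  show "(\<lambda>(x, y). f x * g y) \<in> borel_measurable (lborel \<Otimes>\<^sub>M lborel)" by measurable
  show "integrable lborel (\<lambda>x. LINT y|lborel. norm (case (x, y) of (x, y) \<Rightarrow> f x * g y))"
    using assms(1) by (simp add: abs_mult)
  show "AE x in lborel. integrable lborel (\<lambda>y. case (x, y) of (x, y) \<Rightarrow> f x * g y)"
    using assms(2) by simp
qed

text \<open>Fubini on the triangle y \<le> x turns the pairing of the indefinite integral with b'
  into minus the pairing of g with b.\<close>

lemma primitive_weak_derivative:
  assumes g: "locally_integrable g"
  shows "\<exists>G. continuous_on UNIV G \<and> (continuous_on UNIV g \<longrightarrow> (\<forall>x. (G has_real_derivative g x) (at x))) \<and>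
    C1_weak_derivative G g"
proof -
  have gm[measurable]: "g \<in> borel_measurable borel" using g by (simp add: locally_integrable_def)
  have si: "set_integrable lborel {-R..R} g" for R
    using g by (simp add: locally_integrable_def set_integrable_def)
  have sub: "set_integrable lborel {a..b} g" for a b
  proof -
    have "{a..b} \<subseteq> {-(\<bar>a\<bar> + \<bar>b\<bar>)..\<bar>a\<bar> + \<bar>b\<bar>}" by auto
    then show ?thesis using si set_integrable_subset by (metis sets_lborel atLeastAtMost_borel)
  qed
  have gi: "g integrable_on {a..b}" for a b
    using set_borel_integral_eq_integral(1)[OF sub] .
  \<comment> \<open>An integral over an empty interval is 0, so the difference is the signed
    integral from 0 to x.\<close>
  define G where "G x = integral {0..x} g - integral {x..0} g" for x
  have G_eq: "G x = integral {-R..x} g - integral {-R..0} g" if "-R \<le> x" "0 \<le> R" for x R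
  proof (cases "0 \<le> x")
    case True
    then have "integral {-R..0} g + integral {0..x} g = integral {-R..x} g"
      by (intro Henstock_Kurzweil_Integration.integral_combine gi) (use that in auto)
    moreover have "integral {x..0} g = 0" using True by (cases "x = 0") auto
    ultimately show ?thesis by (simp add: G_def)
  next
    case False
    then have "integral {-R..x} g + integral {x..0} g = integral {-R..0} g"
      by (intro Henstock_Kurzweil_Integration.integral_combine gi) (use that in auto)
    then show ?thesis using False by (simp add: G_def)
  qed
  have "isCont G x" for x
  proof -
    define R where "R = \<bar>x\<bar> + 1"
    have R: "0 \<le> R" "x \<in> {-R<..<R}" by (auto simp: R_def)
    have "continuous_on {-R..R} (\<lambda>x. integral {-R..x} g - integral {-R..0} g)"
      by (intro continuous_intros indefinite_integral_continuous_1 gi)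
    then have "continuous_on {-R..R} G"
      by (rule continuous_on_eq) (use G_eq[of R] R in auto)
    then show ?thesis by (rule continuous_on_interior) (use R in auto)
  qed
  moreover have "(G has_real_derivative g x) (at x)" if c: "continuous_on UNIV g" for x
  proof -
    define R where "R = \<bar>x\<bar> + 1"
    have R: "0 \<le> R" "x \<in> {-R<..<R}" by (auto simp: R_def)
    have "((\<lambda>x. integral {-R..x} g - integral {-R..0} g) has_real_derivative g x - 0) (at x within {-R..R})"
      using R by (intro DERIV_diff[OF integral_has_real_derivative[OF continuous_on_subset[OF c]] DERIV_const]) auto
    moreover have "at x within {-R..R} = at x"
      using R by (intro at_within_interior) auto
    ultimately have "((\<lambda>x. integral {-R..x} g - integral {-R..0} g) has_real_derivative g x) (at x)"
      by (simp only: diff_0_right)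
    then show ?thesis
      by (rule has_field_derivative_transform_within_open[where S="{-R<..<R}"]) (use R G_eq[of R] in auto)
  qed
  ultimately have cG: "continuous_on UNIV G" and dG: "continuous_on UNIV g \<longrightarrow> (\<forall>x. (G has_real_derivative g x) (at x))"
    by (simp_all add: continuous_at_imp_continuous_on)
  have "C1_weak_derivative G g"
  proof (rule C1_weak_derivativeI)
    fix b b' R0
    assume d: "\<And>x. (b has_real_derivative b' x) (at x)" and c: "continuous_on UNIV b'"
      and s: "\<And>x. R0 < \<bar>x\<bar> \<Longrightarrow> b x = 0" "\<And>x. R0 < \<bar>x\<bar> \<Longrightarrow> b' x = 0"
    define Q where "Q = \<bar>R0\<bar> + 1"
    have Q: "0 \<le> Q" "R0 < Q" by (auto simp: Q_def)
    have s': "b x = 0" "b' x = 0" if "Q \<le> \<bar>x\<bar>" for x using s that Q by auto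
    have ftc: "(LINT x|lborel. indicator {y..Q} x *\<^sub>R b' x) = b Q - b y" if "y \<le> Q" for y
      using that d continuous_on_subset[OF c]
      by (intro integral_FTC_atLeastAtMost)
        (auto simp: has_real_derivative_iff_has_vector_derivative[symmetric] intro: has_field_derivative_at_within)
    have cm[measurable]: "b' \<in> borel_measurable borel" using c by (rule borel_measurable_continuous_onI)
    obtain B where B: "0 \<le> B" "\<And>x. \<bar>b' x\<bar> \<le> B"
      using continuous_vanishing_bounded[OF c, of Q] s' by (metis less_imp_le)
    define I where "I x = (LINT y|lborel. indicator {-Q..x} y * g y)" for x
    have G_I: "G x = I x - I 0" if "-Q \<le> x" for x
      using G_eq[OF that Q(1)] set_borel_integral_eq_integral(2)[OF sub, of "-Q"]
      by (simp add: I_def set_lebesgue_integral_def)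
    \<comment> \<open>\<open>F\<close> lives on the triangle: integrating over x gives
      \<open>g y * (b Q - b y)\<close>, integrating over y gives \<open>b' x\<close> times the
      indefinite integral of \<open>g\<close> started at -Q.\<close>
    define F where "F x y = (if -Q \<le> y \<and> y \<le> x \<and> x \<le> Q then g y * b' x else 0)" for x y
    have "integrable (lborel \<Otimes>\<^sub>M lborel) (case_prod F)"
    proof (rule Bochner_Integration.integrable_bound)
      show "integrable (lborel \<Otimes>\<^sub>M lborel) (\<lambda>(x, y). (B * indicator {-Q..Q} x) * (indicator {-Q..Q} y * g y))"
        using si[of Q] by (intro integrable_prod_mult) (auto simp: set_integrable_def integrable_indicator_Icc)
      show "case_prod F \<in> borel_measurable (lborel \<Otimes>\<^sub>M lborel)" unfolding F_def by measurable
      show "AE p in lborel \<Otimes>\<^sub>M lborel. norm (case p of (x,y) \<Rightarrow> F x y) \<le> norm (case p of (x,y) \<Rightarrow> (B * indicator {-Q..Q} x) * (indicator {-Q..Q} y * g y))"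
        using B by (auto simp: F_def abs_mult mult.commute intro!: AE_I2 mult_right_mono)
    qed
    from lborel_pair.Fubini_integral[OF this]
    have "(LINT y|lborel. (LINT x|lborel. F x y)) = (LINT x|lborel. (LINT y|lborel. F x y))" .
    moreover have "(LINT x|lborel. F x y) = - (g y * b y)" for y
    proof (cases "-Q \<le> y \<and> y \<le> Q")
      case True
      then have "(LINT x|lborel. F x y) = (LINT x|lborel. g y * (indicator {y..Q} x *\<^sub>R b' x))"
        by (intro Bochner_Integration.integral_cong) (auto simp: F_def indicator_def)
      also have "\<dots> = g y * (b Q - b y)" using ftc[of y] True by simp
      finally show ?thesis using s'(1)[of Q] Q by simp
    next
      case False
      then have "F x y = 0" for x by (auto simp: F_def)
      moreover have "b y = 0" using False by (intro s') auto
      ultimately show ?thesis by simp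
    qed
    moreover have "(LINT y|lborel. F x y) = G x * b' x + I 0 * b' x" for x
    proof (cases "-Q \<le> x \<and> x \<le> Q")
      case True
      then have "(LINT y|lborel. F x y) = (LINT y|lborel. (indicator {-Q..x} y * g y) * b' x)"
        by (intro Bochner_Integration.integral_cong) (auto simp: F_def indicator_def)
      also have "\<dots> = I x * b' x" by (simp add: I_def)
      also have "I x = G x + I 0" using G_I[of x] True by simp
      finally show ?thesis by (simp add: algebra_simps)
    next
      case False
      then have "F x y = 0" for y by (auto simp: F_def)
      moreover have "b' x = 0" using False by (intro s') auto
      ultimately show ?thesis by simp
    qed
    ultimately have "(LINT y|lborel. - (g y * b y)) = (LINT x|lborel. G x * b' x + I 0 * b' x)" by simp
    also have "\<dots> = (LINT x|lborel. G x * b' x) + I 0 * (LINT x|lborel. b' x)"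
    proof -
      have k: "\<And>x. Q < \<bar>x\<bar> \<Longrightarrow> b' x = 0" using s' by auto
      have "integrable lborel (\<lambda>x. G x * b' x)" 
        by (rule integral_continuous_compact_support(1)[of _ Q]) (auto intro!: continuous_intros cG c simp: k)
      then show ?thesis using integral_continuous_compact_support(1)[OF c k] by simp
    qed
    \<comment> \<open>The base point -Q instead of 0 contributes the constant \<open>I 0\<close>,
      which drops out because b' integrates to 0.\<close>
    also have "(LINT x|lborel. b' x) = 0"
    proof -
      have "(\<lambda>x. indicator {-Q..Q} x *\<^sub>R b' x) = b'"
      proof
        fix x show "indicator {-Q..Q} x *\<^sub>R b' x = b' x"
          using s'(2)[of x] by (auto simp: indicator_symmetric_interval)
      qed
      from ftc[of "-Q", unfolded this] show ?thesis using s'(1)[of Q] s'(1)[of "-Q"] Q by simp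
    qed
    finally show "(LINT x|lborel. G x * b' x) = - (LINT x|lborel. g x * b x)" by simp
  qed
  then show ?thesis using cG dG by blast
qed

text \<open>The difference of f and a primitive of g has weak derivative 0, hence is constant almost
  everywhere. Repeated application converts weak derivatives into classical ones, from the highest
  order downwards.\<close>

lemma weak_deriv1_continuous_representative:
  assumes w: "weak_deriv1 f g" and f: "locally_integrable f" and g: "locally_integrable g"
  shows "\<exists>F. continuous_on UNIV F \<and> (AE x in lborel. f x = F x) \<and>
     (continuous_on UNIV g \<longrightarrow> (\<forall>x. (F has_real_derivative g x) (at x)))"
proof -
  obtain G where dG: "continuous_on UNIV g \<longrightarrow> (\<forall>x. (G has_real_derivative g x) (at x))" and G: "continuous_on UNIV G" "C1_weak_derivative G g"
    using primitive_weak_derivative[OF g] by blast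
  have Gl: "locally_integrable G" by (rule continuous_imp_locally_integrable[OF G(1)])
  have "locally_integrable (\<lambda>x. f x - G x)"
    using f Gl by (auto simp: locally_integrable_def right_diff_distrib)
  moreover have "C1_weak_derivative (\<lambda>x. f x - G x) (\<lambda>_. 0)"
  proof (rule C1_weak_derivativeI)
    fix b b' R
    assume k: "\<And>x. (b has_real_derivative b' x) (at x)" "continuous_on UNIV b'"
      "\<And>x. R < \<bar>x\<bar> \<Longrightarrow> b x = 0" "\<And>x. R < \<bar>x\<bar> \<Longrightarrow> b' x = 0"
    show "(LINT x|lborel. (f x - G x) * b' x) = - (LINT x|lborel. 0 * b x)"
      using C1_weak_derivativeD[OF weak_deriv1_imp_C1_weak_derivative[OF w f g] k] C1_weak_derivativeD[OF G(2) k]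
        locally_integrable_mult[OF f k(2,4)] locally_integrable_mult[OF Gl k(2,4)]
      by (simp add: left_diff_distrib)
  qed
  ultimately obtain C where "AE x in lborel. f x - G x = C"
    using weak_derivative_zero_imp_constant[of "\<lambda>x. f x - G x"] by blast
  then have "AE x in lborel. f x = C + G x" by (rule eventually_mono) simp
  moreover have "continuous_on UNIV (\<lambda>x. C + G x)" by (intro continuous_intros G(1))
  moreover have "((\<lambda>x. C + G x) has_real_derivative g x) (at x)" if "continuous_on UNIV g" for x
    using DERIV_add[OF DERIV_const dG[rule_format, OF that]] by simp
  ultimately show ?thesis by (intro exI[of _ "\<lambda>x. C + G x"]) blast
qed

lemma sq_integrable_imp_locally_integrable:
  assumes "sq_integrable f" shows "locally_integrable f"
  unfolding locally_integrable_def
proof (intro conjI allI)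
  show fm[measurable]: "f \<in> borel_measurable borel" using assms by (simp add: sq_integrable_def)
  fix R :: real
  show "integrable lborel (\<lambda>x. indicator {-R..R} x * f x)"
  proof (rule Bochner_Integration.integrable_bound)
    show "integrable lborel (\<lambda>x. indicator {-R..R} x + (f x)\<^sup>2)"
      using assms by (intro Bochner_Integration.integrable_add) (auto simp: sq_integrable_def integrable_indicator_Icc)
    show "AE x in lborel. norm (indicator {-R..R} x * f x) \<le> norm (indicator {-R..R} x + (f x)\<^sup>2)"
    proof (rule AE_I2)
      fix x
      have "0 \<le> (\<bar>f x\<bar> - 1)\<^sup>2 + \<bar>f x\<bar>\<^sup>2" by simp
      then have "\<bar>f x\<bar> \<le> 1 + (f x)\<^sup>2" by (simp add: power2_diff)
      then show "norm (indicator {-R..R} x * f x) \<le> norm (indicator {-R..R} x + (f x)\<^sup>2)"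
        by (auto simp: indicator_def)
    qed
  qed measurable
qed

lemma weak_deriv1_cong_AE:
  assumes "weak_deriv1 f g" "AE x in lborel. g x = h x" "locally_integrable g" "locally_integrable h"
  shows "weak_deriv1 f h"
  unfolding weak_deriv1_def
proof (intro allI impI)
  fix \<psi> assume \<psi>: "test_fun1 \<psi>"
  then have [measurable]: "\<psi> \<in> borel_measurable borel"
    by (auto simp: test_fun1_def intro!: borel_measurable_continuous_onI smooth_fun_continuous)
  have [measurable]: "g \<in> borel_measurable borel" "h \<in> borel_measurable borel"
    using assms by (auto simp: locally_integrable_def)
  have "(LINT x|lborel. g x * \<psi> x) = (LINT x|lborel. h x * \<psi> x)"
    by (rule integral_cong_AE) (use assms(2) in \<open>auto elim: eventually_mono\<close>)
  then show "(LINT x|lborel. f x * deriv \<psi> x) = - (LINT x|lborel. h x * \<psi> x)"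
    using assms(1) \<psi> by (simp add: weak_deriv1_def)
qed

lemma continuous_AE_eq_imp_eq:
  fixes f g :: "real \<Rightarrow> real"
  assumes "continuous_on UNIV f" "continuous_on UNIV g" "AE x in lborel. f x = g x"
  shows "f x = g x"
proof -
  have "closed {x. f x = g x}" using assms by (intro closed_Collect_eq)
  moreover have "AE x in lebesgue. x \<in> {x. f x = g x}" using assms(3) by (simp add: AE_completion)
  ultimately have "x \<in> {x. f x = g x}" by (rule mem_closed_if_AE_lebesgue)
  then show ?thesis by simp
qed

text \<open>Descends from order three: the second weak derivative has a continuous representative
  because a third exists, so the first is C^1 and the function itself C^2. The third derivative
  survives as the weak derivative \<open>g\<close> of \<phi>2.\<close>

lemma sobolevH_regularity:
  assumes "sobolevH s \<phi>" "3 \<le> s" "continuous_on UNIV \<phi>"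
  shows "\<exists>\<phi>1 \<phi>2 g. (\<forall>x. (\<phi> has_real_derivative \<phi>1 x) (at x)) \<and> (\<forall>x. (\<phi>1 has_real_derivative \<phi>2 x) (at x)) \<and>
    continuous_on UNIV \<phi>2 \<and> locally_integrable g \<and> C1_weak_derivative \<phi>2 g"
proof -
  have "3 \<le> nat \<lfloor>s\<rfloor>" using assms(2) by (simp add: le_nat_iff le_floor_iff)
  then obtain g where g0: "g 0 = \<phi>" and sq: "\<And>j. j \<le> 3 \<Longrightarrow> sq_integrable (g j)"
    and w: "\<And>j. j < 3 \<Longrightarrow> weak_deriv1 (g j) (g (Suc j))"
    using assms(1) unfolding sobolevH_def by (metis le_trans less_le_trans)
  have l: "locally_integrable (g j)" if "j \<le> 3" for j
    using sq that by (intro sq_integrable_imp_locally_integrable) auto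
  obtain F2 where F2: "continuous_on UNIV F2" "AE x in lborel. g 2 x = F2 x"
    using weak_deriv1_continuous_representative[OF w[of 2] l l] by auto
  have "weak_deriv1 (g 1) F2"
    using weak_deriv1_cong_AE[OF w[of 1] _ l] F2 by (simp add: numeral_2_eq_2 continuous_imp_locally_integrable)
  from weak_deriv1_continuous_representative[OF this l continuous_imp_locally_integrable[OF F2(1)]]
  obtain F1 where F1: "continuous_on UNIV F1" "AE x in lborel. g 1 x = F1 x" "\<And>x. (F1 has_real_derivative F2 x) (at x)"
    using F2(1) by auto
  have "weak_deriv1 (g 0) F1"
    using weak_deriv1_cong_AE[OF w[of 0] _ l] F1 by (simp add: continuous_imp_locally_integrable)
  from weak_deriv1_continuous_representative[OF this l continuous_imp_locally_integrable[OF F1(1)]]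
  obtain F0 where F0: "continuous_on UNIV F0" "AE x in lborel. g 0 x = F0 x" "\<And>x. (F0 has_real_derivative F1 x) (at x)"
    using F1(1) by auto
  \<comment> \<open>Continuous functions that agree almost everywhere are equal; this is where the
    continuity of \<phi> enters.\<close>
  have "\<phi> = F0"
  proof
    fix x show "\<phi> x = F0 x"
      by (rule continuous_AE_eq_imp_eq[OF assms(3) F0(1) F0(2)[unfolded g0]])
  qed
  moreover have "C1_weak_derivative F2 (g 3)"
  proof (rule C1_weak_derivativeI)
    fix b b' R
    assume k: "\<And>x. (b has_real_derivative b' x) (at x)" "continuous_on UNIV b'"
      "\<And>x. R < \<bar>x\<bar> \<Longrightarrow> b x = 0" "\<And>x. R < \<bar>x\<bar> \<Longrightarrow> b' x = 0"
    have [measurable]: "g 2 \<in> borel_measurable borel" "F2 \<in> borel_measurable borel" "b' \<in> borel_measurable borel"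
      using l[of 2] F2(1) k(2) by (auto simp: locally_integrable_def intro: borel_measurable_continuous_onI)
    have "(LINT x|lborel. F2 x * b' x) = (LINT x|lborel. g 2 x * b' x)"
      by (rule integral_cong_AE) (use F2(2) in \<open>auto elim: eventually_mono\<close>)
    also have "\<dots> = - (LINT x|lborel. g 3 x * b x)"
      using C1_weak_derivativeD[OF weak_deriv1_imp_C1_weak_derivative[OF w[of 2] l l] k] by (simp add: numeral_3_eq_3)
    finally show "(LINT x|lborel. F2 x * b' x) = - (LINT x|lborel. g 3 x * b x)" .
  qed
  ultimately show ?thesis using F0(3) F1(3) F2(1) l[of 3]
    by (intro exI[of _ F1] exI[of _ F2] exI[of _ "g 3"]) simp
qed

section \<open>Characteristics\<close>


text \<open>The energy z^2 exp(-2Ks) decreases and z^2 exp(2Ks) increases. Both directions of time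
  are covered because characteristics are followed forward from the initial line and backward from a
  later point.\<close>

lemma gronwall_zero:
  fixes z z' :: "real \<Rightarrow> real"
  assumes d: "\<And>s. s \<in> {\<alpha>..\<beta>} \<Longrightarrow> (z has_real_derivative z' s) (at s within {\<alpha>..\<beta>})"
    and b: "\<And>s. s \<in> {\<alpha>..\<beta>} \<Longrightarrow> \<bar>z' s\<bar> \<le> K * \<bar>z s\<bar>"
    and z0: "z \<alpha> = 0 \<or> z \<beta> = 0" and s: "s \<in> {\<alpha>..\<beta>}"
  shows "z s = 0"
proof -
  have zz': "\<bar>z s * z' s\<bar> \<le> K * (z s)^2" if "s \<in> {\<alpha>..\<beta>}" for s
    using mult_left_mono[OF b[OF that], of "\<bar>z s\<bar>"] by (simp add: abs_mult power2_eq_square mult.left_commute)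
  have E: "((\<lambda>s. (z s)^2 * exp (k * s)) has_real_derivative (2 * (z s * z' s) + k * (z s)^2) * exp (k * s)) (at s)"
    if "\<alpha> < s" "s < \<beta>" for s k
  proof -
    have "(z has_real_derivative z' s) (at s)"
      using d[of s] that at_within_interior[of s "{\<alpha>..\<beta>}"] by simp
    then show ?thesis by (auto intro!: derivative_eq_intros simp: algebra_simps)
  qed
  have c: "continuous_on {\<alpha>..\<beta>} (\<lambda>s. (z s)^2 * exp (k * s))" for k
    by (intro continuous_intros) (meson d DERIV_continuous continuous_on_eq_continuous_within)
  have "(z s)^2 * exp (2 * K * s) \<le> 0 \<or> (z s)^2 * exp (- 2 * K * s) \<le> 0"
    using z0
  proof
    assume z: "z \<alpha> = 0"
    have "(z s)^2 * exp (- 2 * K * s) \<le> (z \<alpha>)^2 * exp (- 2 * K * \<alpha>)"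
    proof (rule DERIV_nonpos_imp_decreasing_open[of \<alpha> s "\<lambda>s. (z s)^2 * exp (- 2 * K * s)"])
      show "continuous_on {\<alpha>..s} (\<lambda>s. (z s)^2 * exp (- 2 * K * s))" using s by (intro continuous_on_subset[OF c]) auto
      fix x assume x: "\<alpha> < x" "x < s"
      have "(2 * (z x * z' x) + (- 2 * K) * (z x)^2) * exp (- 2 * K * x) \<le> 0"
        using zz'[of x] x s by (intro mult_nonpos_nonneg) (auto simp: abs_le_iff)
      then show "\<exists>y. ((\<lambda>s. (z s)^2 * exp (- 2 * K * s)) has_real_derivative y) (at x) \<and> y \<le> 0"
        using E[of x "- 2 * K"] x s by (intro exI conjI) auto
    qed (use s in auto)
    then show ?thesis by (simp add: z)
  next
    assume z: "z \<beta> = 0"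
    have "(z s)^2 * exp (2 * K * s) \<le> (z \<beta>)^2 * exp (2 * K * \<beta>)"
    proof (rule DERIV_nonneg_imp_increasing_open[of s \<beta> "\<lambda>s. (z s)^2 * exp (2 * K * s)"])
      show "continuous_on {s..\<beta>} (\<lambda>s. (z s)^2 * exp (2 * K * s))" using s by (intro continuous_on_subset[OF c]) auto
      fix x assume x: "s < x" "x < \<beta>"
      have "0 \<le> (2 * (z x * z' x) + (2 * K) * (z x)^2) * exp (2 * K * x)"
        using zz'[of x] x s by (intro mult_nonneg_nonneg) (auto simp: abs_le_iff)
      then show "\<exists>y. ((\<lambda>s. (z s)^2 * exp (2 * K * s)) has_real_derivative y) (at x) \<and> 0 \<le> y"
        using E[of x "2 * K"] x s by (intro exI conjI) auto
    qed (use s in auto)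
    then show ?thesis by (simp add: z)
  qed
  then show ?thesis by (auto simp: mult_le_0_iff)
qed

text \<open>Continuity is required of one partial derivative, here the one in time; the domain UNIV
  \<times> S admits one-sided time derivatives at the boundary of \<open>S\<close>.\<close>

lemma has_derivative_continuous_partials:
  fixes f fx ft :: "real \<Rightarrow> real \<Rightarrow> real"
  assumes fx: "((\<lambda>y. f y t) has_real_derivative fx x t) (at x)"
    and ft: "\<And>x t. t \<in> S \<Longrightarrow> ((\<lambda>s. f x s) has_real_derivative ft x t) (at t within S)"
    and c: "continuous_on (UNIV \<times> S) (\<lambda>(x, t). ft x t)" and S: "t \<in> S" "convex S"
  shows "((\<lambda>(x, t). f x t) has_derivative (\<lambda>(h, k). fx x t * h + ft x t * k)) (at (x, t) within UNIV \<times> S)"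
proof -
  have "((\<lambda>(x, t). f x t) has_derivative (\<lambda>(h, k). fx x t * h + blinfun_mult_right (ft x t) k)) (at (x, t) within UNIV \<times> S)"
  proof (rule has_derivative_partialsI)
    show "((\<lambda>y. f y t) has_derivative (*) (fx x t)) (at x within UNIV)"
      using fx by (simp add: has_field_derivative_def)
    show "((\<lambda>s. f x s) has_derivative blinfun_apply (blinfun_mult_right (ft x t))) (at t within S)" if "t \<in> S" for x t
      using ft[OF that] by (simp add: has_field_derivative_def)
    have "continuous_on (UNIV \<times> S) (\<lambda>(x, t). blinfun_mult_right (ft x t))"
      using c unfolding case_prod_beta by (intro continuous_intros)
    then show "continuous (at (x, t) within UNIV \<times> S) (\<lambda>(x, t). blinfun_mult_right (ft x t))"
      using S by (simp add: continuous_on_eq_continuous_within)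
  qed (use S in auto)
  then show ?thesis by simp
qed

lemma has_real_derivative_along_curve:
  fixes f fx ft :: "real \<Rightarrow> real \<Rightarrow> real"
  assumes fx: "((\<lambda>y. f y t) has_real_derivative fx (g t) t) (at (g t))"
    and ft: "\<And>x t. t \<in> S \<Longrightarrow> ((\<lambda>s. f x s) has_real_derivative ft x t) (at t within S)"
    and c: "continuous_on (UNIV \<times> S) (\<lambda>(x, t). ft x t)" and S: "t \<in> S" "convex S"
    and g: "(g has_real_derivative g') (at t within S)"
  shows "((\<lambda>s. f (g s) s) has_real_derivative fx (g t) t * g' + ft (g t) t) (at t within S)"
proof -
  have "((\<lambda>s. (g s, s)) has_derivative (\<lambda>h. (g' * h, h))) (at t within S)"
    using g by (auto intro!: has_derivative_Pair simp: has_field_derivative_def)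
  moreover have "((\<lambda>(x, t). f x t) has_derivative (\<lambda>(h, k). fx (g t) t * h + ft (g t) t * k)) (at (g t, t) within (\<lambda>s. (g s, s)) ` S)"
    by (rule has_derivative_subset[OF has_derivative_continuous_partials[where x = "g t" and fx = fx, OF fx ft c S]]) auto
  ultimately have "((\<lambda>s. case (g s, s) of (x, t) \<Rightarrow> f x t) has_derivative
      (\<lambda>h. case (g' * h, h) of (h, k) \<Rightarrow> fx (g t) t * h + ft (g t) t * k)) (at t within S)"
    by (rule has_derivative_in_compose)
  then show ?thesis
    by (simp add: has_field_derivative_def) (rule has_derivative_eq_rhs, assumption, simp add: fun_eq_iff algebra_simps)
qed

section \<open>The solution along its characteristics\<close>

definition time_interval :: "ereal \<Rightarrow> real set" where
  "time_interval T = {t. 0 \<le> t \<and> ereal t < T}"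

lemma convex_time_interval: "convex (time_interval T)"
  unfolding convex_alt time_interval_def
proof (intro ballI allI impI)
  fix x y u :: real assume a: "x \<in> {t. 0 \<le> t \<and> ereal t < T}" "y \<in> {t. 0 \<le> t \<and> ereal t < T}" "0 \<le> u \<and> u \<le> 1"
  have "(1 - u) * x + u * y \<le> (1 - u) * max x y + u * max x y"
    using a by (intro add_mono mult_left_mono) auto
  also have "\<dots> = max x y" by (simp add: algebra_simps)
  finally have "ereal ((1 - u) * x + u * y) \<le> ereal (max x y)" by (simp only: ereal_less_eq)
  also have "\<dots> < T" using a by (auto simp: max_def)
  finally show "(1 - u) *\<^sub>R x + u *\<^sub>R y \<in> {t. 0 \<le> t \<and> ereal t < T}" using a by simp
qed

lemma strip_eq_Times: "strip T = UNIV \<times> time_interval T"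
  by (auto simp: strip_def time_interval_def)

lemma open_ereal_less: "open {t. ereal t < T}"
  by (cases T) (auto simp: lessThan_def[symmetric])

text \<open>The upper end of the interval is open, so near t only the bound at 0 is felt.\<close>

lemma at_within_time_interval: "t \<in> time_interval T \<Longrightarrow> at t within time_interval T = at t within {0..}"
  by (rule at_within_nhd[of _ "{t. ereal t < T}"]) (auto simp: time_interval_def open_ereal_less)

lemma time_interval_downward: "t \<in> time_interval T \<Longrightarrow> s \<in> {0..t} \<Longrightarrow> s \<in> time_interval T"
  unfolding time_interval_def by (auto intro: le_less_trans[of "ereal s" "ereal t"])

text \<open>Sobolev regularity enters through the two classical derivatives of \<phi>. The weak
  derivative of \<phi>2 is kept outside, as an assumption of the existence proof.\<close>

locale C2_transport =
  fixes a c \<phi> \<phi>1 \<phi>2 :: "real \<Rightarrow> real" and v vx vt :: "real \<Rightarrow> real \<Rightarrow> real" and T :: ereal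
  assumes a: "smooth_fun a" and c: "smooth_fun c"
    and \<phi>: "\<And>\<xi>. (\<phi> has_real_derivative \<phi>1 \<xi>) (at \<xi>)" and \<phi>1: "\<And>\<xi>. (\<phi>1 has_real_derivative \<phi>2 \<xi>) (at \<xi>)"
    and \<phi>2: "continuous_on UNIV \<phi>2"
    and vx: "\<And>x t. t \<in> time_interval T \<Longrightarrow> ((\<lambda>y. v y t) has_real_derivative vx x t) (at x)"
    and vt: "\<And>x t. t \<in> time_interval T \<Longrightarrow> ((\<lambda>s. v x s) has_real_derivative vt x t) (at t within {0..})"
    and transport: "\<And>x t. t \<in> time_interval T \<Longrightarrow> vt x t = a (v x t) * vx x t"
    and v_cont: "continuous_on (strip T) (\<lambda>(x,t). v x t)" "continuous_on (strip T) (\<lambda>(x,t). vx x t)"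
       "continuous_on (strip T) (\<lambda>(x,t). vt x t)"
    and v_0: "\<And>x. v x 0 = \<phi> x"
begin

abbreviation "a1 \<equiv> deriv a"
abbreviation "a2 \<equiv> deriv (deriv a)"
abbreviation "c1 \<equiv> deriv c"

definition b :: "real \<Rightarrow> real" where "b \<xi> = a1 (\<phi> \<xi>) * \<phi>1 \<xi>"
definition b1 :: "real \<Rightarrow> real" where "b1 \<xi> = a2 (\<phi> \<xi>) * (\<phi>1 \<xi>)^2 + a1 (\<phi> \<xi>) * \<phi>2 \<xi>"
text \<open>\<open>X\<close> is the characteristic starting at \<open>\<xi>\<close>, \<open>J\<close> its derivative in \<open>\<xi>\<close>, and \<open>\<Xi>\<close> the inverse of \<open>X\<close>.\<close>
definition X :: "real \<Rightarrow> real \<Rightarrow> real" where "X \<xi> t = \<xi> - t * a (\<phi> \<xi>)"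
definition J :: "real \<Rightarrow> real \<Rightarrow> real" where "J \<xi> t = 1 - t * b \<xi>"
definition \<Xi> :: "real \<Rightarrow> real \<Rightarrow> real" where "\<Xi> x t = x + t * a (v x t)"

lemmas a_DERIV = smooth_fun_DERIV[OF a] smooth_fun_DERIV[OF smooth_fun_deriv[OF a]]
  smooth_fun_DERIV[OF smooth_fun_deriv[OF smooth_fun_deriv[OF a]]]
lemmas c_DERIV = smooth_fun_DERIV[OF c] smooth_fun_DERIV[OF smooth_fun_deriv[OF c]]

lemma v_derivative_along_curve:
  assumes t: "t \<in> time_interval T" and g: "(g has_real_derivative g') (at t within time_interval T)"
  shows "((\<lambda>s. v (g s) s) has_real_derivative vx (g t) t * g' + vt (g t) t) (at t within time_interval T)"
proof (rule has_real_derivative_along_curve[where f=v and fx=vx and ft=vt, OF vx[OF t] _ _ t convex_time_interval g])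
  show "continuous_on (UNIV \<times> time_interval T) (\<lambda>(x, t). vt x t)" using v_cont(3) by (simp add: strip_eq_Times)
  show "((\<lambda>s. v x s) has_real_derivative vt x t) (at t within time_interval T)" if "t \<in> time_interval T" for x t
    using vt[OF that] that by (simp add: at_within_time_interval)
qed

lemma v_cont_curve:
  assumes "continuous_on S g" "continuous_on S h" "h ` S \<subseteq> time_interval T"
  shows "continuous_on S (\<lambda>s. v (g s) (h s))" "continuous_on S (\<lambda>s. vx (g s) (h s))"
  using continuous_on_compose2[OF v_cont(1), of S "\<lambda>s. (g s, h s)"]
    continuous_on_compose2[OF v_cont(2), of S "\<lambda>s. (g s, h s)"] assms
  by (auto simp: strip_eq_Times intro!: continuous_on_Pair)

text \<open>Along the line x0 - s a(w) the deviation y - w satisfies (y - w)' = (a(y) - a(w)) v_x,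
  which the mean value theorem bounds by a multiple of |y - w|. The disjunction serves two purposes:
  prescribing \<open>w\<close> at time 0 yields v(X, t) = \<phi>, prescribing it at time t yields
  \<phi>(\<Xi>) = v.\<close>

lemma characteristic_constant:
  assumes t: "t \<in> time_interval T" and w: "v x0 0 = w \<or> v (x0 - t * a w) t = w" and s: "s \<in> {0..t}"
  shows "v (x0 - s * a w) s = w"
proof -
  define y where "y s = v (x0 - s * a w) s" for s
  have sub: "{0..t} \<subseteq> time_interval T" using time_interval_downward[OF t] by blast
  have yc: "continuous_on {0..t} y" and xc: "continuous_on {0..t} (\<lambda>s. vx (x0 - s * a w) s)"
    unfolding y_def using sub by (auto intro!: v_cont_curve continuous_intros)
  obtain B where B: "\<And>s. s \<in> {0..t} \<Longrightarrow> \<bar>y s\<bar> \<le> B"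
    using compact_continuous_bounded[OF compact_Icc yc] by blast
  obtain M where M: "\<And>s. s \<in> {0..t} \<Longrightarrow> \<bar>vx (x0 - s * a w) s\<bar> \<le> M"
    using compact_continuous_bounded[OF compact_Icc xc] by blast
  \<comment> \<open>The interval must contain \<open>w\<close> and all values of \<open>y\<close>,
    so that the bound on \<open>a1\<close> over this convex set is a Lipschitz constant.\<close>
  define B' where "B' = max B \<bar>w\<bar>"
  obtain L where L: "\<And>u. u \<in> {-B'..B'} \<Longrightarrow> \<bar>a1 u\<bar> \<le> L"
    using compact_continuous_bounded[OF compact_Icc smooth_fun_continuous[OF smooth_fun_deriv[OF a]]] by blast
  have lip: "\<bar>a (y s) - a w\<bar> \<le> L * \<bar>y s - w\<bar>" if "s \<in> {0..t}" for s
  proof -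
    have "norm (a (y s) - a w) \<le> L * norm (y s - w)"
    proof (rule field_differentiable_bound[of "{-B'..B'}"])
      show "(a has_field_derivative a1 u) (at u within {-B'..B'})" for u
        by (rule has_field_derivative_at_within[OF a_DERIV(1)])
    qed (use L B[OF that] in \<open>auto simp: B'_def abs_le_iff max_def split: if_splits\<close>)
    then show ?thesis by simp
  qed
  have "y s - w = 0"
  proof (rule gronwall_zero[where z = "\<lambda>s. y s - w" and K = "L * M" and z' = "\<lambda>s. (a (y s) - a w) * vx (x0 - s * a w) s"])
    fix s assume s: "s \<in> {0..t}"
    then have st: "s \<in> time_interval T" using sub by blast
    have "((\<lambda>s. x0 - s * a w) has_real_derivative - a w) (at s within time_interval T)"
      by (auto intro!: derivative_eq_intros)
    from v_derivative_along_curve[OF st this]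
    have "(y has_real_derivative (a (y s) - a w) * vx (x0 - s * a w) s) (at s within time_interval T)"
      by (simp add: y_def[abs_def] transport[OF st] algebra_simps)
    then show "((\<lambda>s. y s - w) has_real_derivative (a (y s) - a w) * vx (x0 - s * a w) s) (at s within {0..t})"
      using sub by (auto intro!: derivative_eq_intros intro: DERIV_subset)
    have "\<bar>a (y s) - a w\<bar> * \<bar>vx (x0 - s * a w) s\<bar> \<le> (L * \<bar>y s - w\<bar>) * M"
      using lip[OF s] M[OF s] by (intro mult_mono) (auto intro: order_trans[OF abs_ge_zero])
    then show "\<bar>(a (y s) - a w) * vx (x0 - s * a w) s\<bar> \<le> L * M * \<bar>y s - w\<bar>"
      by (simp add: abs_mult mult_ac)
  next
    show "y 0 - w = 0 \<or> y t - w = 0" using w by (auto simp: y_def)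
  qed (rule s)
  then show ?thesis by (simp add: y_def)
qed

lemma v_X: "t \<in> time_interval T \<Longrightarrow> v (X \<xi> t) t = \<phi> \<xi>"
  using characteristic_constant[of t \<xi> "\<phi> \<xi>" t] by (auto simp: X_def v_0 time_interval_def)

lemma \<phi>_\<Xi>: "t \<in> time_interval T \<Longrightarrow> \<phi> (\<Xi> x t) = v x t"
  using characteristic_constant[of t "\<Xi> x t" "v x t" 0] by (auto simp: \<Xi>_def v_0 time_interval_def)

lemma \<Xi>_X: "t \<in> time_interval T \<Longrightarrow> \<Xi> (X \<xi> t) t = \<xi>"
  by (simp add: \<Xi>_def v_X) (simp add: X_def)

lemma X_\<Xi>: "t \<in> time_interval T \<Longrightarrow> X (\<Xi> x t) t = x"
  by (simp add: X_def \<phi>_\<Xi>) (simp add: \<Xi>_def)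

lemma \<phi>_cont: "continuous_on S \<phi>" "continuous_on S \<phi>1"
  by (meson \<phi> \<phi>1 DERIV_isCont continuous_at_imp_continuous_on)+

lemma b_DERIV: "(b has_real_derivative b1 \<xi>) (at \<xi>)"
  unfolding b_def[abs_def] b1_def
  by (auto intro!: derivative_eq_intros DERIV_chain2[OF a_DERIV(2)] \<phi> \<phi>1 simp: power2_eq_square algebra_simps)

lemma X_DERIV: "((\<lambda>\<xi>. X \<xi> t) has_real_derivative J \<xi> t) (at \<xi>)"
  unfolding X_def J_def b_def by (auto intro!: derivative_eq_intros DERIV_chain2[OF a_DERIV(1)] \<phi>)

lemma vx_X_mult_J: assumes t: "t \<in> time_interval T" shows "vx (X \<xi> t) t * J \<xi> t = \<phi>1 \<xi>"
proof -
  have "((\<lambda>\<xi>. v (X \<xi> t) t) has_real_derivative vx (X \<xi> t) t * J \<xi> t) (at \<xi>)"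
    by (rule DERIV_chain2[OF vx[OF t] X_DERIV])
  then show ?thesis using \<phi>[of \<xi>] by (auto simp: v_X[OF t] dest: DERIV_unique)
qed

text \<open>This is the source of the denominators in the closed formula. The product form is
  available before \<open>J\<close> is known to be nonzero, and in fact proves it.\<close>

lemma J_mult: "t \<in> time_interval T \<Longrightarrow> (1 + t * (a1 (\<phi> \<xi>) * vx (X \<xi> t) t)) * J \<xi> t = 1"
proof -
  assume t: "t \<in> time_interval T"
  have "(1 + t * (a1 (\<phi> \<xi>) * vx (X \<xi> t) t)) * J \<xi> t = J \<xi> t + t * (a1 (\<phi> \<xi>) * (vx (X \<xi> t) t * J \<xi> t))"
    by (simp add: algebra_simps)
  also have "\<dots> = 1" unfolding vx_X_mult_J[OF t] by (simp add: J_def b_def)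
  finally show ?thesis .
qed

text \<open>\<open>J\<close> equals 1 at time 0, is continuous in time and has no zero, since a
  multiple of it equals 1; the intermediate value theorem does the rest. Positivity thus comes from
  the existence of the solution up to T.\<close>

lemma J_pos: assumes t: "t \<in> time_interval T" shows "0 < J \<xi> t"
proof (rule ccontr)
  assume "\<not> 0 < J \<xi> t"
  then have "J \<xi> t \<le> 0" by simp
  moreover have "0 \<le> t" using t by (simp add: time_interval_def)
  moreover have "continuous_on {0..t} (J \<xi>)" unfolding J_def by (intro continuous_intros)
  ultimately obtain s where s: "s \<in> {0..t}" "J \<xi> s = 0"
    using IVT2'[of "J \<xi>" t 0 0] by (auto simp: J_def)
  then show False using J_mult[OF time_interval_downward[OF t s(1)], of \<xi>] by simp
qed

lemma mem_strip_iff: "(x, t) \<in> strip T \<longleftrightarrow> t \<in> time_interval T"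
  by (simp add: strip_eq_Times)

lemma J_nonzero: "\<forall>p\<in>strip T. J (fst p) (snd p) \<noteq> 0" "\<forall>p\<in>strip T. J (\<Xi> (fst p) (snd p)) (snd p) \<noteq> 0"
proof -
  have "J \<xi> (snd p) \<noteq> 0" if "p \<in> strip T" for \<xi> p
    using J_pos[of "snd p" \<xi>] that by (cases p) (simp add: mem_strip_iff)
  then show "\<forall>p\<in>strip T. J (fst p) (snd p) \<noteq> 0" "\<forall>p\<in>strip T. J (\<Xi> (fst p) (snd p)) (snd p) \<noteq> 0" by blast+
qed

lemma vx_X: "t \<in> time_interval T \<Longrightarrow> vx (X \<xi> t) t = \<phi>1 \<xi> / J \<xi> t"
  using vx_X_mult_J[of t \<xi>] J_pos[of t \<xi>] by (simp add: field_simps)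

lemma vx_eq: "t \<in> time_interval T \<Longrightarrow> vx x t = \<phi>1 (\<Xi> x t) / J (\<Xi> x t) t"
  using vx_X[of t "\<Xi> x t"] by (simp add: X_\<Xi>)

lemma one_plus_eq: "t \<in> time_interval T \<Longrightarrow> 1 + t * (a1 (v x t) * vx x t) = 1 / J (\<Xi> x t) t"
  using J_mult[of t "\<Xi> x t"] J_pos[of t "\<Xi> x t"] by (simp add: X_\<Xi> \<phi>_\<Xi> field_simps)

lemma \<Xi>_DERIV_x: assumes t: "t \<in> time_interval T"
  shows "((\<lambda>x. \<Xi> x t) has_real_derivative 1 / J (\<Xi> x t) t) (at x)"
  unfolding one_plus_eq[OF t, symmetric] unfolding \<Xi>_def
  by (auto intro!: derivative_eq_intros DERIV_chain2[OF a_DERIV(1)] vx[OF t])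

lemma \<Xi>_DERIV_t: assumes t: "t \<in> time_interval T"
  shows "((\<lambda>t. \<Xi> x t) has_real_derivative a (v x t) / J (\<Xi> x t) t) (at t within {0..})"
proof -
  have "((\<lambda>t. \<Xi> x t) has_real_derivative a (v x t) * (1 + t * (a1 (v x t) * vx x t))) (at t within {0..})"
    unfolding \<Xi>_def
    by (auto intro!: derivative_eq_intros DERIV_chain2[OF a_DERIV(1)] vt[OF t] simp: transport[OF t] algebra_simps)
  then show ?thesis by (simp add: one_plus_eq[OF t])
qed

lemma \<Xi>_cont: 
  assumes "continuous_on S g" "continuous_on S h" "h ` S \<subseteq> time_interval T"
  shows "continuous_on S (\<lambda>s. \<Xi> (g s) (h s))"
  unfolding \<Xi>_def
  by (intro continuous_intros assms v_cont_curve continuous_on_compose2[OF smooth_fun_continuous[OF a, of UNIV]]) auto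

text \<open>A classical solution is assumed to be C^1, but v_x = \<phi>1(\<Xi>)/J is built from
  functions differentiable in x, so v_xx exists and is explicit.\<close>

lemma vxx: assumes t: "t \<in> time_interval T"
  shows "((\<lambda>x. vx x t) has_real_derivative
    \<phi>2 (\<Xi> x t) / J (\<Xi> x t) t ^ 2 + t * \<phi>1 (\<Xi> x t) * b1 (\<Xi> x t) / J (\<Xi> x t) t ^ 3) (at x)"
proof -
  have "((\<lambda>x. \<phi>1 (\<Xi> x t) / J (\<Xi> x t) t) has_real_derivative
    \<phi>2 (\<Xi> x t) / J (\<Xi> x t) t ^ 2 + t * \<phi>1 (\<Xi> x t) * b1 (\<Xi> x t) / J (\<Xi> x t) t ^ 3) (at x)"
    using J_pos[OF t, of "\<Xi> x t"] unfolding J_def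
    by (auto intro!: derivative_eq_intros DERIV_chain2[OF \<phi>1] DERIV_chain2[OF b_DERIV] \<Xi>_DERIV_x[OF t] 
       simp: J_def power2_eq_square power3_eq_cube)
       (simp add: divide_simps; simp add: algebra_simps)
  moreover have "(\<lambda>x. \<phi>1 (\<Xi> x t) / J (\<Xi> x t) t) = (\<lambda>x. vx x t)" using vx_eq[OF t] by auto
  ultimately show ?thesis by simp
qed

lemma dx_v: "t \<in> time_interval T \<Longrightarrow> dx v x t = vx x t"
  unfolding dx_def by (rule DERIV_imp_deriv[OF vx])

lemma dxx_v: assumes t: "t \<in> time_interval T"
  shows "dxx v x t = \<phi>2 (\<Xi> x t) / J (\<Xi> x t) t ^ 2 + t * \<phi>1 (\<Xi> x t) * b1 (\<Xi> x t) / J (\<Xi> x t) t ^ 3"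
proof -
  have "(\<lambda>y. deriv (\<lambda>z. v z t) y) = (\<lambda>x. vx x t)" by (auto intro: DERIV_imp_deriv vx[OF t])
  then show ?thesis unfolding dxx_def using DERIV_imp_deriv[OF vxx[OF t]] by simp
qed

end

section \<open>Lagrangian coordinates\<close>


text \<open>The image of the measure g' dx under g agrees with Lebesgue measure on intervals by the
  fundamental theorem, and intervals determine it. Nonnegative integrals cover every Borel function
  without a question of integrability.\<close>

lemma nn_integral_substitution_diffeo:
  fixes g g' k :: "real \<Rightarrow> real"
  assumes d: "\<And>x. (g has_real_derivative g' x) (at x)" and c: "continuous_on UNIV g'" and pos: "\<And>x. 0 < g' x"
    and k: "\<And>x. k (g x) = x" "\<And>y. g (k y) = y" and f: "f \<in> borel_measurable borel"
  shows "(\<integral>\<^sup>+y. f y \<partial>lborel) = (\<integral>\<^sup>+x. f (g x) * ennreal (g' x) \<partial>lborel)"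
proof -
  have [measurable]: "g' \<in> borel_measurable borel" using c by (rule borel_measurable_continuous_onI)
  have "continuous_on UNIV g" using d by (meson DERIV_isCont continuous_at_imp_continuous_on)
  then have [measurable]: "g \<in> borel_measurable borel" by (rule borel_measurable_continuous_onI)
  have mono: "g x < g y" if "x < y" for x y
    using DERIV_pos_imp_increasing[OF that] d pos by blast
  have mono_iff: "g x < g y \<longleftrightarrow> x < y" for x y
    using mono[of x y] mono[of y x] by (cases x y rule: linorder_cases) auto
  define M where "M = distr (density lborel (\<lambda>x. ennreal (g' x))) borel g"
  have "lborel = M"
  proof (rule lborel_eqI)
    fix l u :: real assume "\<And>b. b \<in> Basis \<Longrightarrow> l \<bullet> b \<le> u \<bullet> b"
    then have lu: "l \<le> u" by simp
    then have klu: "k l \<le> k u" using mono_iff[of "k u" "k l"] k by simp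
    have vimage: "g -` {l<..<u} = {k l<..<k u}"
      using mono_iff[of "k l"] mono_iff[of _ "k u"] k by (auto)
    have "emeasure M (box l u) = emeasure (density lborel (\<lambda>x. ennreal (g' x))) (g -` {l<..<u})"
      unfolding M_def by (subst emeasure_distr) (auto simp: box_real)
    also have "\<dots> = (\<integral>\<^sup>+x. ennreal (g' x) * indicator {k l<..<k u} x \<partial>lborel)"
      unfolding vimage by (subst emeasure_density) auto
    also have "\<dots> = (\<integral>\<^sup>+x. ennreal (g' x) * indicator {k l..k u} x \<partial>lborel)"
      by (rule nn_integral_cong_AE) (use AE_lborel_singleton[of "k l"] AE_lborel_singleton[of "k u"] in eventually_elim, auto simp: indicator_def)
    also have "\<dots> = ennreal (g (k u) - g (k l))"
      by (rule nn_integral_FTC_Icc) (use klu pos d in \<open>auto intro: less_imp_le has_field_derivative_at_within\<close>)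
    finally show "emeasure M (box l u) = (\<Prod>b\<in>Basis. (u - l) \<bullet> b)" by (simp add: k)
  qed (simp add: M_def)
  then have "(\<integral>\<^sup>+y. f y \<partial>lborel) = (\<integral>\<^sup>+y. f y \<partial>M)" by simp
  also have "\<dots> = (\<integral>\<^sup>+x. f (g x) \<partial>density lborel (\<lambda>x. ennreal (g' x)))"
    unfolding M_def by (subst nn_integral_distr) (use f in auto)
  also have "\<dots> = (\<integral>\<^sup>+x. ennreal (g' x) * f (g x) \<partial>lborel)"
    by (subst nn_integral_density) (use f in auto)
  finally show ?thesis by (simp add: mult.commute)
qed

lemma strip_borel[measurable]: "strip T \<in> sets borel"
proof -
  have "strip T = {p. 0 \<le> snd p} \<inter> {p. ereal (snd p) < T}" by (auto simp: strip_def)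
  moreover have "closed {p :: real \<times> real. 0 \<le> snd p}" by (intro closed_Collect_le continuous_intros)
  moreover have "open {p :: real \<times> real. ereal (snd p) < T}"
    by (cases T) (auto intro!: open_Collect_less continuous_intros)
  ultimately show ?thesis by auto
qed

context C2_transport begin

lemma X_cont: "continuous_on S (\<lambda>p. X (fst p) (snd p))"
  unfolding X_def
  by (intro continuous_intros continuous_on_compose2[OF smooth_fun_continuous[OF a, of UNIV]] continuous_on_compose2[OF \<phi>_cont(1)[of UNIV]]) auto

lemma b_cont: "continuous_on S b"
  by (meson b_DERIV DERIV_isCont continuous_at_imp_continuous_on)

lemma b1_cont: "continuous_on S b1"
  unfolding b1_def
  by (intro continuous_intros \<phi>_cont continuous_on_compose2[OF smooth_fun_continuous[OF smooth_fun_deriv[OF a], of UNIV]]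
    continuous_on_compose2[OF smooth_fun_continuous[OF smooth_fun_deriv[OF smooth_fun_deriv[OF a]], of UNIV]] continuous_on_subset[OF \<phi>2]) auto

lemma J_cont: "continuous_on S (\<lambda>p. J (fst p) (snd p))"
  unfolding J_def by (intro continuous_intros continuous_on_compose2[OF b_cont[of UNIV]]) auto

definition lagrange_map :: "real \<times> real \<Rightarrow> real \<times> real" where
  "lagrange_map p = (X (fst p) (snd p), snd p)"

lemma lagrange_map_measurable[measurable]: "lagrange_map \<in> borel_measurable borel"
  unfolding lagrange_map_def by (intro borel_measurable_continuous_onI continuous_intros X_cont)

lemma J_measurable[measurable]: "(\<lambda>p. J (fst p) (snd p)) \<in> borel_measurable borel"
  by (intro borel_measurable_continuous_onI J_cont)

text \<open>The map fixes the time, so by Tonelli the substitution is one-dimensional on each slice,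
  with derivative \<open>J\<close>.\<close>

lemma nn_integral_lagrange:
  fixes F :: "real \<times> real \<Rightarrow> ennreal"
  assumes F[measurable]: "F \<in> borel_measurable borel"
  shows "(\<integral>\<^sup>+p. indicator (strip T) p * F p \<partial>lborel) =
    (\<integral>\<^sup>+p. indicator (strip T) p * ennreal (J (fst p) (snd p)) * F (lagrange_map p) \<partial>lborel)"
proof -
  have lp: "(lborel :: (real \<times> real) measure) = lborel \<Otimes>\<^sub>M lborel" by (simp add: lborel_prod)
  have m1: "(\<lambda>p. indicator (strip T) p * F p) \<in> borel_measurable (lborel \<Otimes>\<^sub>M lborel)"
    unfolding lborel_prod by measurable
  have m2: "(\<lambda>p. indicator (strip T) p * ennreal (J (fst p) (snd p)) * F (lagrange_map p)) \<in> borel_measurable (lborel \<Otimes>\<^sub>M lborel)"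
    unfolding lborel_prod by measurable
  have "(\<integral>\<^sup>+p. indicator (strip T) p * F p \<partial>lborel) = (\<integral>\<^sup>+t. (\<integral>\<^sup>+x. indicator (strip T) (x,t) * F (x,t) \<partial>lborel) \<partial>lborel)"
    unfolding lp by (rule lborel_pair.nn_integral_snd[OF m1, symmetric])
  also have "\<dots> = (\<integral>\<^sup>+t. (\<integral>\<^sup>+\<xi>. indicator (strip T) (\<xi>,t) * ennreal (J \<xi> t) * F (lagrange_map (\<xi>,t)) \<partial>lborel) \<partial>lborel)"
  proof (rule nn_integral_cong)
    fix t :: real
    show "(\<integral>\<^sup>+x. indicator (strip T) (x,t) * F (x,t) \<partial>lborel) = (\<integral>\<^sup>+\<xi>. indicator (strip T) (\<xi>,t) * ennreal (J \<xi> t) * F (lagrange_map (\<xi>,t)) \<partial>lborel)"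
    proof (cases "t \<in> time_interval T")
      case True
      have cJ: "continuous_on UNIV (\<lambda>\<xi>. J \<xi> t)" unfolding J_def by (intro continuous_intros b_cont)
      have Fm: "(\<lambda>x. F (x,t)) \<in> borel_measurable borel" by measurable
      have "indicator (strip T) (x,t) = (1::ennreal)" for x using True by (simp add: strip_eq_Times)
      then show ?thesis
        using nn_integral_substitution_diffeo[OF X_DERIV cJ J_pos[OF True], where k = "\<lambda>x. \<Xi> x t" and f = "\<lambda>x. F (x,t)", OF \<Xi>_X[OF True] X_\<Xi>[OF True] Fm]
        by (simp add: lagrange_map_def mult.commute)
    next
      case False
      then have "indicator (strip T) (x,t) = (0::ennreal)" for x by (simp add: strip_eq_Times)
      then show ?thesis by simp
    qed
  qed
  also have "\<dots> = (\<integral>\<^sup>+p. indicator (strip T) p * ennreal (J (fst p) (snd p)) * F (lagrange_map p) \<partial>lborel)"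
    unfolding lp using lborel_pair.nn_integral_snd[OF m2] by simp
  finally show ?thesis .
qed

text \<open>As an equality of measures the substitution transfers integrability and the value of an
  integral alike.\<close>

lemma lagrange_measure_eq:
  "density lborel (indicator (strip T)) =
    distr (density lborel (\<lambda>p. indicator (strip T) p * ennreal (J (fst p) (snd p)))) borel lagrange_map" (is "?M = ?N")
proof (rule measure_eqI)
  fix A assume "A \<in> sets ?M"
  then have A[measurable]: "A \<in> sets borel" by simp
  have "emeasure ?M A = (\<integral>\<^sup>+p. indicator (strip T) p * indicator A p \<partial>lborel)"
    by (subst emeasure_density) auto
  also have "\<dots> = (\<integral>\<^sup>+p. indicator (strip T) p * ennreal (J (fst p) (snd p)) * indicator A (lagrange_map p) \<partial>lborel)"
    by (rule nn_integral_lagrange) simp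
  also have "\<dots> = emeasure ?N A"
  proof -
    have [measurable]: "lagrange_map -` A \<in> sets borel"
      using measurable_sets[OF lagrange_map_measurable A] by simp
    have "emeasure ?N A = emeasure (density lborel (\<lambda>p. indicator (strip T) p * ennreal (J (fst p) (snd p)))) (lagrange_map -` A)"
      by (subst emeasure_distr) auto
    also have "\<dots> = (\<integral>\<^sup>+p. indicator (strip T) p * ennreal (J (fst p) (snd p)) * indicator (lagrange_map -` A) p \<partial>lborel)"
      by (subst emeasure_density) auto
    finally show ?thesis by (simp add: indicator_vimage)
  qed
  finally show "emeasure ?M A = emeasure ?N A" .
qed simp

lemma lagrange_density_eq:
  fixes F :: "real \<times> real \<Rightarrow> real"
  shows "(indicator (strip T) p * J (fst p) (snd p)) *\<^sub>R F (lagrange_map p) = indicator (strip T) p *\<^sub>R (F (lagrange_map p) * J (fst p) (snd p))"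
  by simp

lemma
  fixes F :: "real \<times> real \<Rightarrow> real"
  assumes F[measurable]: "F \<in> borel_measurable borel"
  shows set_integrable_lagrange: "set_integrable lborel (strip T) F \<longleftrightarrow>
      set_integrable lborel (strip T) (\<lambda>p. F (lagrange_map p) * J (fst p) (snd p))" (is ?thesis1)
    and set_integral_lagrange: "(LINT p:strip T|lborel. F p) = (LINT p:strip T|lborel. F (lagrange_map p) * J (fst p) (snd p))" (is ?thesis2)
proof -
  let ?d = "\<lambda>p. indicator (strip T) p * J (fst p) (snd p)"
  have nn: "0 \<le> ?d p" for p
    by (cases p) (auto simp: indicator_def strip_eq_Times intro: less_imp_le[OF J_pos])
  have N: "density lborel (\<lambda>p. indicator (strip T) p * ennreal (J (fst p) (snd p))) = density lborel (\<lambda>p. ennreal (?d p))"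
    by (intro arg_cong[where f = "density lborel"] ext) (auto simp: indicator_def)
  have M: "density lborel (indicator (strip T)) = density lborel (\<lambda>p. ennreal (indicator (strip T) p))"
    by (intro arg_cong[where f = "density lborel"] ext) (auto simp: indicator_def)
  have "set_integrable lborel (strip T) F \<longleftrightarrow> integrable (density lborel (indicator (strip T))) F"
    unfolding M set_integrable_def by (subst integrable_density) auto
  also have "\<dots> \<longleftrightarrow> integrable (density lborel (\<lambda>p. ennreal (?d p))) (\<lambda>p. F (lagrange_map p))"
    unfolding lagrange_measure_eq N by (subst integrable_distr_eq) auto
  also have "\<dots> \<longleftrightarrow> set_integrable lborel (strip T) (\<lambda>p. F (lagrange_map p) * J (fst p) (snd p))"
    unfolding set_integrable_def lagrange_density_eq[symmetric] by (subst integrable_density) (use nn in auto)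
  finally show ?thesis1 .
  have "(LINT p:strip T|lborel. F p) = integral\<^sup>L (density lborel (indicator (strip T))) F"
    unfolding M set_lebesgue_integral_def by (subst integral_density) auto
  also have "\<dots> = integral\<^sup>L (density lborel (\<lambda>p. ennreal (?d p))) (\<lambda>p. F (lagrange_map p))"
    unfolding lagrange_measure_eq N by (subst integral_distr) auto
  also have "\<dots> = (LINT p:strip T|lborel. F (lagrange_map p) * J (fst p) (snd p))"
    unfolding set_lebesgue_integral_def lagrange_density_eq[symmetric] by (subst integral_density) (use nn in auto)
  finally show ?thesis2 .
qed

text \<open>\<open>h\<close> and \<open>\<sigma>\<close> are \<open>formula_H\<close> and \<open>source_term\<close> in Lagrangian coordinates.\<close>
definition h :: "real \<Rightarrow> real \<Rightarrow> real" where
  "h \<xi> t = t / 2 * (c1 (\<phi> \<xi>) * a1 (\<phi> \<xi>) * \<phi>1 \<xi> ^ 2 / J \<xi> t + c (\<phi> \<xi>) * a2 (\<phi> \<xi>) * \<phi>1 \<xi> ^ 2 / J \<xi> t ^ 2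
     + c (\<phi> \<xi>) * a1 (\<phi> \<xi>) * \<phi>2 \<xi> * (1 + J \<xi> t) / J \<xi> t ^ 2)"

definition \<sigma> :: "real \<Rightarrow> real \<Rightarrow> real" where
  "\<sigma> \<xi> t = 1 / 2 * (c1 (\<phi> \<xi>) * a1 (\<phi> \<xi>) * \<phi>1 \<xi> ^ 2 / J \<xi> t ^ 2 + c (\<phi> \<xi>) * a2 (\<phi> \<xi>) * \<phi>1 \<xi> ^ 2 * (2 - J \<xi> t) / J \<xi> t ^ 3
     + 2 * c (\<phi> \<xi>) * a1 (\<phi> \<xi>) * \<phi>2 \<xi> / J \<xi> t ^ 3)"

section \<open>The closed formulas in Lagrangian coordinates\<close>

lemma h_DERIV_t: assumes "J \<xi> t \<noteq> 0" shows "((\<lambda>t. h \<xi> t) has_real_derivative \<sigma> \<xi> t) (at t)"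
proof -
  define j where "j = J \<xi> t"
  have dJ: "((\<lambda>t. J \<xi> t) has_real_derivative - b \<xi>) (at t)"
    unfolding J_def by (auto intro!: derivative_eq_intros)
  have j: "j \<noteq> 0" "t * b \<xi> = 1 - j" using assms by (auto simp: j_def J_def)
  have d1: "((\<lambda>t. t / J \<xi> t) has_real_derivative 1 / j ^ 2) (at t)"
    using j by (auto intro!: derivative_eq_intros dJ simp: j_def[symmetric] power2_eq_square)
  have d2: "((\<lambda>t. t / J \<xi> t ^ 2) has_real_derivative (2 - j) / j ^ 3) (at t)"
  proof -
    have "((\<lambda>t. t / J \<xi> t ^ 2) has_real_derivative (1 * j ^ 2 - t * (2 * j * - b \<xi>)) / (j ^ 2 * j ^ 2)) (at t)"
      using j by (auto intro!: derivative_eq_intros dJ simp: j_def[symmetric])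
    moreover have "1 * j ^ 2 - t * (2 * j * - b \<xi>) = j ^ 2 + 2 * j * (t * b \<xi>)" by simp
    then have "1 * j ^ 2 - t * (2 * j * - b \<xi>) = (2 - j) * j"
      unfolding j(2) by (simp add: power2_eq_square algebra_simps)
    then have "(1 * j ^ 2 - t * (2 * j * - b \<xi>)) / (j ^ 2 * j ^ 2) = (2 - j) / j ^ 3"
      using j by (simp add: power2_eq_square power3_eq_cube)
    ultimately show ?thesis by simp
  qed
  have "((\<lambda>t. 1 / 2 * (c1 (\<phi> \<xi>) * a1 (\<phi> \<xi>) * \<phi>1 \<xi> ^ 2 * (t / J \<xi> t) + c (\<phi> \<xi>) * a2 (\<phi> \<xi>) * \<phi>1 \<xi> ^ 2 * (t / J \<xi> t ^ 2)
     + c (\<phi> \<xi>) * a1 (\<phi> \<xi>) * \<phi>2 \<xi> * (t / J \<xi> t ^ 2 + t / J \<xi> t))) has_real_derivative 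
       1 / 2 * (c1 (\<phi> \<xi>) * a1 (\<phi> \<xi>) * \<phi>1 \<xi> ^ 2 * (1 / j ^ 2) + c (\<phi> \<xi>) * a2 (\<phi> \<xi>) * \<phi>1 \<xi> ^ 2 * ((2 - j) / j ^ 3)
     + c (\<phi> \<xi>) * a1 (\<phi> \<xi>) * \<phi>2 \<xi> * ((2 - j) / j ^ 3 + 1 / j ^ 2))) (at t)"
    by (intro DERIV_cmult DERIV_add d1 d2)
  \<comment> \<open>The derivatives of t/J and t/J^2 are 1/J^2 and (2 - J)/J^3; this identity merges
    the two contributions of \<phi>2.\<close>
  moreover have "(2 - j) / j ^ 3 + 1 / j ^ 2 = 2 / j ^ 3"
    using j by (simp add: field_simps power2_eq_square power3_eq_cube)
  \<comment> \<open>The equality is needed for all t; where \<open>J\<close> vanishes both sides are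
    0 by the convention on division.\<close>
  moreover have "1 / 2 * (c1 (\<phi> \<xi>) * a1 (\<phi> \<xi>) * \<phi>1 \<xi> ^ 2 * (t / J \<xi> t) + c (\<phi> \<xi>) * a2 (\<phi> \<xi>) * \<phi>1 \<xi> ^ 2 * (t / J \<xi> t ^ 2)
     + c (\<phi> \<xi>) * a1 (\<phi> \<xi>) * \<phi>2 \<xi> * (t / J \<xi> t ^ 2 + t / J \<xi> t)) = h \<xi> t" for t
    by (cases "J \<xi> t = 0") (simp_all add: h_def field_simps power2_eq_square)
  moreover have "1 / 2 * (c1 (\<phi> \<xi>) * a1 (\<phi> \<xi>) * \<phi>1 \<xi> ^ 2 * (1 / j ^ 2) + c (\<phi> \<xi>) * a2 (\<phi> \<xi>) * \<phi>1 \<xi> ^ 2 * ((2 - j) / j ^ 3)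
     + c (\<phi> \<xi>) * a1 (\<phi> \<xi>) * \<phi>2 \<xi> * (2 / j ^ 3)) = \<sigma> \<xi> t"
    by (simp add: \<sigma>_def j_def)
  ultimately show ?thesis by simp
qed

text \<open>With p = \<phi>1(\<Xi>), v_x = p/J and the formula for v_xx, everything is rational in
  J, and the relation t a'(v) p = 1 - J eliminates the explicit t.\<close>

lemma source_eq: assumes t: "t \<in> time_interval T" shows "source_term a c v x t = \<sigma> (\<Xi> x t) t"
proof -
  define j where "j = J (\<Xi> x t) t"
  have j: "j \<noteq> 0" "t * (a1 (v x t) * \<phi>1 (\<Xi> x t)) = 1 - j" using J_pos[OF t, of "\<Xi> x t"] by (auto simp: j_def J_def b_def \<phi>_\<Xi>[OF t])
  define A1 A2 C0 C1 p q where defs: "A1 = a1 (v x t)" "A2 = a2 (v x t)" "C0 = c (v x t)" "C1 = c1 (v x t)" "p = \<phi>1 (\<Xi> x t)" "q = \<phi>2 (\<Xi> x t)"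
  have r: "t * (A1 * p) = 1 - j" using j by (simp add: defs)
  have "source_term a c v x t = C0 * A1 * (q / j ^ 2 + t * p * (A2 * p ^ 2 + A1 * q) / j ^ 3) + 1/2 * (C0 * A2 + C1 * A1) * (p / j) ^ 2"
    unfolding source_term_def Let_def dxx_v[OF t] dx_v[OF t] vx_eq[OF t] b1_def \<phi>_\<Xi>[OF t] j_def[symmetric] by (simp add: defs)
  also have "\<dots> = (C0 * A1 * q * j + C0 * (t * (A1 * p)) * (A2 * p ^ 2 + A1 * q) + 1/2 * (C0 * A2 + C1 * A1) * p ^ 2 * j) / j ^ 3"
    using j(1) by (simp add: field_simps power2_eq_square power3_eq_cube)
  also have "\<dots> = 1/2 * (C1 * A1 * p ^ 2 / j ^ 2 + C0 * A2 * p ^ 2 * (2 - j) / j ^ 3 + 2 * C0 * A1 * q / j ^ 3)"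
    unfolding r using j(1) by (simp add: field_simps power2_eq_square power3_eq_cube)
  also have "\<dots> = \<sigma> (\<Xi> x t) t"
    unfolding \<sigma>_def \<phi>_\<Xi>[OF t] j_def[symmetric] by (simp add: defs)
  finally show ?thesis .
qed

text \<open>Dividing by (1 + t a'(v) v_x)^2 means multiplying by J^2, and t a'(v) \<phi>1(\<Xi>) = 1
  - J removes every t except the factor t/2 in front.\<close>

lemma formula_H_eq: assumes t: "t \<in> time_interval T" shows "formula_H a c v x t = h (\<Xi> x t) t"
proof -
  define j where "j = J (\<Xi> x t) t"
  have j: "j \<noteq> 0" "t * (a1 (v x t) * \<phi>1 (\<Xi> x t)) = 1 - j" using J_pos[OF t, of "\<Xi> x t"] by (auto simp: j_def J_def b_def \<phi>_\<Xi>[OF t])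
  define A1 A2 C0 C1 p q where defs: "A1 = a1 (v x t)" "A2 = a2 (v x t)" "C0 = c (v x t)" "C1 = c1 (v x t)" "p = \<phi>1 (\<Xi> x t)" "q = \<phi>2 (\<Xi> x t)"
  have r: "t * (A1 * p) = 1 - j" using j by (simp add: defs)
  have dca: "deriv (\<lambda>y. c y * a1 y) (v x t) = C1 * A1 + C0 * A2"
    by (rule DERIV_imp_deriv) (auto intro!: derivative_eq_intros a_DERIV c_DERIV simp: defs)
  have D: "1 + t * a1 (v x t) * vx x t = 1 / j" using one_plus_eq[OF t, of x] by (simp add: j_def mult.assoc)
  have "formula_H a c v x t = t / 2 * (((C1 * A1 + C0 * A2) * (p / j) ^ 2 + 2 * C0 * A1 * (q / j ^ 2 + t * p * (A2 * p ^ 2 + A1 * q) / j ^ 3)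
     + t * C0 * A1 ^ 2 * (p / j) * (q / j ^ 2 + t * p * (A2 * p ^ 2 + A1 * q) / j ^ 3) + t * C1 * A1 ^ 2 * (p / j) ^ 3) / (1 / j) ^ 2)"
    unfolding formula_H_def Let_def dxx_v[OF t] dx_v[OF t] dca D unfolding vx_eq[OF t] b1_def \<phi>_\<Xi>[OF t] j_def[symmetric] by (simp add: defs)
  also have "\<dots> = t / 2 * (((C1 * A1 + C0 * A2) * p ^ 2 * j ^ 2 + 2 * C0 * (A1 * q * j ^ 2 + (t * (A1 * p)) * (A2 * p ^ 2 + A1 * q) * j)
     + C0 * (t * (A1 * p)) * (A1 * q * j + (t * (A1 * p)) * (A2 * p ^ 2 + A1 * q)) + C1 * A1 * p ^ 2 * (t * (A1 * p)) * j) / j ^ 2)"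
    using j(1) by (simp add: field_simps power2_eq_square power3_eq_cube)
  also have "\<dots> = t / 2 * (C1 * A1 * p ^ 2 / j + C0 * A2 * p ^ 2 / j ^ 2 + C0 * A1 * q * (1 + j) / j ^ 2)"
    unfolding r using j(1) by (simp add: field_simps power2_eq_square power3_eq_cube)
  also have "\<dots> = h (\<Xi> x t) t"
    unfolding h_def \<phi>_\<Xi>[OF t] j_def[symmetric] by (simp add: defs)
  finally show ?thesis .
qed

text \<open>On the solution the logarithm is -ln J. Its contributions to the two parts of the
  variational derivative, each a multiple of c'(v) v_x ln J, cancel, and what is left is
  rational.\<close>

lemma var_deriv1_eq: assumes t: "t \<in> time_interval T"
  shows "var_deriv1 (Kdens a c t) (\<lambda>y. v y t) x = h (\<Xi> x t) t"
proof -
  have du: "deriv (\<lambda>y. v y t) y = vx y t" for y by (rule DERIV_imp_deriv[OF vx[OF t]])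
  have D: "1 + t * a1 (v y t) * vx y t = 1 / J (\<Xi> y t) t" for y using one_plus_eq[OF t, of y] by (simp add: mult.assoc)
  have Jp: "0 < J (\<Xi> y t) t" for y by (rule J_pos[OF t])
  \<comment> \<open>On the solution this expression depends on y only through
    \<open>\<Xi> y t\<close>, so its space derivative is a \<xi>-derivative divided by J.\<close>
  have k_p: "deriv (\<lambda>p. Kdens a c t (v y t) p) (vx y t) = - 1/2 * c (\<phi> (\<Xi> y t)) * (t * b (\<Xi> y t) - ln (J (\<Xi> y t) t))" for y
  proof (rule DERIV_imp_deriv)
    have "((\<lambda>p. Kdens a c t (v y t) p) has_real_derivative
       - 1/2 * c (v y t) * (ln (1 + t * a1 (v y t) * vx y t) + vx y t * (t * a1 (v y t) / (1 + t * a1 (v y t) * vx y t)))) (at (vx y t))"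
      unfolding Kdens_def using Jp[of y] D[of y]
      by (auto intro!: derivative_eq_intros simp: algebra_simps)
    moreover have e1: "vx y t * (t * a1 (v y t) / (1 / J (\<Xi> y t) t)) = t * b (\<Xi> y t)"
      using vx_X_mult_J[OF t, of "\<Xi> y t"] by (simp add: X_\<Xi>[OF t] b_def \<phi>_\<Xi>[OF t] mult_ac)
    moreover have e2: "ln (1 / J (\<Xi> y t) t) = - ln (J (\<Xi> y t) t)" using Jp[of y] by (simp add: ln_div)
    ultimately have "((\<lambda>p. Kdens a c t (v y t) p) has_real_derivative
       - 1/2 * c (v y t) * (- ln (J (\<Xi> y t) t) + t * b (\<Xi> y t))) (at (vx y t))"
      unfolding D e1 e2 by blast
    then show "((\<lambda>p. Kdens a c t (v y t) p) has_real_derivative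
       - 1/2 * c (\<phi> (\<Xi> y t)) * (t * b (\<Xi> y t) - ln (J (\<Xi> y t) t))) (at (vx y t))"
      by (simp add: \<phi>_\<Xi>[OF t])
  qed
  define \<xi> where "\<xi> = \<Xi> x t"
  define j where "j = J \<xi> t"
  have j: "0 < j" "t * (a1 (v x t) * \<phi>1 \<xi>) = 1 - j" using Jp[of x] by (auto simp: \<xi>_def j_def J_def b_def \<phi>_\<Xi>[OF t])
  have "((\<lambda>\<xi>. - 1/2 * c (\<phi> \<xi>) * (t * b \<xi> - ln (J \<xi> t))) has_real_derivative
     - 1/2 * (c1 (\<phi> \<xi>) * \<phi>1 \<xi> * (t * b \<xi> - ln j) + c (\<phi> \<xi>) * (t * b1 \<xi> + t * b1 \<xi> / j))) (at \<xi>)"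
  proof -
    have dJ: "((\<lambda>\<xi>. J \<xi> t) has_real_derivative - (t * b1 \<xi>)) (at \<xi>)"
      unfolding J_def by (auto intro!: derivative_eq_intros b_DERIV)
    have dl: "((\<lambda>\<xi>. ln (J \<xi> t)) has_real_derivative - (t * b1 \<xi>) / j) (at \<xi>)"
      using j(1) by (auto intro!: derivative_eq_intros dJ simp: j_def divide_inverse)
    have "((\<lambda>\<xi>. t * b \<xi> - ln (J \<xi> t)) has_real_derivative t * b1 \<xi> - - (t * b1 \<xi>) / j) (at \<xi>)"
      by (intro DERIV_diff DERIV_cmult b_DERIV dl)
    from DERIV_cmult[OF DERIV_mult[OF DERIV_chain2[OF c_DERIV(1) \<phi>] this], of "- 1/2", unfolded mult.assoc]
    show ?thesis unfolding mult.assoc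
      by (rule DERIV_cong) (simp add: algebra_simps j_def)
  qed
  then have d: "((\<lambda>\<xi>. - 1/2 * c (\<phi> \<xi>) * (t * b \<xi> - ln (J \<xi> t))) has_real_derivative
     - 1/2 * (c1 (\<phi> \<xi>) * \<phi>1 \<xi> * (t * b \<xi> - ln j) + c (\<phi> \<xi>) * (t * b1 \<xi> + t * b1 \<xi> / j))) (at (\<Xi> x t))"
    by (simp add: \<xi>_def)
  have k_p': "deriv (\<lambda>y. deriv (\<lambda>p. Kdens a c t (v y t) p) (deriv (\<lambda>y. v y t) y)) x
    = - 1/2 * (c1 (\<phi> \<xi>) * \<phi>1 \<xi> * (t * b \<xi> - ln j) + c (\<phi> \<xi>) * (t * b1 \<xi> + t * b1 \<xi> / j)) * (1 / j)"
    unfolding du k_p using DERIV_chain2[OF d \<Xi>_DERIV_x[OF t]] by (intro DERIV_imp_deriv) (simp add: \<xi>_def j_def)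
  have k_u: "deriv (\<lambda>w. Kdens a c t w (deriv (\<lambda>y. v y t) x)) (v x t)
    = - 1/2 * (c1 (v x t) * (\<phi>1 \<xi> / j) * (- ln j) + c (v x t) * (\<phi>1 \<xi> / j) * (t * a2 (v x t) * (\<phi>1 \<xi> / j) * j))"
  proof (rule DERIV_imp_deriv)
    have "((\<lambda>w. Kdens a c t w (vx x t)) has_real_derivative
       - 1/2 * (c1 (v x t) * vx x t * ln (1 + t * a1 (v x t) * vx x t) + c (v x t) * vx x t * (t * a2 (v x t) * vx x t / (1 + t * a1 (v x t) * vx x t)))) (at (v x t))"
      unfolding Kdens_def using Jp[of x] D[of x]
      by (auto intro!: derivative_eq_intros a_DERIV c_DERIV simp: algebra_simps)
    moreover have "ln (1 / j) = - ln j" using j(1) by (simp add: ln_div)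
    ultimately show "((\<lambda>w. Kdens a c t w (deriv (\<lambda>y. v y t) x)) has_real_derivative
       - 1/2 * (c1 (v x t) * (\<phi>1 \<xi> / j) * (- ln j) + c (v x t) * (\<phi>1 \<xi> / j) * (t * a2 (v x t) * (\<phi>1 \<xi> / j) * j))) (at (v x t))"
      unfolding D du by (simp add: vx_eq[OF t] \<xi>_def[symmetric] j_def[symmetric])
  qed
  define A1 A2 C0 C1 p q l where defs: "A1 = a1 (v x t)" "A2 = a2 (v x t)" "C0 = c (v x t)" "C1 = c1 (v x t)" "p = \<phi>1 \<xi>" "q = \<phi>2 \<xi>" "l = ln j"
  have \<phi>\<xi>: "\<phi> \<xi> = v x t" by (simp add: \<xi>_def \<phi>_\<Xi>[OF t])
  have bb: "b \<xi> = A1 * p" "b1 \<xi> = A2 * p ^ 2 + A1 * q" by (simp_all add: b_def b1_def \<phi>\<xi> defs)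
  have "var_deriv1 (Kdens a c t) (\<lambda>y. v y t) x =
     - 1/2 * (C1 * (p / j) * (- l) + C0 * (p / j) * (t * A2 * (p / j) * j))
     + 1/2 * (C1 * p * (t * (A1 * p) - l) + C0 * (t * (A2 * p ^ 2 + A1 * q) + t * (A2 * p ^ 2 + A1 * q) / j)) * (1 / j)"
    unfolding var_deriv1_def k_p' k_u unfolding bb \<phi>\<xi> by (simp add: defs)
  also have "\<dots> = t / 2 * (C1 * A1 * p ^ 2 / j + C0 * A2 * p ^ 2 / j ^ 2 + C0 * A1 * q * (1 + j) / j ^ 2)"
    using j(1) by (simp add: field_simps power2_eq_square)
  also have "\<dots> = h (\<Xi> x t) t"
    unfolding h_def \<phi>_\<Xi>[OF t] \<xi>_def[symmetric] j_def[symmetric] by (simp add: defs \<phi>\<xi>)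
  finally show ?thesis .
qed

end

section \<open>Continuously differentiable test functions\<close>


lemma set_integrable_mult_continuous:
  fixes u g :: "real \<times> real \<Rightarrow> real"
  assumes K: "compact K" and u: "set_integrable lborel K u" and g: "continuous_on K g"
  shows "set_integrable lborel K (\<lambda>p. u p * g p)"
proof -
  have Kb: "K \<in> sets borel" using K by (intro borel_compact)
  obtain B where B: "\<And>p. p \<in> K \<Longrightarrow> \<bar>g p\<bar> \<le> B"
    using compact_continuous_bounded[OF K g] by blast
  have m: "(\<lambda>p. indicator K p * g p) \<in> borel_measurable lborel"
    using borel_measurable_continuous_on_indicator[OF Kb g] by simp
  have bd: "\<bar>indicator K p * g p\<bar> \<le> max 0 B" for p
    using B[of p] by (cases "p \<in> K") auto
  have "integrable lborel (\<lambda>p. (indicator K p * u p) * (indicator K p * g p))"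
    using u by (intro integrable_mult_bounded_measurable[OF _ m bd]) (simp add: set_integrable_def)
  moreover have "(indicator K p * u p) * (indicator K p * g p) = indicator K p * (u p * g p)" for p
    by (simp add: indicator_def)
  ultimately show ?thesis by (simp add: set_integrable_def)
qed

lemma set_integrable_continuous_compact:
  fixes g :: "real \<times> real \<Rightarrow> real"
  assumes "compact K" "continuous_on K g" shows "set_integrable lborel K g"
  using borel_integrable_compact[OF assms] by (simp add: set_integrable_def)

lemma
  fixes F :: "'a \<Rightarrow> real"
  assumes "K \<subseteq> S" "\<And>p. p \<in> S \<Longrightarrow> p \<notin> K \<Longrightarrow> F p = 0"
  shows set_integrable_superset_zero: "set_integrable M S F \<longleftrightarrow> set_integrable M K F"
    and set_integral_superset_zero: "(LINT p:S|M. F p) = (LINT p:K|M. F p)"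
proof -
  have "(\<lambda>p. indicator S p *\<^sub>R F p) = (\<lambda>p. indicator K p *\<^sub>R F p)"
  proof
    fix p show "indicator S p *\<^sub>R F p = indicator K p *\<^sub>R F p"
      using assms(1) assms(2)[of p] by (auto simp: indicator_def)
  qed
  then show "set_integrable M S F \<longleftrightarrow> set_integrable M K F" "(LINT p:S|M. F p) = (LINT p:K|M. F p)"
    unfolding set_integrable_def set_lebesgue_integral_def by simp_all
qed

lemma test_fun2_derivatives:
  assumes "test_fun2 f"
  shows test_fun2_DERIV_x: "((\<lambda>y. f (y,t)) has_real_derivative px f (x,t)) (at x)"
    and test_fun2_DERIV_t: "((\<lambda>s. f (x,s)) has_real_derivative pt f (x,t)) (at t)"
    and test_fun2_cont: "continuous_on S f"
    and test_fun2_px_cont: "continuous_on S (px f)" and test_fun2_pt_cont: "continuous_on S (pt f)"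
proof -
  have s: "smooth2 f" using assms by (simp add: test_fun2_def)
  note s0 = s[unfolded smooth2_def Let_def, rule_format, of "[]"]
  have "(\<lambda>y. f (y,t)) differentiable (at x)" "(\<lambda>s. f (x,s)) differentiable (at t)"
    using s0 differentiable_compose[of f "\<lambda>x. (x,t)" x UNIV] differentiable_compose[of f "\<lambda>t. (x,t)" t UNIV]
    by (auto intro!: derivative_intros)
  then show "((\<lambda>y. f (y,t)) has_real_derivative px f (x,t)) (at x)" "((\<lambda>s. f (x,s)) has_real_derivative pt f (x,t)) (at t)"
    by (simp_all add: px_def pt_def DERIV_deriv_iff_real_differentiable)
  show "continuous_on S f" using s0 by (auto intro: continuous_on_subset)
  show "continuous_on S (px f)" "continuous_on S (pt f)"
    using s[unfolded smooth2_def Let_def, rule_format, of "[True]"] s[unfolded smooth2_def Let_def, rule_format, of "[False]"]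
    by (auto intro: continuous_on_subset)
qed

lemma px_pt_eq_0:
  assumes U: "open U" "p \<in> U" "\<And>q. q \<in> U \<Longrightarrow> f q = 0"
  shows "px f p = 0" "pt f p = 0"
proof -
  obtain x t where p: "p = (x,t)" by (cases p)
  have "((\<lambda>y. f (y,t)) has_real_derivative 0) (at x)"
  proof (rule has_field_derivative_transform_within_open[OF DERIV_const])
    show "open ((\<lambda>y. (y,t)) -` U)" using U(1) by (intro open_vimage continuous_intros)
  qed (use U p in auto)
  then show "px f p = 0" by (simp add: p px_def DERIV_imp_deriv)
  have "((\<lambda>s. f (x,s)) has_real_derivative 0) (at t)"
  proof (rule has_field_derivative_transform_within_open[OF DERIV_const])
    show "open ((\<lambda>s. (x,s)) -` U)" using U(1) by (intro open_vimage continuous_intros)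
  qed (use U p in auto)
  then show "pt f p = 0" by (simp add: p pt_def DERIV_imp_deriv)
qed

lemma strip_rectangle_subset: "ereal T' < T \<Longrightarrow> {x0..x1} \<times> {0..T'} \<subseteq> strip T"
  by (auto simp: strip_def intro: le_less_trans[of "ereal _" "ereal T'" T])

text \<open>\<open>W\<close> bounds the response of the integrand to errors in the two derivatives
  of the test function, and it is integrable over a rectangle independent of the approximation.
  Letting the accuracy tend to 0 removes the smoothness requirement.\<close>

lemma weak_sol_transport_C1_test:
  fixes \<psi> \<psi>x \<psi>t :: "real \<times> real \<Rightarrow> real"
  assumes w: "weak_sol_transport A S T v" and T': "ereal T' < T"
    and A: "continuous_on (strip T) (\<lambda>(x,t). A x t)" and S: "continuous_on (strip T) (\<lambda>(x,t). S x t)"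
    and c: "continuous_on (UNIV \<times> {0..}) \<psi>" "continuous_on (UNIV \<times> {0..}) \<psi>x" "continuous_on (UNIV \<times> {0..}) \<psi>t"
    and dx: "\<And>x t. 0 \<le> t \<Longrightarrow> ((\<lambda>y. \<psi> (y,t)) has_real_derivative \<psi>x (x,t)) (at x)"
    and dt: "\<And>x t. 0 \<le> t \<Longrightarrow> ((\<lambda>s. \<psi> (x,s)) has_real_derivative \<psi>t (x,t)) (at t within {0..})"
    and supp: "\<And>x t. 0 \<le> t \<Longrightarrow> R < \<bar>x\<bar> \<or> T' < t \<Longrightarrow> \<psi> (x,t) = 0"
      "\<And>x t. 0 \<le> t \<Longrightarrow> R < \<bar>x\<bar> \<or> T' < t \<Longrightarrow> \<psi>x (x,t) = 0"
      "\<And>x t. 0 \<le> t \<Longrightarrow> R < \<bar>x\<bar> \<or> T' < t \<Longrightarrow> \<psi>t (x,t) = 0"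
  shows "(LINT p:strip T|lborel. (\<lambda>(x,t). v x t * \<psi>t (x,t) - (A x t * v x t + S x t) * \<psi>x (x,t)) p) = 0"
proof -
  \<comment> \<open>Mollification widens the support by at most 1 in space. It does not reach later
    times, since the kernel looks ahead; hence \<open>T'\<close> can be kept and the rectangle stays
    in the strip.\<close>
  define K where "K = {-(R+1)..R+1} \<times> {0..T'}"
  have K: "compact K" "K \<subseteq> strip T" "K \<subseteq> UNIV \<times> {0..}" "K \<in> sets borel"
    using strip_rectangle_subset[OF T'] by (auto simp: K_def intro!: compact_Times borel_compact)
  define V where "V = (\<lambda>(x,t). v x t)"
  define A' where "A' = (\<lambda>(x,t). A x t)"
  define S' where "S' = (\<lambda>(x,t). S x t)"
  have V: "set_integrable lborel K V"
    using w K unfolding weak_sol_transport_def V_def by blast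
  have A'K: "continuous_on K A'" and S'K: "continuous_on K S'"
    using A S K continuous_on_subset unfolding A'_def S'_def by blast+
  define I where "I g1 g2 p = V p * g1 p - (A' p * V p + S' p) * g2 p" for g1 g2 p
  have int_I: "set_integrable lborel K (I g1 g2)" if "continuous_on K g1" "continuous_on K g2" for g1 g2
  proof -
    have "set_integrable lborel K (\<lambda>p. (V p * g1 p - V p * (A' p * g2 p)) - S' p * g2 p)"
      by (intro set_integral_diff set_integrable_mult_continuous K V that continuous_intros A'K S'K
          set_integrable_continuous_compact)
    then show ?thesis by (rule set_integrable_cong[THEN iffD1, rotated -1]) (auto simp: I_def algebra_simps)
  qed
  have restrict: "(LINT p:strip T|lborel. I g1 g2 p) = (LINT p:K|lborel. I g1 g2 p)"
    if "\<And>x t. 0 \<le> t \<Longrightarrow> R + 1 < \<bar>x\<bar> \<or> T' < t \<Longrightarrow> g1 (x,t) = 0" "\<And>x t. 0 \<le> t \<Longrightarrow> R + 1 < \<bar>x\<bar> \<or> T' < t \<Longrightarrow> g2 (x,t) = 0" for g1 g2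
  proof (rule set_integral_superset_zero[OF K(2)])
    fix p assume "p \<in> strip T" "p \<notin> K"
    moreover obtain x t where p: "p = (x,t)" by (cases p)
    ultimately have "0 \<le> t" "R + 1 < \<bar>x\<bar> \<or> T' < t" by (auto simp: K_def strip_def)
    then show "I g1 g2 p = 0" using that by (simp add: I_def p)
  qed
  define D where "D = (LINT p:K|lborel. I \<psi>t \<psi>x p)"
  obtain B where B: "\<And>p. p \<in> K \<Longrightarrow> \<bar>A' p\<bar> \<le> B"
    using compact_continuous_bounded[OF K(1) A'K] by blast
  define W where "W p = (1 + B) * \<bar>V p\<bar> + \<bar>S' p\<bar>" for p
  have W: "set_integrable lborel K W" unfolding W_def
    by (intro set_integral_add set_integrable_mult_right set_integrable_abs V set_integrable_continuous_compact K S'K)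
  define M where "M = (LINT p:K|lborel. W p)"
  have \<psi>K: "continuous_on K \<psi>x" "continuous_on K \<psi>t" using c K continuous_on_subset by blast+
  have bound: "\<bar>D\<bar> \<le> e * M" if "e > 0" for e
  proof -
    obtain f where f: "test_fun2 f" "\<forall>p. f p \<noteq> 0 \<longrightarrow> \<bar>fst p\<bar> \<le> R + 1 \<and> snd p \<le> T'"
      "\<forall>x t. 0 \<le> t \<longrightarrow> \<bar>f (x,t) - \<psi> (x,t)\<bar> \<le> e \<and> \<bar>px f (x,t) - \<psi>x (x,t)\<bar> \<le> e \<and> \<bar>pt f (x,t) - \<psi>t (x,t)\<bar> \<le> e"
      using smooth_approximation_half_plane[OF c dx dt supp \<open>e > 0\<close>] by blast
    have z: "px f (x,t) = 0 \<and> pt f (x,t) = 0" if "R + 1 < \<bar>x\<bar> \<or> T' < t" for x t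
    proof -
      have "open {q :: real \<times> real. R + 1 < \<bar>fst q\<bar> \<or> T' < snd q}"
        by (intro open_Collect_disj open_Collect_less continuous_intros)
      moreover have "f q = 0" if "q \<in> {q. R + 1 < \<bar>fst q\<bar> \<or> T' < snd q}" for q using f(2)[rule_format, of q] that by (cases "f q = 0") auto
      ultimately show ?thesis
        using px_pt_eq_0[of "{q. R + 1 < \<bar>fst q\<bar> \<or> T' < snd q}" "(x,t)" f] that by auto
    qed
    have "(LINT p:strip T|lborel. I (pt f) (px f) p) = 0"
      using w[unfolded weak_sol_transport_def, THEN conjunct2, rule_format, of f T'] f(1,2) T'
      by (simp add: I_def V_def A'_def S'_def case_prod_unfold)
    then have f0: "(LINT p:K|lborel. I (pt f) (px f) p) = 0"
      using restrict[of "pt f" "px f"] z by simp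
    note fK = int_I[OF test_fun2_pt_cont[OF f(1)] test_fun2_px_cont[OF f(1)]] int_I[OF \<psi>K(2,1)]
    have "D = (LINT p:K|lborel. I \<psi>t \<psi>x p - I (pt f) (px f) p)"
      unfolding D_def using f0 by (subst set_integral_diff(2)[OF fK(2,1)]) simp
    moreover have "norm (LINT p:K|lborel. I \<psi>t \<psi>x p - I (pt f) (px f) p) \<le> (LINT p:K|lborel. e * W p)"
      unfolding set_lebesgue_integral_def
    proof (rule Bochner_Integration.integral_norm_bound_integral)
      show "integrable lborel (\<lambda>p. indicator K p *\<^sub>R (I \<psi>t \<psi>x p - I (pt f) (px f) p))"
        using set_integral_diff(1)[OF fK(2,1)] by (simp add: set_integrable_def)
      show "integrable lborel (\<lambda>p. indicator K p *\<^sub>R (e * W p))"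
        using set_integrable_mult_right[of e, OF W] by (simp add: set_integrable_def)
      fix p :: "real \<times> real"
      show "norm (indicator K p *\<^sub>R (I \<psi>t \<psi>x p - I (pt f) (px f) p)) \<le> indicator K p *\<^sub>R (e * W p)"
      proof (cases "p \<in> K")
        case True
        obtain x t where p: "p = (x,t)" "0 \<le> t" using True by (cases p) (auto simp: K_def)
        have 1: "\<bar>\<psi>t p - pt f p\<bar> \<le> e" "\<bar>\<psi>x p - px f p\<bar> \<le> e"
          using f(3) p by (auto simp: abs_minus_commute)
        have e1: "I \<psi>t \<psi>x p - I (pt f) (px f) p = V p * (\<psi>t p - pt f p) - (A' p * V p) * (\<psi>x p - px f p) - S' p * (\<psi>x p - px f p)"
          by (simp add: I_def algebra_simps)
        have "norm (I \<psi>t \<psi>x p - I (pt f) (px f) p) \<le> \<bar>V p\<bar> * \<bar>\<psi>t p - pt f p\<bar> + (\<bar>A' p\<bar> * \<bar>V p\<bar>) * \<bar>\<psi>x p - px f p\<bar> + \<bar>S' p\<bar> * \<bar>\<psi>x p - px f p\<bar>"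
          unfolding e1 real_norm_def abs_mult[symmetric] by linarith
        also have "\<dots> \<le> \<bar>V p\<bar> * e + (B * \<bar>V p\<bar>) * e + \<bar>S' p\<bar> * e"
          using B[OF True] 1 by (intro add_mono mult_mono order_refl) (auto intro: order_trans[OF abs_ge_zero])
        also have "\<dots> = e * W p" by (simp add: W_def algebra_simps)
        finally show ?thesis using True by simp
      qed simp
    qed
    moreover have "(LINT p:K|lborel. e * W p) = e * M" by (simp add: M_def)
    ultimately show ?thesis by (simp only: real_norm_def)
  qed
  then have "D = 0" by (rule abs_le_all_mult_imp_zero)
  moreover have "(LINT p:strip T|lborel. I \<psi>t \<psi>x p) = D"
    unfolding D_def by (rule restrict) (use supp in auto)
  ultimately show ?thesis by (simp add: I_def V_def A'_def S'_def case_prod_unfold)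
qed

section \<open>The dual problem\<close>


lemma px_support_bounded:
  assumes "\<And>p. f p \<noteq> 0 \<Longrightarrow> norm p \<le> R" "\<And>p. f p \<noteq> 0 \<Longrightarrow> \<delta> \<le> snd p \<and> snd p \<le> T'"
    and "R < norm p \<or> snd p < \<delta> \<or> T' < snd p"
  shows "f p = 0" "px f p = 0"
proof -
  have U: "open {q :: real \<times> real. R < norm q \<or> snd q < \<delta> \<or> T' < snd q}"
    by (intro open_Collect_disj open_Collect_less continuous_intros)
  have z: "f q = 0" if "q \<in> {q. R < norm q \<or> snd q < \<delta> \<or> T' < snd q}" for q
    using assms(1)[of q] assms(2)[of q] that by (cases "f q = 0") auto
  show "f p = 0" by (rule z) (use assms(3) in simp)
  show "px f p = 0" by (rule px_pt_eq_0(1)[OF U _ z]) (use assms(3) in simp_all)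
qed

text \<open>Rescaling to the unit interval makes the domain of integration independent of t, so
  continuity of parameter integrals applies.\<close>

lemma continuous_integral_upper_limit:
  fixes M :: "real \<Rightarrow> real \<Rightarrow> real"
  assumes M: "continuous_on UNIV (\<lambda>(\<xi>, s). M \<xi> s)"
  shows "continuous_on (UNIV \<times> {0..}) (\<lambda>(\<xi>, t). integral {0..t} (M \<xi>))"
proof -
  have eq: "integral {0..t} (M \<xi>) = t * integral (cbox 0 1) (\<lambda>r. M \<xi> (t * r))" if "0 \<le> t" for \<xi> t
  proof (cases "t = 0")
    case False
    then have t: "0 < t" using that by simp
    have "continuous_on {0..t} (\<lambda>s. (\<xi>, s))" by (intro continuous_intros)
    from continuous_on_compose2[OF M this] have "continuous_on {0..t} (M \<xi>)" by simp
    then have "(M \<xi> has_integral integral {0..t} (M \<xi>)) (cbox 0 t)"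
      by (simp add: integrable_continuous_interval integrable_integral)
    from has_integral_affinity'[OF this t, of 0]
    have "((\<lambda>r. M \<xi> (t * r)) has_integral integral {0..t} (M \<xi>) / t) (cbox 0 1)"
      using t by (simp add: divide_inverse mult.commute)
    then show ?thesis using t by (simp add: integral_unique)
  qed simp
  have "continuous_on (UNIV \<times> {0..}) (\<lambda>p. snd p * integral (cbox 0 1) (\<lambda>r. M (fst p) (snd p * r)))"
  proof (intro continuous_intros integral_continuous_on_param)
    show "continuous_on ((UNIV \<times> {0..}) \<times> cbox 0 1) (\<lambda>(p, r). M (fst p) (snd p * r))"
    proof -
      have "continuous_on ((UNIV \<times> {0..}) \<times> cbox 0 1) (\<lambda>z :: (real \<times> real) \<times> real. (fst (fst z), snd (fst z) * snd z))"
        by (intro continuous_intros)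
      from continuous_on_compose2[OF M this] show ?thesis by (simp add: case_prod_unfold)
    qed
  qed
  then show ?thesis
    by (rule continuous_on_eq) (auto simp: eq)
qed

text \<open>An intermediate time \<open>T1\<close> lets two closed pieces meet where f already
  vanishes, so they glue together without any condition at T.\<close>

lemma continuous_on_half_plane_from_strip:
  fixes f :: "real \<times> real \<Rightarrow> real"
  assumes f: "continuous_on (strip T) f" and T': "ereal T' < T" "0 < T"
    and z: "\<And>x t. 0 \<le> t \<Longrightarrow> T' < t \<Longrightarrow> f (x,t) = 0"
  shows "continuous_on (UNIV \<times> {0..}) f"
proof -
  have "max (ereal T') 0 < T" using T' by (simp add: max_def)
  then obtain T1 where T1: "max (ereal T') 0 < ereal T1" "ereal T1 < T" using ereal_dense2 by blast
  have "continuous_on (UNIV \<times> {0..T1}) f"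
    by (rule continuous_on_subset[OF f]) (use T1 in \<open>auto simp: strip_def intro: le_less_trans[of "ereal _" "ereal T1" T]\<close>)
  moreover have "continuous_on (UNIV \<times> {T1..}) f"
    by (rule continuous_on_eq[of _ "\<lambda>_. 0"]) (use T1 z in auto)
  ultimately have "continuous_on (UNIV \<times> {0..T1} \<union> UNIV \<times> {T1..}) f"
    by (intro continuous_on_closed_Un closed_Times) auto
  moreover have "UNIV \<times> {0..T1} \<union> UNIV \<times> {T1..} = (UNIV :: real set) \<times> {0..}" using T1 by auto
  ultimately show ?thesis by simp
qed

context C2_transport begin

lemma h_cont: "continuous_on (strip T) (\<lambda>p. h (fst p) (snd p))"
  and \<sigma>_cont: "continuous_on (strip T) (\<lambda>p. \<sigma> (fst p) (snd p))"
proof -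
  note c = continuous_on_compose2[OF smooth_fun_continuous[OF a, of UNIV]]
    continuous_on_compose2[OF smooth_fun_continuous[OF smooth_fun_deriv[OF a], of UNIV]]
    continuous_on_compose2[OF smooth_fun_continuous[OF smooth_fun_deriv[OF smooth_fun_deriv[OF a]], of UNIV]]
    continuous_on_compose2[OF smooth_fun_continuous[OF c, of UNIV]]
    continuous_on_compose2[OF smooth_fun_continuous[OF smooth_fun_deriv[OF c], of UNIV]]
    continuous_on_compose2[OF \<phi>_cont(1)[of UNIV]] continuous_on_compose2[OF \<phi>_cont(2)[of UNIV]]
    continuous_on_compose2[OF \<phi>2]
  have nz: "\<forall>p\<in>strip T. J (fst p) (snd p) ^ n \<noteq> 0" for n using J_nonzero(1) by auto
  show "continuous_on (strip T) (\<lambda>p. h (fst p) (snd p))"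
    unfolding h_def by (intro continuous_intros J_cont J_nonzero(1) nz c) auto
  show "continuous_on (strip T) (\<lambda>p. \<sigma> (fst p) (snd p))"
    unfolding \<sigma>_def by (intro continuous_intros J_cont J_nonzero(1) nz c) auto
qed

lemma \<Xi>_cont_strip: "continuous_on (strip T) (\<lambda>p. \<Xi> (fst p) (snd p))"
  by (intro \<Xi>_cont continuous_intros) (auto simp: strip_eq_Times)

lemma continuous_on_strip_compose_\<Xi>:
  assumes "continuous_on (strip T) (\<lambda>p. f (fst p) (snd p))"
  shows "continuous_on (strip T) (\<lambda>p. f (\<Xi> (fst p) (snd p)) (snd p))"
proof -
  have 1: "continuous_on (strip T) (\<lambda>p. (\<Xi> (fst p) (snd p), snd p))"
    by (intro continuous_on_Pair \<Xi>_cont_strip continuous_intros)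
  have "(\<lambda>p. (\<Xi> (fst p) (snd p), snd p)) ` strip T \<subseteq> strip T" by (auto simp: strip_eq_Times)
  from continuous_on_compose2[OF assms 1 this] show ?thesis by simp
qed

lemma set_integral_lagrange_continuous:
  fixes F :: "real \<times> real \<Rightarrow> real"
  assumes F: "continuous_on (strip T) F"
  shows "(LINT p:strip T|lborel. F p) = (LINT p:strip T|lborel. F (lagrange_map p) * J (fst p) (snd p))"
proof -
  have m: "(\<lambda>p. indicator (strip T) p *\<^sub>R F p) \<in> borel_measurable borel"
    by (rule borel_measurable_continuous_on_indicator[OF strip_borel F])
  have "(LINT p:strip T|lborel. F p) = (LINT p:strip T|lborel. indicator (strip T) p *\<^sub>R F p)"
    unfolding set_lebesgue_integral_def by (rule Bochner_Integration.integral_cong) (auto simp: indicator_def)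
  also have "\<dots> = (LINT p:strip T|lborel. (indicator (strip T) (lagrange_map p) *\<^sub>R F (lagrange_map p)) * J (fst p) (snd p))"
    by (rule set_integral_lagrange[OF m])
  also have "\<dots> = (LINT p:strip T|lborel. F (lagrange_map p) * J (fst p) (snd p))"
    unfolding set_lebesgue_integral_def
    by (rule Bochner_Integration.integral_cong) (auto simp: indicator_def lagrange_map_def strip_eq_Times)
  finally show ?thesis .
qed

lemma set_integrable_strip_compact_support:
  fixes F :: "real \<times> real \<Rightarrow> real"
  assumes F: "continuous_on (strip T) F" and T': "ereal T' < T"
    and z: "\<And>x t. (x,t) \<in> strip T \<Longrightarrow> R < \<bar>x\<bar> \<or> T' < t \<Longrightarrow> F (x,t) = 0"
  shows "set_integrable lborel (strip T) F"
    and "(LINT p:strip T|lborel. F p) = integral (cbox (-R,0) (R,T')) F"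
proof -
  let ?K = "{-R..R} \<times> {0..T'}"
  have K: "compact ?K" "?K \<subseteq> strip T" using strip_rectangle_subset[OF T'] by (auto intro!: compact_Times)
  have z': "F p = 0" if "p \<in> strip T" "p \<notin> ?K" for p
  proof -
    obtain x t where p: "p = (x,t)" by (cases p)
    have "R < \<bar>x\<bar> \<or> T' < t" using that by (auto simp: p strip_def)
    then show ?thesis using z that by (simp add: p)
  qed
  have i: "set_integrable lborel ?K F"
    by (rule set_integrable_continuous_compact[OF K(1) continuous_on_subset[OF F K(2)]])
  then show "set_integrable lborel (strip T) F" using set_integrable_superset_zero[OF K(2), of F] z' by blast
  have "(LINT p:strip T|lborel. F p) = (LINT p:?K|lborel. F p)" by (rule set_integral_superset_zero[OF K(2) z'])
  also have "\<dots> = integral ?K F" using set_borel_integral_eq_integral(2)[OF i] .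
  finally show "(LINT p:strip T|lborel. F p) = integral (cbox (-R,0) (R,T')) F"
    by (simp add: cbox_Pair_eq)
qed

text \<open>Integration by parts along characteristics, where \<open>\<sigma>\<close> is the time derivative of \<open>h\<close> and \<open>h\<close> vanishes at time 0.\<close>
lemma integral_\<sigma>_by_parts:
  fixes g g' :: "real \<Rightarrow> real \<Rightarrow> real"
  assumes g: "continuous_on (strip T) (\<lambda>p. g (fst p) (snd p))" "continuous_on (strip T) (\<lambda>p. g' (fst p) (snd p))"
    and d: "\<And>\<xi> t. t \<in> time_interval T \<Longrightarrow> ((\<lambda>t. g \<xi> t) has_real_derivative g' \<xi> t) (at t within {0..})"
    and T': "ereal T' < T" "0 < T"
    and z: "\<And>\<xi> t. t \<in> time_interval T \<Longrightarrow> R < \<bar>\<xi>\<bar> \<or> T' < t \<Longrightarrow> g \<xi> t = 0"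
      "\<And>\<xi> t. t \<in> time_interval T \<Longrightarrow> R < \<bar>\<xi>\<bar> \<or> T' < t \<Longrightarrow> g' \<xi> t = 0"
  shows "(LINT p:strip T|lborel. \<sigma> (fst p) (snd p) * g (fst p) (snd p)) =
     - (LINT p:strip T|lborel. h (fst p) (snd p) * g' (fst p) (snd p))"
proof -
  \<comment> \<open>The time \<open>T1\<close> lies beyond the support, so \<open>g\<close> vanishes
    there, and it is positive even if \<open>T'\<close> is not.\<close>
  have "max (ereal T') 0 < T" using T' by (simp add: max_def)
  then obtain T1 where T1: "max (ereal T') 0 < ereal T1" "ereal T1 < T" using ereal_dense2 by blast
  then have T1': "T' < T1" "0 < T1" by auto
  let ?F1 = "\<lambda>p. \<sigma> (fst p) (snd p) * g (fst p) (snd p)"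
  let ?F2 = "\<lambda>p. h (fst p) (snd p) * g' (fst p) (snd p)"
  have c: "continuous_on (strip T) ?F1" "continuous_on (strip T) ?F2" "continuous_on (strip T) (\<lambda>p. ?F1 p + ?F2 p)"
    by (intro continuous_intros h_cont \<sigma>_cont g)+
  have z': "?F1 (\<xi>,t) = 0" "?F2 (\<xi>,t) = 0" if "(\<xi>,t) \<in> strip T" "R < \<bar>\<xi>\<bar> \<or> T1 < t" for \<xi> t
    using z[of t \<xi>] that T1' by (auto simp: strip_eq_Times)
  have i: "set_integrable lborel (strip T) ?F1" "set_integrable lborel (strip T) ?F2"
    by (rule set_integrable_strip_compact_support(1)[OF c(1) T1(2) z'(1)] set_integrable_strip_compact_support(1)[OF c(2) T1(2) z'(2)]; assumption)+
  have "(LINT p:strip T|lborel. ?F1 p) + (LINT p:strip T|lborel. ?F2 p) = (LINT p:strip T|lborel. ?F1 p + ?F2 p)"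
    using i by (simp add: set_integral_add)
  also have "\<dots> = integral (cbox (-R,0) (R,T1)) (\<lambda>p. ?F1 p + ?F2 p)"
  proof (rule set_integrable_strip_compact_support(2)[OF c(3) T1(2)])
    fix x t assume "(x,t) \<in> strip T" "R < \<bar>x\<bar> \<or> T1 < t"
    from z'(1)[OF this] z'(2)[OF this] show "?F1 (x,t) + ?F2 (x,t) = 0" by (simp only: add_0_left)
  qed
  also have "\<dots> = integral (cbox (-R) R) (\<lambda>\<xi>. integral (cbox 0 T1) (\<lambda>t. ?F1 (\<xi>,t) + ?F2 (\<xi>,t)))"
    using strip_rectangle_subset[OF T1(2), of "-R" R]
    by (intro integral_prod_continuous continuous_on_subset[OF c(3)]) (auto simp: cbox_Pair_eq)
  also have "\<dots> = integral (cbox (-R) R) (\<lambda>\<xi>. 0)"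
  proof (rule integral_cong)
    fix \<xi> :: real
    have ti: "t \<in> time_interval T" if "t \<in> {0..T1}" for t
      by (rule time_interval_downward[of T1]) (use T1 T1' that in \<open>auto simp: time_interval_def\<close>)
    have "((\<lambda>t. ?F1 (\<xi>,t) + ?F2 (\<xi>,t)) has_integral h \<xi> T1 * g \<xi> T1 - h \<xi> 0 * g \<xi> 0) {0..T1}"
    proof (rule fundamental_theorem_of_calculus)
      fix t assume t: "t \<in> {0..T1}"
      have "((\<lambda>t. g \<xi> t) has_real_derivative g' \<xi> t) (at t within {0..T1})"
        by (rule DERIV_subset[OF d[OF ti[OF t]]]) auto
      moreover have "((\<lambda>t. h \<xi> t) has_real_derivative \<sigma> \<xi> t) (at t within {0..T1})"
        using J_pos[OF ti[OF t], of \<xi>] by (intro has_field_derivative_at_within[OF h_DERIV_t]) simp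
      ultimately have "((\<lambda>t. h \<xi> t * g \<xi> t) has_real_derivative \<sigma> \<xi> t * g \<xi> t + g' \<xi> t * h \<xi> t) (at t within {0..T1})"
        by (intro DERIV_mult)
      then have "((\<lambda>t. h \<xi> t * g \<xi> t) has_real_derivative ?F1 (\<xi>,t) + ?F2 (\<xi>,t)) (at t within {0..T1})"
        by (simp add: mult.commute)
      then show "((\<lambda>t. h \<xi> t * g \<xi> t) has_vector_derivative ?F1 (\<xi>,t) + ?F2 (\<xi>,t)) (at t within {0..T1})"
        by (simp add: has_real_derivative_iff_has_vector_derivative)
    qed (use T1' in simp)
    moreover have "g \<xi> T1 = 0" using z(1)[of T1 \<xi>] T1' ti[of T1] by auto
    moreover have "h \<xi> 0 = 0" by (simp add: h_def)
    ultimately show "integral (cbox 0 T1) (\<lambda>t. ?F1 (\<xi>,t) + ?F2 (\<xi>,t)) = 0" by (simp add: integral_unique)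
  qed
  finally show ?thesis by simp
qed

end

lemma integral_upper_limit_DERIV:
  fixes f :: "real \<Rightarrow> real"
  assumes f: "continuous_on {0..} f" and t: "0 \<le> t"
  shows "((\<lambda>t. integral {0..t} f) has_real_derivative f t) (at t within {0..})"
proof -
  have "((\<lambda>t. integral {0..t} f) has_real_derivative f t) (at t within {0..t + 1})"
    by (rule integral_has_real_derivative[OF continuous_on_subset[OF f]]) (use t in auto)
  moreover have "at t within {0..t + 1} = at t within {0..}"
    by (rule at_within_nhd[of _ "{..<t + 1}"]) (use t in auto)
  ultimately show ?thesis by simp
qed

lemma integral_parameter_DERIV:
  fixes N M :: "real \<Rightarrow> real \<Rightarrow> real"
  assumes N: "continuous_on UNIV (\<lambda>(\<xi>, s). N \<xi> s)" and M: "continuous_on UNIV (\<lambda>(\<xi>, s). M \<xi> s)"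
    and d: "\<And>\<xi> s. ((\<lambda>\<xi>. N \<xi> s) has_real_derivative M \<xi> s) (at \<xi>)"
  shows "((\<lambda>\<xi>. integral {0..t} (N \<xi>)) has_real_derivative integral {0..t} (M \<xi>)) (at \<xi>)"
proof -
  have "((\<lambda>\<xi>. integral (cbox 0 t) (N \<xi>)) has_real_derivative integral (cbox 0 t) (M \<xi>)) (at \<xi> within UNIV)"
  proof (rule leibniz_rule_field_derivative)
    fix \<xi> s :: real
    show "(N \<xi>) integrable_on cbox 0 t"
    proof (rule integrable_continuous)
      have "continuous_on (cbox 0 t) (\<lambda>s. (\<xi>, s))" by (intro continuous_intros)
      from continuous_on_compose2[OF N this] show "continuous_on (cbox 0 t) (N \<xi>)" by simp
    qed
  qed (use d continuous_on_subset[OF M] in auto)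
  then show ?thesis by simp
qed

context C2_transport begin

lemma source_cont: "continuous_on (strip T) (\<lambda>(x,t). source_term a c v x t)"
  by (rule continuous_on_eq[OF continuous_on_strip_compose_\<Xi>[OF \<sigma>_cont]]) (auto simp: source_eq strip_eq_Times)

lemma a_v_cont: "continuous_on (strip T) (\<lambda>(x,t). a (v x t))"
  using continuous_on_compose2[OF smooth_fun_continuous[OF a, of UNIV] v_cont(1)] by (simp add: case_prod_unfold)

text \<open>Supports are bounded in x but integrals are computed in \<xi>. The continuous inverse
  \<Xi> is bounded on a compact rectangle, which transfers the bound.\<close>

lemma lagrangian_support_bounded:
  assumes T': "ereal T' < T"
  obtains R1 where "\<And>\<xi> t. t \<in> {0..T'} \<Longrightarrow> \<bar>X \<xi> t\<bar> \<le> R \<Longrightarrow> \<bar>\<xi>\<bar> \<le> R1"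
proof -
  have K: "{-R..R} \<times> {0..T'} \<subseteq> strip T" by (rule strip_rectangle_subset[OF T'])
  obtain R1 where R1: "\<And>p. p \<in> {-R..R} \<times> {0..T'} \<Longrightarrow> \<bar>\<Xi> (fst p) (snd p)\<bar> \<le> R1"
    using compact_continuous_bounded[OF compact_Times[OF compact_Icc compact_Icc] continuous_on_subset[OF \<Xi>_cont_strip K]] by blast
  have "\<bar>\<xi>\<bar> \<le> R1" if "t \<in> {0..T'}" "\<bar>X \<xi> t\<bar> \<le> R" for \<xi> t
  proof -
    have "- R \<le> X \<xi> t" "X \<xi> t \<le> R" using that(2) by linarith+
    then have m: "(X \<xi> t, t) \<in> {-R..R} \<times> {0..T'}" using that(1) by simp
    then have "t \<in> time_interval T" using K mem_strip_iff by blast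
    then show ?thesis using R1[OF m] by (simp add: \<Xi>_X)
  qed
  then show ?thesis by (rule that)
qed

text \<open>Uniqueness by duality. In Lagrangian coordinates the dual equation \<psi>_t - a(v)
  \<psi>_x = \<eta> says that \<open>P\<close> has time derivative \<open>N\<close>, so it is solved
  by one integration. In the weak formulation the terms with \<open>v1\<close> combine to
  \<open>v1 * \<eta>\<close>. The factor 1/J in \<psi>_x cancels the Jacobian of the substitution,
  and the time derivative of \<open>Px\<close> is \<open>M\<close>, that is \<eta>_x J.\<close>

lemma weak_sol_integral_test_fun:
  assumes T: "0 < T" and w: "weak_sol_transport (\<lambda>x t. a (v x t)) (source_term a c v) T v1"
    and \<eta>: "test_fun2 \<eta>" and T': "ereal T' < T"
    and \<delta>: "\<And>p. \<eta> p \<noteq> 0 \<Longrightarrow> \<delta> \<le> snd p \<and> snd p \<le> T'"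
  shows "(LINT p:strip T|lborel. v1 (fst p) (snd p) * \<eta> p) =
    - (LINT p:strip T|lborel. h (\<Xi> (fst p) (snd p)) (snd p) * px \<eta> p)"
proof -
  obtain R where R: "\<And>p. \<eta> p \<noteq> 0 \<Longrightarrow> norm p \<le> R" using \<eta> unfolding test_fun2_def by blast
  note z = px_support_bounded[OF R \<delta>]
  have z0: "\<eta> (x,t) = 0 \<and> px \<eta> (x,t) = 0" if "R < \<bar>x\<bar> \<or> T' < t" for x t
  proof -
    have "\<bar>x\<bar> \<le> norm (x,t)" using norm_fst_le[of x t] by simp
    then show ?thesis using that z[where p="(x,t)"] by auto
  qed
  define N where "N \<xi> s = \<eta> (X \<xi> s, s)" for \<xi> s
  define M where "M \<xi> s = px \<eta> (X \<xi> s, s) * J \<xi> s" for \<xi> s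
  have cX: "continuous_on UNIV (\<lambda>p. (X (fst p) (snd p), snd p))" by (intro continuous_intros X_cont)
  have cN: "continuous_on UNIV (\<lambda>(\<xi>, s). N \<xi> s)"
    using continuous_on_compose2[OF test_fun2_cont[OF \<eta>, of UNIV] cX] by (simp add: N_def case_prod_unfold)
  have cM: "continuous_on UNIV (\<lambda>(\<xi>, s). M \<xi> s)"
    using continuous_on_mult[OF continuous_on_compose2[OF test_fun2_px_cont[OF \<eta>, of UNIV] cX] J_cont] by (simp add: M_def case_prod_unfold)
  have cNs: "continuous_on {0..} (N \<xi>)" and cMs: "continuous_on {0..} (M \<xi>)" for \<xi>
  proof -
    have "continuous_on {0..} (\<lambda>s. (\<xi>, s))" by (intro continuous_intros)
    from continuous_on_compose2[OF cN this] continuous_on_compose2[OF cM this]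
    show "continuous_on {0..} (N \<xi>)" "continuous_on {0..} (M \<xi>)" by simp_all
  qed
  have dN: "((\<lambda>\<xi>. N \<xi> s) has_real_derivative M \<xi> s) (at \<xi>)" for \<xi> s
    unfolding N_def M_def by (rule DERIV_chain2[OF test_fun2_DERIV_x[OF \<eta>] X_DERIV])
  \<comment> \<open>Subtracting the integral up to \<open>T'\<close> makes \<open>P\<close> vanish
    after \<open>T'\<close>; at time 0 it need not vanish.\<close>
  define P where "P \<xi> t = integral {0..t} (N \<xi>) - integral {0..T'} (N \<xi>)" for \<xi> t
  define Px where "Px \<xi> t = integral {0..t} (M \<xi>) - integral {0..T'} (M \<xi>)" for \<xi> t
  have P_x: "((\<lambda>\<xi>. P \<xi> t) has_real_derivative Px \<xi> t) (at \<xi>)" for \<xi> t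
    unfolding P_def Px_def by (intro DERIV_diff integral_parameter_DERIV cN cM dN)
  have P_t: "((\<lambda>t. P \<xi> t) has_real_derivative N \<xi> t) (at t within {0..})" if "0 \<le> t" for \<xi> t
    using DERIV_diff[OF integral_upper_limit_DERIV[OF cNs that] DERIV_const] by (simp add: P_def)
  have Px_t: "((\<lambda>t. Px \<xi> t) has_real_derivative M \<xi> t) (at t within {0..})" if "0 \<le> t" for \<xi> t
    using DERIV_diff[OF integral_upper_limit_DERIV[OF cMs that] DERIV_const] by (simp add: Px_def)
  have late: "P \<xi> t = 0 \<and> Px \<xi> t = 0 \<and> M \<xi> t = 0 \<and> N \<xi> t = 0" if "0 \<le> t" "T' < t" for \<xi> t
  proof -
    have "integral {0..t} (N \<xi>) = integral {0..T'} (N \<xi>)"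
      by (rule integral_superset_zero) (use that z0 in \<open>auto simp: N_def\<close>)
    moreover have "integral {0..t} (M \<xi>) = integral {0..T'} (M \<xi>)"
      by (rule integral_superset_zero) (use that z0 in \<open>auto simp: M_def\<close>)
    ultimately show ?thesis using that z0 by (simp add: P_def Px_def M_def N_def)
  qed
  have early: "t \<in> time_interval T" if "t \<in> {0..T'}" for t
    using that T' by (auto simp: time_interval_def intro: le_less_trans[of "ereal t" "ereal T'" T])
  obtain R1 where R1: "\<And>\<xi> t. t \<in> {0..T'} \<Longrightarrow> \<bar>X \<xi> t\<bar> \<le> R \<Longrightarrow> \<bar>\<xi>\<bar> \<le> R1"
    using lagrangian_support_bounded[OF T'] by blast
  have far: "N \<xi> s = 0 \<and> M \<xi> s = 0" if "R1 < \<bar>\<xi>\<bar>" "0 \<le> s" for \<xi> s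
  proof (cases "R < \<bar>X \<xi> s\<bar> \<or> T' < s")
    case True
    then show ?thesis using z0 by (simp add: N_def M_def)
  next
    case False
    then show ?thesis using R1[of s \<xi>] that by simp
  qed
  have far': "P \<xi> t = 0 \<and> Px \<xi> t = 0" if "R1 < \<bar>\<xi>\<bar>" for \<xi> t
  proof -
    have "integral {0..t} (N \<xi>) = integral {0..t} (\<lambda>_. 0)" for t
      by (rule integral_cong) (use far[OF that] in simp)
    moreover have "integral {0..t} (M \<xi>) = integral {0..t} (\<lambda>_. 0)" for t
      by (rule integral_cong) (use far[OF that] in simp)
    ultimately show ?thesis by (simp add: P_def Px_def)
  qed
  \<comment> \<open>Carries the support bound back to x: a point with |x| > R2 has starting point
    |\<xi>| > R1.\<close>
  obtain R2 where R2: "\<And>p. p \<in> {-R1..R1} \<times> {0..T'} \<Longrightarrow> \<bar>X (fst p) (snd p)\<bar> \<le> R2"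
    using compact_continuous_bounded[OF compact_Times[OF compact_Icc compact_Icc] X_cont] by blast
  have far2: "R1 < \<bar>\<Xi> x t\<bar>" if "R2 < \<bar>x\<bar>" "t \<in> {0..T'}" for x t
  proof (rule ccontr)
    assume "\<not> R1 < \<bar>\<Xi> x t\<bar>"
    then have "- R1 \<le> \<Xi> x t" "\<Xi> x t \<le> R1" by linarith+
    then have "\<bar>X (\<Xi> x t) t\<bar> \<le> R2" using R2[of "(\<Xi> x t, t)"] that by simp
    then show False using that X_\<Xi>[OF early[OF that(2)]] by simp
  qed
  have cP: "continuous_on (strip T) (\<lambda>p. P (fst p) (snd p))" and cPx: "continuous_on (strip T) (\<lambda>p. Px (fst p) (snd p))"
  proof -
    have s: "strip T \<subseteq> UNIV \<times> {0..}" by (auto simp: strip_def)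
    have "continuous_on UNIV (\<lambda>p. integral {0..T'} (N (fst p)))"
      using P_x[of 0, unfolded P_def]
      by (intro continuous_on_compose2[of UNIV "\<lambda>\<xi>. integral {0..T'} (N \<xi>)" UNIV fst] continuous_intros
          DERIV_continuous_on[of _ _ "\<lambda>\<xi>. integral {0..T'} (M \<xi>)"] integral_parameter_DERIV cN cM dN) auto
    moreover have "continuous_on UNIV (\<lambda>p. integral {0..T'} (M (fst p)))"
    proof -
      have "continuous_on UNIV (\<lambda>\<xi>. integral (cbox 0 T') (M \<xi>))"
        by (rule integral_continuous_on_param) (use continuous_on_subset[OF cM] in auto)
      then show ?thesis by (intro continuous_on_compose2[of UNIV "\<lambda>\<xi>. integral {0..T'} (M \<xi>)" UNIV fst] continuous_intros) auto
    qed
    ultimately show "continuous_on (strip T) (\<lambda>p. P (fst p) (snd p))" "continuous_on (strip T) (\<lambda>p. Px (fst p) (snd p))"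
      using continuous_on_subset[OF continuous_integral_upper_limit[OF cN] s] continuous_on_subset[OF continuous_integral_upper_limit[OF cM] s]
      unfolding P_def Px_def
      by (auto intro!: continuous_on_diff intro: continuous_on_subset simp: case_prod_unfold)
  qed
  \<comment> \<open>The test function is needed on the whole half plane. After \<open>T'\<close> it
    is 0, so the value 0 outside the strip is the consistent extension.\<close>
  define \<psi> where "\<psi> p = (if p \<in> strip T then P (\<Xi> (fst p) (snd p)) (snd p) else 0)" for p
  define \<psi>x where "\<psi>x p = (if p \<in> strip T then Px (\<Xi> (fst p) (snd p)) (snd p) / J (\<Xi> (fst p) (snd p)) (snd p) else 0)" for p
  \<comment> \<open>Defined by the dual equation; that it is the time derivative of \<psi> follows
    from the chain rule along \<Xi>.\<close>
  define \<psi>t where "\<psi>t p = (if p \<in> strip T then a (v (fst p) (snd p)) * \<psi>x p + \<eta> p else 0)" for p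
  have zero: "\<psi> (x,t) = 0 \<and> \<psi>x (x,t) = 0 \<and> \<psi>t (x,t) = 0" if "0 \<le> t" "max R R2 < \<bar>x\<bar> \<or> T' < t" for x t
  proof -
    have "P (\<Xi> x t) t = 0 \<and> Px (\<Xi> x t) t = 0"
    proof (cases "T' < t")
      case True then show ?thesis using late that by blast
    next
      case False
      then show ?thesis using that by (intro far' far2) auto
    qed
    moreover have "\<eta> (x,t) = 0" using z0 that by auto
    ultimately show ?thesis by (simp add: \<psi>_def \<psi>x_def \<psi>t_def)
  qed
  have c\<psi>: "continuous_on (strip T) \<psi>"
    by (rule continuous_on_eq[OF continuous_on_strip_compose_\<Xi>[OF cP]]) (simp add: \<psi>_def)
  have c\<psi>x: "continuous_on (strip T) \<psi>x"
    by (rule continuous_on_eq[OF continuous_on_divide[OF continuous_on_strip_compose_\<Xi>[OF cPx] continuous_on_strip_compose_\<Xi>[OF J_cont] J_nonzero(2)]])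
      (simp add: \<psi>x_def)
  have c\<psi>t: "continuous_on (strip T) \<psi>t"
    by (rule continuous_on_eq[OF continuous_on_add[OF continuous_on_mult[OF a_v_cont c\<psi>x] test_fun2_cont[OF \<eta>]]])
      (simp add: \<psi>t_def case_prod_unfold)
  have test: "(LINT p:strip T|lborel. (\<lambda>(x,t). v1 x t * \<psi>t (x,t) - (a (v x t) * v1 x t + source_term a c v x t) * \<psi>x (x,t)) p) = 0"
  proof (rule weak_sol_transport_C1_test[where R = "max R R2", OF w T' a_v_cont source_cont])
    show "continuous_on (UNIV \<times> {0..}) \<psi>" "continuous_on (UNIV \<times> {0..}) \<psi>x" "continuous_on (UNIV \<times> {0..}) \<psi>t"
      by (rule continuous_on_half_plane_from_strip[OF c\<psi> T' T] continuous_on_half_plane_from_strip[OF c\<psi>x T' T]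
        continuous_on_half_plane_from_strip[OF c\<psi>t T' T], simp add: zero)+
    show "((\<lambda>y. \<psi> (y,t)) has_real_derivative \<psi>x (x,t)) (at x)" if "0 \<le> t" for x t
    proof (cases "t \<in> time_interval T")
      case True
      from DERIV_chain2[OF P_x \<Xi>_DERIV_x[OF True]]
      show ?thesis using True by (simp add: \<psi>_def \<psi>x_def mem_strip_iff)
    qed (simp add: \<psi>_def \<psi>x_def mem_strip_iff)
    show "((\<lambda>s. \<psi> (x,s)) has_real_derivative \<psi>t (x,t)) (at t within {0..})" if "0 \<le> t" for x t
    proof (cases "t \<in> time_interval T")
      case True
      have "((\<lambda>s. P (\<Xi> x s) s) has_real_derivative Px (\<Xi> x t) t * (a (v x t) / J (\<Xi> x t) t) + N (\<Xi> x t) t) (at t within time_interval T)"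
      proof (rule has_real_derivative_along_curve[where f = P and fx = Px and ft = N, OF P_x _ _ True convex_time_interval])
        show "((\<lambda>s. P \<xi> s) has_real_derivative N \<xi> s) (at s within time_interval T)" if "s \<in> time_interval T" for \<xi> s
          using P_t[of s \<xi>] that by (simp add: at_within_time_interval) (simp add: time_interval_def)
        show "continuous_on (UNIV \<times> time_interval T) (\<lambda>(\<xi>, s). N \<xi> s)" by (rule continuous_on_subset[OF cN]) auto
        show "((\<lambda>s. \<Xi> x s) has_real_derivative a (v x t) / J (\<Xi> x t) t) (at t within time_interval T)"
          using \<Xi>_DERIV_t[OF True] True by (simp add: at_within_time_interval)
      qed
      then have "((\<lambda>s. \<psi> (x,s)) has_real_derivative Px (\<Xi> x t) t * (a (v x t) / J (\<Xi> x t) t) + N (\<Xi> x t) t) (at t within time_interval T)"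
        by (rule has_field_derivative_transform_within[where d = 1]) (use True in \<open>auto simp: \<psi>_def mem_strip_iff\<close>)
      then show ?thesis using True
        by (simp add: at_within_time_interval \<psi>t_def \<psi>x_def mem_strip_iff N_def X_\<Xi> mult.commute)
    next
      case False
      then have "T' < t" using early[of t] that by (cases "t \<le> T'") auto
      have "((\<lambda>s. 0) has_real_derivative \<psi>t (x,t)) (at t within {0..})" using False by (simp add: \<psi>t_def mem_strip_iff)
      then show ?thesis
      proof (rule has_field_derivative_transform_within[where d = "t - T'"])
        fix s assume "s \<in> {0..}" "dist s t < t - T'"
        then have "0 \<le> s" "T' < s" by (auto simp: dist_real_def)
        then show "0 = \<psi> (x,s)" using zero by simp
      qed (use \<open>T' < t\<close> that in auto)
    qed
  qed (use zero in auto)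
  define S where "S p = \<sigma> (\<Xi> (fst p) (snd p)) (snd p) * \<psi>x p" for p
  have cS: "continuous_on (strip T) S"
    unfolding S_def by (intro continuous_on_mult c\<psi>x continuous_on_strip_compose_\<Xi> \<sigma>_cont)
  have iS: "set_integrable lborel (strip T) S"
    by (rule set_integrable_strip_compact_support(1)[OF cS T', of "max R R2"]) (use zero in \<open>auto simp: S_def strip_def\<close>)
  have iv: "set_integrable lborel (strip T) (\<lambda>p. v1 (fst p) (snd p) * \<eta> p)"
  proof -
    let ?K = "{-R..R} \<times> {0..T'}"
    have K: "compact ?K" "?K \<subseteq> strip T" using strip_rectangle_subset[OF T'] by (auto intro: compact_Times)
    have "set_integrable lborel ?K (\<lambda>p. v1 (fst p) (snd p))"
      using w[unfolded weak_sol_transport_def, THEN conjunct1, rule_format, OF conjI[OF K]] by (simp add: case_prod_unfold)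
    from set_integrable_mult_continuous[OF K(1) this test_fun2_cont[OF \<eta>]]
    have i: "set_integrable lborel ?K (\<lambda>p. v1 (fst p) (snd p) * \<eta> p)" .
    have z1: "v1 (fst p) (snd p) * \<eta> p = 0" if "p \<in> strip T" "p \<notin> ?K" for p
    proof -
      obtain x t where p: "p = (x,t)" by (cases p)
      have "R < \<bar>x\<bar> \<or> T' < t" using that by (auto simp: p strip_def)
      then show ?thesis using z0 by (simp add: p)
    qed
    show ?thesis by (rule set_integrable_superset_zero[THEN iffD2, OF K(2) z1 i])
  qed
  have "(LINT p:strip T|lborel. v1 (fst p) (snd p) * \<eta> p - S p) = 0"
  proof -
    have "(LINT p:strip T|lborel. v1 (fst p) (snd p) * \<eta> p - S p) =
      (LINT p:strip T|lborel. (\<lambda>(x,t). v1 x t * \<psi>t (x,t) - (a (v x t) * v1 x t + source_term a c v x t) * \<psi>x (x,t)) p)"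
      by (rule set_lebesgue_integral_cong)
        (auto simp: S_def \<psi>t_def source_eq mem_strip_iff left_diff_distrib distrib_left distrib_right)
    then show ?thesis using test by simp
  qed
  then have "(LINT p:strip T|lborel. v1 (fst p) (snd p) * \<eta> p) = (LINT p:strip T|lborel. S p)"
    using iv iS by (simp add: set_integral_diff)
  also have "\<dots> = (LINT p:strip T|lborel. S (lagrange_map p) * J (fst p) (snd p))"
    by (rule set_integral_lagrange_continuous[OF cS])
  also have "\<dots> = (LINT p:strip T|lborel. \<sigma> (fst p) (snd p) * Px (fst p) (snd p))"
  proof (rule set_lebesgue_integral_cong, simp, intro allI impI)
    fix p assume "p \<in> strip T"
    then obtain \<xi> t where p: "p = (\<xi>,t)" "t \<in> time_interval T" by (cases p) (auto simp: mem_strip_iff)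
    then show "S (lagrange_map p) * J (fst p) (snd p) = \<sigma> (fst p) (snd p) * Px (fst p) (snd p)"
      using J_pos[OF p(2), of \<xi>] by (simp add: S_def \<psi>x_def lagrange_map_def mem_strip_iff \<Xi>_X)
  qed
  also have "\<dots> = - (LINT p:strip T|lborel. h (fst p) (snd p) * M (fst p) (snd p))"
  proof (rule integral_\<sigma>_by_parts[OF cPx _ _ T' T])
    show "continuous_on (strip T) (\<lambda>p. M (fst p) (snd p))"
      using continuous_on_subset[OF cM] by (simp add: case_prod_unfold)
    show "((\<lambda>t. Px \<xi> t) has_real_derivative M \<xi> t) (at t within {0..})" if "t \<in> time_interval T" for \<xi> t
      using that by (intro Px_t) (simp add: time_interval_def)
    fix \<xi> t assume t: "t \<in> time_interval T" "R1 < \<bar>\<xi>\<bar> \<or> T' < t"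
    then have "0 \<le> t" by (simp add: time_interval_def)
    then show "Px \<xi> t = 0" "M \<xi> t = 0" using t(2) late far far' by blast+
  qed
  also have "(LINT p:strip T|lborel. h (fst p) (snd p) * M (fst p) (snd p)) =
      (LINT p:strip T|lborel. h (\<Xi> (fst p) (snd p)) (snd p) * px \<eta> p)"
  proof -
    have cH: "continuous_on (strip T) (\<lambda>p. h (\<Xi> (fst p) (snd p)) (snd p) * px \<eta> p)"
      by (intro continuous_on_mult continuous_on_strip_compose_\<Xi> h_cont test_fun2_px_cont[OF \<eta>])
    show ?thesis
      unfolding set_integral_lagrange_continuous[OF cH]
    proof (rule set_lebesgue_integral_cong, simp, intro allI impI)
      fix p assume "p \<in> strip T"
      then obtain \<xi> t where p: "p = (\<xi>,t)" "t \<in> time_interval T" by (cases p) (auto simp: mem_strip_iff)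
      then show "h (fst p) (snd p) * M (fst p) (snd p) =
        h (\<Xi> (fst (lagrange_map p)) (snd (lagrange_map p))) (snd (lagrange_map p)) * px \<eta> (lagrange_map p) * J (fst p) (snd p)"
        by (simp add: lagrange_map_def \<Xi>_X M_def)
    qed
  qed
  finally show ?thesis .
qed

end

section \<open>Existence of a weak solution\<close>


lemma test_fun2_px_pt:
  assumes "test_fun2 f" shows test_fun2_px: "test_fun2 (px f)" and test_fun2_pt: "test_fun2 (pt f)"
proof -
  have s: "smooth2 f" using assms by (simp add: test_fun2_def)
  obtain R where R: "\<And>p. f p \<noteq> 0 \<Longrightarrow> norm p \<le> R" using assms unfolding test_fun2_def by blast
  have U: "open {q :: real \<times> real. R < norm q}" by (intro open_Collect_less continuous_intros)
  have z: "f q = 0" if "q \<in> {q. R < norm q}" for q using R[of q] that by (cases "f q = 0") auto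
  have "px f p = 0 \<and> pt f p = 0" if "R < norm p" for p
    using px_pt_eq_0[OF U _ z] that by simp
  then have b: "px f p \<noteq> 0 \<Longrightarrow> norm p \<le> R" "pt f p \<noteq> 0 \<Longrightarrow> norm p \<le> R" for p by (meson not_le)+
  have "smooth2 (px f)"
    unfolding smooth2_def
  proof
    fix ds show "let g = fold (\<lambda>b g. if b then px g else pt g) ds (px f) in (\<forall>p. g differentiable at p) \<and> continuous_on UNIV g"
      using s[unfolded smooth2_def, rule_format, of "True # ds"] by simp
  qed
  moreover have "smooth2 (pt f)"
    unfolding smooth2_def
  proof
    fix ds show "let g = fold (\<lambda>b g. if b then px g else pt g) ds (pt f) in (\<forall>p. g differentiable at p) \<and> continuous_on UNIV g"
      using s[unfolded smooth2_def, rule_format, of "False # ds"] by simp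
  qed
  ultimately show "test_fun2 (px f)" "test_fun2 (pt f)" using b unfolding test_fun2_def by blast+
qed

text \<open>The notion of smoothness provides iterated partial derivatives without symmetry.
  Symmetry is obtained by integrating \<open>pt f\<close> in time, differentiating under the
  integral in x, and then differentiating in the upper limit.\<close>

lemma px_pt_commute:
  assumes f: "test_fun2 f" and t: "0 \<le> t"
  shows "px (pt f) (x,t) = pt (px f) (x,t)"
proof -
  note fx = test_fun2_px[OF f] and ft = test_fun2_pt[OF f]
  have ftc: "integral {0..t} (\<lambda>s. pt f (x,s)) = f (x,t) - f (x,0)" if "0 \<le> t" for x t
  proof (rule integral_unique, rule fundamental_theorem_of_calculus[OF that])
    fix s show "((\<lambda>s. f (x,s)) has_vector_derivative pt f (x,s)) (at s within {0..t})"
      using test_fun2_DERIV_t[OF f] by (simp add: has_real_derivative_iff_has_vector_derivative[symmetric] has_field_derivative_at_within)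
  qed
  have cc: "continuous_on UNIV (\<lambda>(\<xi>,s). pt f (\<xi>,s))" "continuous_on UNIV (\<lambda>(\<xi>,s). px (pt f) (\<xi>,s))"
    using test_fun2_cont[OF ft] test_fun2_px_cont[OF ft] by (simp_all add: case_prod_unfold)
  have eq: "px f (x,t) - px f (x,0) = integral {0..t} (\<lambda>s. px (pt f) (x,s))" if "0 \<le> t" for t
  proof -
    have "((\<lambda>x. integral {0..t} (\<lambda>s. pt f (x,s))) has_real_derivative integral {0..t} (\<lambda>s. px (pt f) (x,s))) (at x)"
      by (rule integral_parameter_DERIV[OF cc test_fun2_DERIV_x[OF ft]])
    then have "((\<lambda>x. f (x,t) - f (x,0)) has_real_derivative integral {0..t} (\<lambda>s. px (pt f) (x,s))) (at x)"
      by (simp add: ftc[OF that])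
    moreover have "((\<lambda>x. f (x,t) - f (x,0)) has_real_derivative px f (x,t) - px f (x,0)) (at x)"
      by (intro DERIV_diff test_fun2_DERIV_x[OF f])
    ultimately show ?thesis by (metis DERIV_unique)
  qed
  have "continuous_on {0..} (\<lambda>s. (x,s))" by (intro continuous_intros)
  from continuous_on_compose2[OF test_fun2_px_cont[OF ft, of UNIV] this]
  have "continuous_on {0..} (\<lambda>s. px (pt f) (x,s))" by simp
  from integral_upper_limit_DERIV[OF this t]
  have "((\<lambda>t. px f (x,t) - px f (x,0)) has_real_derivative px (pt f) (x,t)) (at t within {0..})"
  proof (rule has_field_derivative_transform_within[where d = 1])
    fix s :: real assume "s \<in> {0..}"
    then show "integral {0..s} (\<lambda>s. px (pt f) (x,s)) = px f (x,s) - px f (x,0)" using eq[of s] by simp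
  qed (use t in auto)
  moreover have "((\<lambda>t. px f (x,t) - px f (x,0)) has_real_derivative pt (px f) (x,t)) (at t within {0..})"
    using DERIV_diff[OF has_field_derivative_at_within[OF test_fun2_DERIV_t[OF fx]] DERIV_const] by simp
  ultimately show ?thesis
    by (rule has_field_derivative_unique_within[OF _ _ at_within_atLeast_neq_bot[OF t]])
qed

lemma integral_derivative_compact_support:
  fixes \<kappa> \<kappa>' :: "real \<Rightarrow> real"
  assumes d: "\<And>x. (\<kappa> has_real_derivative \<kappa>' x) (at x)" and c: "continuous_on UNIV \<kappa>'"
    and z: "\<And>x. R < \<bar>x\<bar> \<Longrightarrow> \<kappa> x = 0" "\<And>x. R < \<bar>x\<bar> \<Longrightarrow> \<kappa>' x = 0"
  shows "(LINT x|lborel. \<kappa>' x) = 0"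
proof -
  define Q where "Q = \<bar>R\<bar> + 1"
  have Q: "R < \<bar>x\<bar>" if "Q \<le> \<bar>x\<bar>" for x using that by (auto simp: Q_def)
  have "(LINT x|lborel. \<kappa>' x) = integral {-Q..Q} \<kappa>'"
    by (rule integral_continuous_compact_support(2)[OF c]) (use Q z in auto)
  also have "\<dots> = \<kappa> Q - \<kappa> (-Q)"
  proof (rule integral_unique, rule fundamental_theorem_of_calculus)
    fix x show "(\<kappa> has_vector_derivative \<kappa>' x) (at x within {-Q..Q})"
      using d by (simp add: has_real_derivative_iff_has_vector_derivative[symmetric] has_field_derivative_at_within)
  qed (simp add: Q_def)
  also have "\<dots> = 0" using z(1)[OF Q[of Q]] z(1)[OF Q[of "-Q"]] by simp
  finally show ?thesis .
qed

text \<open>The latest time in a nonempty compact set is attained, hence strictly below T.\<close>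

lemma compact_subset_strip_rectangle:
  assumes K: "compact K" "K \<subseteq> strip T"
  shows "\<exists>R T'. K \<subseteq> {-R..R} \<times> {0..T'} \<and> (K \<noteq> {} \<longrightarrow> ereal T' < T)"
proof (cases "K = {}")
  case False
  obtain R where R: "\<And>p. p \<in> K \<Longrightarrow> norm p \<le> R" using compact_imp_bounded[OF K(1)] by (auto simp: bounded_iff)
  obtain p0 where p0: "p0 \<in> K" "\<And>p. p \<in> K \<Longrightarrow> snd p \<le> snd p0"
    using continuous_attains_sup[OF K(1) False continuous_on_snd[OF continuous_on_id]] by blast
  have "p \<in> {-R..R} \<times> {0..snd p0}" if "p \<in> K" for p
  proof -
    have "\<bar>fst p\<bar> \<le> norm p" using norm_fst_le[of "fst p" "snd p"] by simp
    then have "\<bar>fst p\<bar> \<le> R" using R[OF that] by linarith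
    then have "- R \<le> fst p" "fst p \<le> R" by linarith+
    then show ?thesis using p0(2)[OF that] K(2) that by (auto simp: strip_def mem_Times_iff)
  qed
  moreover have "ereal (snd p0) < T" using p0(1) K(2) by (auto simp: strip_def)
  ultimately show ?thesis by blast
qed auto

section \<open>Differentiability of \<open>h\<close> in the starting point of the
  characteristic\<close>

context C2_transport begin

text \<open>Pairs a coefficient with its \<xi>-derivative. Closure under sums, products and the
  reciprocal of \<open>J\<close> reduces the coefficients of \<open>h\<close> to rule application,
  with joint continuity on the strip carried along.\<close>

definition C1x :: "(real \<Rightarrow> real \<Rightarrow> real) \<Rightarrow> (real \<Rightarrow> real \<Rightarrow> real) \<Rightarrow> bool" where
  "C1x f f' \<longleftrightarrow> continuous_on (strip T) (\<lambda>p. f (fst p) (snd p)) \<and> continuous_on (strip T) (\<lambda>p. f' (fst p) (snd p)) \<and>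
     (\<forall>\<xi>. \<forall>t\<in>time_interval T. ((\<lambda>\<xi>. f \<xi> t) has_real_derivative f' \<xi> t) (at \<xi>))"

lemma C1x_const: "C1x (\<lambda>\<xi> t. k t) (\<lambda>\<xi> t. 0)" if "continuous_on UNIV k"
  unfolding C1x_def
  by (auto intro!: continuous_intros continuous_on_compose2[OF that])

lemma C1x_space:
  assumes "\<And>\<xi>. (f has_real_derivative f' \<xi>) (at \<xi>)" "continuous_on UNIV f'"
  shows "C1x (\<lambda>\<xi> t. f \<xi>) (\<lambda>\<xi> t. f' \<xi>)"
proof -
  have "continuous_on UNIV f" using assms(1) by (meson DERIV_isCont continuous_at_imp_continuous_on)
  then show ?thesis unfolding C1x_def using assms
    by (auto intro!: continuous_on_compose2[of UNIV f] continuous_on_compose2[OF assms(2)] continuous_intros)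
qed

lemma C1x_comp_\<phi>: assumes "smooth_fun \<alpha>" shows "C1x (\<lambda>\<xi> t. \<alpha> (\<phi> \<xi>)) (\<lambda>\<xi> t. deriv \<alpha> (\<phi> \<xi>) * \<phi>1 \<xi>)"
  by (rule C1x_space) (auto intro!: DERIV_chain2[OF smooth_fun_DERIV[OF assms] \<phi>] continuous_intros \<phi>_cont
      continuous_on_compose2[OF smooth_fun_continuous[OF smooth_fun_deriv[OF assms], of UNIV]])

lemma C1x_mult: "C1x f f' \<Longrightarrow> C1x g g' \<Longrightarrow> C1x (\<lambda>\<xi> t. f \<xi> t * g \<xi> t) (\<lambda>\<xi> t. f' \<xi> t * g \<xi> t + g' \<xi> t * f \<xi> t)"
  unfolding C1x_def by (auto intro!: continuous_intros DERIV_mult)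

lemma C1x_add: "C1x f f' \<Longrightarrow> C1x g g' \<Longrightarrow> C1x (\<lambda>\<xi> t. f \<xi> t + g \<xi> t) (\<lambda>\<xi> t. f' \<xi> t + g' \<xi> t)"
  unfolding C1x_def by (auto intro!: continuous_intros DERIV_add)

lemma C1x_J: "C1x J (\<lambda>\<xi> t. - (t * b1 \<xi>))"
  unfolding C1x_def
proof (intro conjI allI ballI J_cont)
  show "continuous_on (strip T) (\<lambda>p. - (snd p * b1 (fst p)))"
    by (intro continuous_intros continuous_on_compose2[OF b1_cont[of UNIV]]) auto
  show "((\<lambda>\<xi>. J \<xi> t) has_real_derivative - (t * b1 \<xi>)) (at \<xi>)" for \<xi> t
    unfolding J_def by (auto intro!: derivative_eq_intros b_DERIV)
qed

lemma C1x_inverse_J: "C1x (\<lambda>\<xi> t. inverse (J \<xi> t)) (\<lambda>\<xi> t. t * b1 \<xi> * (inverse (J \<xi> t) * inverse (J \<xi> t)))"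
proof -
  have cI: "continuous_on (strip T) (\<lambda>p. inverse (J (fst p) (snd p)))"
    using J_nonzero(1) by (intro continuous_on_inverse J_cont) auto
  show ?thesis unfolding C1x_def
  proof (intro conjI allI ballI cI)
    show "continuous_on (strip T) (\<lambda>p. snd p * b1 (fst p) * (inverse (J (fst p) (snd p)) * inverse (J (fst p) (snd p))))"
      by (intro continuous_intros cI continuous_on_compose2[OF b1_cont[of UNIV]]) auto
    fix \<xi> t assume "t \<in> time_interval T"
    then have "J \<xi> t \<noteq> 0" using J_pos[of t \<xi>] by simp
    then show "((\<lambda>\<xi>. inverse (J \<xi> t)) has_real_derivative t * b1 \<xi> * (inverse (J \<xi> t) * inverse (J \<xi> t))) (at \<xi>)"
      using C1x_J \<open>t \<in> time_interval T\<close> unfolding C1x_def by (auto intro!: derivative_eq_intros)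
  qed
qed

text \<open>The split isolates \<phi>2, the one ingredient without a classical derivative:
  \<open>p\<close> and \<open>q\<close> are built from t, \<open>J\<close> and functions of \<phi>
  and \<phi>1, all of them C^1 in \<xi>.\<close>

lemma h_decomposition:
  "\<exists>p p' q q'. C1x p p' \<and> C1x q q' \<and> (\<forall>\<xi> t. h \<xi> t = p \<xi> t + q \<xi> t * \<phi>2 \<xi>)"
proof -
  let ?k = "\<lambda>\<xi> t. t / 2"
  let ?I = "\<lambda>\<xi> t. inverse (J \<xi> t)"
  have k: "C1x ?k (\<lambda>\<xi> t. 0)" by (rule C1x_const) (intro continuous_intros; simp)
  note basic = C1x_comp_\<phi>[OF a] C1x_comp_\<phi>[OF smooth_fun_deriv[OF a]] C1x_comp_\<phi>[OF smooth_fun_deriv[OF smooth_fun_deriv[OF a]]]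
    C1x_comp_\<phi>[OF c] C1x_comp_\<phi>[OF smooth_fun_deriv[OF c]] C1x_space[OF \<phi>1 \<phi>2] C1x_J C1x_inverse_J k
    C1x_const[OF continuous_on_const[of UNIV "1::real"]]
  \<comment> \<open>The derivative stays schematic and is assembled by unification while the closure
    rules are applied.\<close>
  have "\<exists>p'. C1x (\<lambda>\<xi> t. t / 2 * (c1 (\<phi> \<xi>) * a1 (\<phi> \<xi>) * (\<phi>1 \<xi> * \<phi>1 \<xi>) * ?I \<xi> t + c (\<phi> \<xi>) * a2 (\<phi> \<xi>) * (\<phi>1 \<xi> * \<phi>1 \<xi>) * (?I \<xi> t * ?I \<xi> t))) p'"
    by (rule exI, (rule basic C1x_mult C1x_add)+)
  moreover have "\<exists>q'. C1x (\<lambda>\<xi> t. t / 2 * (c (\<phi> \<xi>) * a1 (\<phi> \<xi>) * (1 + J \<xi> t) * (?I \<xi> t * ?I \<xi> t))) q'"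
    by (rule exI, (rule basic C1x_mult C1x_add)+)
  moreover have "h \<xi> t = t / 2 * (c1 (\<phi> \<xi>) * a1 (\<phi> \<xi>) * (\<phi>1 \<xi> * \<phi>1 \<xi>) * ?I \<xi> t + c (\<phi> \<xi>) * a2 (\<phi> \<xi>) * (\<phi>1 \<xi> * \<phi>1 \<xi>) * (?I \<xi> t * ?I \<xi> t))
      + t / 2 * (c (\<phi> \<xi>) * a1 (\<phi> \<xi>) * (1 + J \<xi> t) * (?I \<xi> t * ?I \<xi> t)) * \<phi>2 \<xi>" for \<xi> t
  proof -
    have "x / J \<xi> t = x * ?I \<xi> t" "x / J \<xi> t ^ 2 = x * (?I \<xi> t * ?I \<xi> t)" for x
      by (simp_all add: divide_inverse power2_eq_square)
    then show ?thesis unfolding h_def by (simp only: power2_eq_square ring_distribs mult_ac add_ac)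
  qed
  ultimately show ?thesis by blast
qed

end

context C2_transport begin

text \<open>The bracket on the left is the product rule for p + q \<phi>2 with \<open>g\<close> in
  place of the missing derivative of \<phi>2. The weak derivative is tested with the C^1 function q
  Q; the terms with p form the derivative of p Q, whose integral is 0.\<close>

lemma integral_h\<xi>_by_parts:
  fixes Q Q' :: "real \<Rightarrow> real"
  assumes g: "locally_integrable g" and w: "C1_weak_derivative \<phi>2 g"
    and p: "C1x p p'" and q: "C1x q q'" and h: "\<And>\<xi> t. h \<xi> t = p \<xi> t + q \<xi> t * \<phi>2 \<xi>"
    and t: "t \<in> time_interval T"
    and dQ: "\<And>\<xi>. (Q has_real_derivative Q' \<xi>) (at \<xi>)" and cQ': "continuous_on UNIV Q'"
    and z: "\<And>\<xi>. R < \<bar>\<xi>\<bar> \<Longrightarrow> Q \<xi> = 0" "\<And>\<xi>. R < \<bar>\<xi>\<bar> \<Longrightarrow> Q' \<xi> = 0"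
  shows "(LINT \<xi>|lborel. (p' \<xi> t + q' \<xi> t * \<phi>2 \<xi> + q \<xi> t * g \<xi>) * Q \<xi>) = - (LINT \<xi>|lborel. h \<xi> t * Q' \<xi>)"
proof -
  have cQ: "continuous_on UNIV Q" using dQ by (meson DERIV_isCont continuous_at_imp_continuous_on)
  have slice: "continuous_on UNIV (\<lambda>\<xi>. f \<xi> t)" if "continuous_on (strip T) (\<lambda>p. f (fst p) (snd p))" for f
  proof -
    have "continuous_on UNIV (\<lambda>\<xi>. (\<xi>, t))" by (intro continuous_intros)
    moreover have "(\<lambda>\<xi>. (\<xi>, t)) ` UNIV \<subseteq> strip T" using t by (auto simp: strip_eq_Times)
    ultimately show ?thesis using continuous_on_compose2[OF that, of UNIV "\<lambda>\<xi>. (\<xi>, t)"] by simp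
  qed
  have cp: "continuous_on UNIV (\<lambda>\<xi>. p \<xi> t)" "continuous_on UNIV (\<lambda>\<xi>. p' \<xi> t)"
    and cq: "continuous_on UNIV (\<lambda>\<xi>. q \<xi> t)" "continuous_on UNIV (\<lambda>\<xi>. q' \<xi> t)" and ch: "continuous_on UNIV (\<lambda>\<xi>. h \<xi> t)"
    using p q h_cont by (auto simp: C1x_def intro: slice)
  have dp: "((\<lambda>\<xi>. p \<xi> t) has_real_derivative p' \<xi> t) (at \<xi>)" and dq: "((\<lambda>\<xi>. q \<xi> t) has_real_derivative q' \<xi> t) (at \<xi>)" for \<xi>
    using p q t by (auto simp: C1x_def)
  define k1 where "k1 \<xi> = q \<xi> t * Q \<xi>" for \<xi>
  define k1' where "k1' \<xi> = q' \<xi> t * Q \<xi> + Q' \<xi> * q \<xi> t" for \<xi>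
  define k2 where "k2 \<xi> = p \<xi> t * Q \<xi>" for \<xi>
  define k2' where "k2' \<xi> = p' \<xi> t * Q \<xi> + Q' \<xi> * p \<xi> t" for \<xi>
  have d: "(k1 has_real_derivative k1' \<xi>) (at \<xi>)" "(k2 has_real_derivative k2' \<xi>) (at \<xi>)" for \<xi>
    unfolding k1_def k1'_def k2_def k2'_def by (intro DERIV_mult dp dq dQ)+
  have ck: "continuous_on UNIV k1" "continuous_on UNIV k1'" "continuous_on UNIV k2'"
    unfolding k1_def k1'_def k2'_def by (intro continuous_intros cp cq cQ cQ')+
  have zk: "k1 \<xi> = 0" "k1' \<xi> = 0" "k2 \<xi> = 0" "k2' \<xi> = 0" if "R < \<bar>\<xi>\<bar>" for \<xi>
    using z[OF that] by (simp_all add: k1_def k1'_def k2_def k2'_def)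
  have i: "integrable lborel k2'" "integrable lborel (\<lambda>\<xi>. \<phi>2 \<xi> * k1' \<xi>)" "integrable lborel (\<lambda>\<xi>. g \<xi> * k1 \<xi>)"
    "integrable lborel (\<lambda>\<xi>. h \<xi> t * Q' \<xi>)"
    using integral_continuous_compact_support(1)[OF ck(3) zk(4)]
      locally_integrable_mult[OF continuous_imp_locally_integrable[OF \<phi>2] ck(2) zk(2)]
      locally_integrable_mult[OF g ck(1) zk(1)]
      locally_integrable_mult[OF continuous_imp_locally_integrable[OF ch] cQ' z(2)] by blast+
  have "(p' \<xi> t + q' \<xi> t * \<phi>2 \<xi> + q \<xi> t * g \<xi>) * Q \<xi> = k2' \<xi> + \<phi>2 \<xi> * k1' \<xi> + g \<xi> * k1 \<xi> - h \<xi> t * Q' \<xi>" for \<xi>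
    by (simp add: k1_def k1'_def k2'_def h algebra_simps)
  then have "(LINT \<xi>|lborel. (p' \<xi> t + q' \<xi> t * \<phi>2 \<xi> + q \<xi> t * g \<xi>) * Q \<xi>)
    = (LINT \<xi>|lborel. k2' \<xi>) + (LINT \<xi>|lborel. \<phi>2 \<xi> * k1' \<xi>) + (LINT \<xi>|lborel. g \<xi> * k1 \<xi>) - (LINT \<xi>|lborel. h \<xi> t * Q' \<xi>)"
    using i by simp
  moreover have "(LINT \<xi>|lborel. k2' \<xi>) = 0"
    by (rule integral_derivative_compact_support[OF d(2) ck(3) zk(3,4)])
  moreover have "(LINT \<xi>|lborel. \<phi>2 \<xi> * k1' \<xi>) = - (LINT \<xi>|lborel. g \<xi> * k1 \<xi>)"
    by (rule C1_weak_derivativeD[OF w d(1) ck(2) zk(1,2)])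
  ultimately show ?thesis by simp
qed

text \<open>Since \<Xi> has space derivative 1/J, the function h_\<xi>/J taken at (\<Xi>, t) is the
  space derivative of H. In Lagrangian coordinates 1/J cancels, and the weak formulation becomes two
  integrations by parts: in \<xi> from h_\<xi> to h, then in time from h to \<sigma>.\<close>

lemma weak_sol_exists:
  assumes T: "0 < T" and g: "locally_integrable g" and w: "C1_weak_derivative \<phi>2 g"
  shows "\<exists>v1. weak_sol_transport (\<lambda>x t. a (v x t)) (source_term a c v) T v1"
proof -
  obtain p p' q q' where p: "C1x p p'" and q: "C1x q q'" and h: "\<And>\<xi> t. h \<xi> t = p \<xi> t + q \<xi> t * \<phi>2 \<xi>"
    using h_decomposition by blast
  have gm[measurable]: "g \<in> borel_measurable borel" using g by (simp add: locally_integrable_def)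
  define hx where "hx \<xi> t = p' \<xi> t + q' \<xi> t * \<phi>2 \<xi> + q \<xi> t * g \<xi>" for \<xi> t
  define v1 where "v1 x t = hx (\<Xi> x t) t / J (\<Xi> x t) t" for x t
  define V where "V z = indicator (strip T) z * v1 (fst z) (snd z)" for z
  have c_hx: "continuous_on (strip T) (\<lambda>z. p' (fst z) (snd z) + q' (fst z) (snd z) * \<phi>2 (fst z))" "continuous_on (strip T) (\<lambda>z. q (fst z) (snd z))"
    using p q by (auto simp: C1x_def intro!: continuous_intros continuous_on_compose2[OF \<phi>2])
  have Vm[measurable]: "V \<in> borel_measurable borel"
  proof -
    let ?A = "\<lambda>z. (p' (\<Xi> (fst z) (snd z)) (snd z) + q' (\<Xi> (fst z) (snd z)) (snd z) * \<phi>2 (\<Xi> (fst z) (snd z))) / J (\<Xi> (fst z) (snd z)) (snd z)"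
    let ?B = "\<lambda>z. q (\<Xi> (fst z) (snd z)) (snd z) / J (\<Xi> (fst z) (snd z)) (snd z)"
    have "continuous_on (strip T) ?A"
      using continuous_on_strip_compose_\<Xi>[OF c_hx(1)] by (intro continuous_on_divide continuous_on_strip_compose_\<Xi>[OF J_cont] J_nonzero(2))
    then have [measurable]: "(\<lambda>z. indicator (strip T) z *\<^sub>R ?A z) \<in> borel_measurable borel"
      by (rule borel_measurable_continuous_on_indicator[OF strip_borel])
    have "continuous_on (strip T) ?B"
      by (intro continuous_on_divide continuous_on_strip_compose_\<Xi>[OF J_cont] continuous_on_strip_compose_\<Xi>[OF c_hx(2)] J_nonzero(2))
    then have [measurable]: "(\<lambda>z. indicator (strip T) z *\<^sub>R ?B z) \<in> borel_measurable borel"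
      by (rule borel_measurable_continuous_on_indicator[OF strip_borel])
    \<comment> \<open>As \<open>g\<close> is only Borel, it is composed with a map that is Borel on
      the whole plane; outside the strip its value at 0 is multiplied by 0.\<close>
    have [measurable]: "(\<lambda>z. indicator (strip T) z *\<^sub>R \<Xi> (fst z) (snd z)) \<in> borel_measurable borel"
      by (rule borel_measurable_continuous_on_indicator[OF strip_borel \<Xi>_cont_strip])
    have "(\<lambda>z. indicator (strip T) z *\<^sub>R ?A z + (indicator (strip T) z *\<^sub>R ?B z) * g (indicator (strip T) z *\<^sub>R \<Xi> (fst z) (snd z)))
        \<in> borel_measurable borel"
      by measurable
    moreover have "V = (\<lambda>z. indicator (strip T) z *\<^sub>R ?A z + (indicator (strip T) z *\<^sub>R ?B z) * g (indicator (strip T) z *\<^sub>R \<Xi> (fst z) (snd z)))"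
      by (auto simp: V_def v1_def hx_def fun_eq_iff indicator_def add_divide_distrib)
    ultimately show ?thesis by (simp only:)
  qed
  have V_lagrange: "V (lagrange_map z) * J (fst z) (snd z) = hx (fst z) (snd z)" if "z \<in> strip T" for z
  proof -
    obtain \<xi> t where z: "z = (\<xi>,t)" "t \<in> time_interval T" using \<open>z \<in> strip T\<close> by (cases z) (auto simp: mem_strip_iff)
    then show ?thesis using J_pos[OF z(2), of \<xi>] by (simp add: V_def v1_def lagrange_map_def mem_strip_iff \<Xi>_X)
  qed
  \<comment> \<open>Since \<open>g\<close> depends on \<xi> alone, it is integrable over a rectangle
    as a product with the indicator of a time interval; all other factors are continuous on the
    strip.\<close>
  have hx_int: "set_integrable lborel ({-R..R} \<times> {0..T1}) (\<lambda>z. hx (fst z) (snd z))" if T1: "ereal T1 < T" for R T1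
  proof -
    let ?K = "{-R..R} \<times> {0..T1}"
    have K: "compact ?K" "?K \<subseteq> strip T" using strip_rectangle_subset[OF T1] by (auto intro: compact_Times)
    have "integrable (lborel \<Otimes>\<^sub>M lborel) (\<lambda>(x, y). (indicator {-R..R} x * g x) * indicator {0..T1} y)"
      using g by (intro integrable_prod_mult integrable_indicator_Icc) (simp add: locally_integrable_def)
    moreover have "(\<lambda>(x, y). (indicator {-R..R} x * g x) * indicator {0..T1} y) = (\<lambda>z. indicator ?K z * g (fst z))"
      by (auto simp: fun_eq_iff indicator_def)
    ultimately have "set_integrable lborel ?K (\<lambda>z. g (fst z))"
      by (simp add: set_integrable_def lborel_prod)
    from set_integral_add(1)[OF set_integrable_continuous_compact[OF K(1) continuous_on_subset[OF c_hx(1) K(2)]]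
        set_integrable_mult_continuous[OF K(1) this continuous_on_subset[OF c_hx(2) K(2)]]]
    have "set_integrable lborel ?K (\<lambda>z. (p' (fst z) (snd z) + q' (fst z) (snd z) * \<phi>2 (fst z)) + g (fst z) * q (fst z) (snd z))" .
    then show ?thesis by (simp add: hx_def mult.commute)
  qed
  have "weak_sol_transport (\<lambda>x t. a (v x t)) (source_term a c v) T v1"
    unfolding weak_sol_transport_def
  proof (intro conjI allI impI)
    fix K :: "(real \<times> real) set" assume K: "compact K \<and> K \<subseteq> strip T"
    show "set_integrable lborel K (\<lambda>(x,t). v1 x t)"
    proof (cases "K = {}")
      case False
      obtain R T' where RT: "K \<subseteq> {-R..R} \<times> {0..T'}" and T': "ereal T' < T"
        using compact_subset_strip_rectangle[of K T] K False by blast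
      obtain R1 where R1: "\<And>\<xi> t. t \<in> {0..T'} \<Longrightarrow> \<bar>X \<xi> t\<bar> \<le> R \<Longrightarrow> \<bar>\<xi>\<bar> \<le> R1" using lagrangian_support_bounded[OF T', of R] by blast
      have [measurable]: "K \<in> sets borel" using K by (auto intro: borel_compact)
      let ?K1 = "{-R1..R1} \<times> {0..T'}"
      let ?F = "\<lambda>z. indicator K (lagrange_map z) * hx (fst z) (snd z)"
      have K1: "?K1 \<subseteq> strip T" by (rule strip_rectangle_subset[OF T'])
      have "integrable lborel (\<lambda>z. (indicator ?K1 z * hx (fst z) (snd z)) * indicator K (lagrange_map z))"
        by (rule integrable_mult_bounded_measurable[where C = 1])
          (use hx_int[OF T', of R1] in \<open>auto simp: set_integrable_def indicator_def\<close>)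
      then have "set_integrable lborel ?K1 ?F" by (simp add: set_integrable_def mult_ac)
      moreover have "?F z = 0" if "z \<in> strip T" "z \<notin> ?K1" for z
      proof (rule ccontr)
        assume "?F z \<noteq> 0"
        then have "lagrange_map z \<in> {-R..R} \<times> {0..T'}" using RT by (auto simp: indicator_def split: if_splits)
        then have "snd z \<in> {0..T'}" "\<bar>X (fst z) (snd z)\<bar> \<le> R" by (auto simp: lagrange_map_def abs_le_iff)
        then have "\<bar>fst z\<bar> \<le> R1" by (rule R1)
        then have "- R1 \<le> fst z" "fst z \<le> R1" by linarith+
        then show False using that(2) \<open>snd z \<in> {0..T'}\<close> by (auto simp: mem_Times_iff)
      qed
      ultimately have "set_integrable lborel (strip T) ?F"
        using set_integrable_superset_zero[OF K1, of ?F lborel] by simp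
      moreover have "set_integrable lborel (strip T) ?F \<longleftrightarrow>
          set_integrable lborel (strip T) (\<lambda>z. (indicator K (lagrange_map z) * V (lagrange_map z)) * J (fst z) (snd z))"
        by (rule set_integrable_cong) (auto simp: V_lagrange mult.assoc)
      ultimately have "set_integrable lborel (strip T) (\<lambda>z. indicator K z * V z)"
        by (subst set_integrable_lagrange) simp_all
      moreover have "(\<lambda>z. indicator (strip T) z *\<^sub>R (indicator K z * V z)) = (\<lambda>z. indicator K z *\<^sub>R (case z of (x,t) \<Rightarrow> v1 x t))"
        using K by (auto simp: V_def indicator_def fun_eq_iff)
      ultimately show ?thesis by (simp add: set_integrable_def)
    qed (simp add: set_integrable_def)
  next
    fix \<psi> T' assume "test_fun2 \<psi> \<and> ereal T' < T \<and> (\<forall>p. \<psi> p \<noteq> 0 \<longrightarrow> snd p \<le> T')"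
    then have \<psi>: "test_fun2 \<psi>" and T': "ereal T' < T" and \<psi>T: "\<And>p. \<psi> p \<noteq> 0 \<Longrightarrow> snd p \<le> T'" by auto
    obtain R where R: "\<And>p. \<psi> p \<noteq> 0 \<Longrightarrow> norm p \<le> R" using \<psi> unfolding test_fun2_def by blast
    note \<psi>x = test_fun2_px[OF \<psi>] and \<psi>t = test_fun2_pt[OF \<psi>]
    let ?U = "{q :: real \<times> real. R < norm q \<or> T' < snd q}"
    have U: "open ?U" by (intro open_Collect_disj open_Collect_less continuous_intros)
    have zU: "\<psi> p = 0" if "p \<in> ?U" for p using R[of p] \<psi>T[of p] that by (cases "\<psi> p = 0") auto
    have zU1: "px \<psi> p = 0" "pt \<psi> p = 0" if "p \<in> ?U" for p using px_pt_eq_0[OF U that zU] by auto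
    have zU2: "px (px \<psi>) p = 0" "pt (px \<psi>) p = 0" if "p \<in> ?U" for p using px_pt_eq_0[OF U that zU1(1)] by auto
    have inU: "(x,t) \<in> ?U" if "R < \<bar>x\<bar> \<or> T' < t" for x t
      using norm_fst_le[of x t] that by auto
    obtain R1 where R1: "\<And>\<xi> t. t \<in> {0..T'} \<Longrightarrow> \<bar>X \<xi> t\<bar> \<le> R \<Longrightarrow> \<bar>\<xi>\<bar> \<le> R1" using lagrangian_support_bounded[OF T', of R] by blast
    have XU: "(X \<xi> t, t) \<in> ?U" if "0 \<le> t" "R1 < \<bar>\<xi>\<bar> \<or> T' < t" for \<xi> t
      using R1[of t \<xi>] that inU[of "X \<xi> t" t] by force
    \<comment> \<open>For the composition \<psi>(X(\<xi>, t), t), \<open>Q\<close> is the time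
      derivative, \<open>G\<close> the \<xi>-derivative and \<open>G'\<close> the mixed derivative,
      hence both the \<xi>-derivative of \<open>Q\<close> and the time derivative of
      \<open>G\<close>.\<close>
    define Q where "Q \<xi> t = pt \<psi> (X \<xi> t, t) - a (\<phi> \<xi>) * px \<psi> (X \<xi> t, t)" for \<xi> t
    define G where "G \<xi> t = px \<psi> (X \<xi> t, t) * J \<xi> t" for \<xi> t
    define G' where "G' \<xi> t = (pt (px \<psi>) (X \<xi> t, t) - a (\<phi> \<xi>) * px (px \<psi>) (X \<xi> t, t)) * J \<xi> t - b \<xi> * px \<psi> (X \<xi> t, t)" for \<xi> t
    have zero: "Q \<xi> t = 0" "G \<xi> t = 0" "G' \<xi> t = 0" if "0 \<le> t" "R1 < \<bar>\<xi>\<bar> \<or> T' < t" for \<xi> t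
      using zU1[OF XU[OF that]] zU2[OF XU[OF that]] by (simp_all add: Q_def G_def G'_def)
    have cX: "continuous_on UNIV (\<lambda>z. (X (fst z) (snd z), snd z))" by (intro continuous_intros X_cont)
    have ca: "continuous_on UNIV (\<lambda>z :: real \<times> real. a (\<phi> (fst z)))"
      by (intro continuous_on_compose2[OF smooth_fun_continuous[OF a, of UNIV]] continuous_on_compose2[OF \<phi>_cont(1)[of UNIV]] continuous_intros) auto
    have cb: "continuous_on UNIV (\<lambda>z :: real \<times> real. b (fst z))"
      by (intro continuous_on_compose2[OF b_cont[of UNIV]] continuous_intros) auto
    note cc = continuous_on_compose2[OF test_fun2_px_cont[OF \<psi>, of UNIV] cX, simplified] continuous_on_compose2[OF test_fun2_pt_cont[OF \<psi>, of UNIV] cX, simplified]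
      continuous_on_compose2[OF test_fun2_px_cont[OF \<psi>x, of UNIV] cX, simplified] continuous_on_compose2[OF test_fun2_pt_cont[OF \<psi>x, of UNIV] cX, simplified]
    have cQ: "continuous_on UNIV (\<lambda>z. Q (fst z) (snd z))" and cG: "continuous_on UNIV (\<lambda>z. G (fst z) (snd z))"
      and cG': "continuous_on UNIV (\<lambda>z. G' (fst z) (snd z))"
      unfolding Q_def G_def G'_def by (intro continuous_on_diff continuous_on_mult cc ca cb J_cont)+
    have dQ: "((\<lambda>\<xi>. Q \<xi> t) has_real_derivative G' \<xi> t) (at \<xi>)" if "0 \<le> t" for \<xi> t
    proof -
      have "((\<lambda>\<xi>. Q \<xi> t) has_real_derivative px (pt \<psi>) (X \<xi> t, t) * J \<xi> t - ((a1 (\<phi> \<xi>) * \<phi>1 \<xi>) * px \<psi> (X \<xi> t, t) + (px (px \<psi>) (X \<xi> t, t) * J \<xi> t) * a (\<phi> \<xi>))) (at \<xi>)"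
        unfolding Q_def
        by (intro DERIV_diff DERIV_mult DERIV_chain2[OF test_fun2_DERIV_x[OF \<psi>t] X_DERIV] DERIV_chain2[OF test_fun2_DERIV_x[OF \<psi>x] X_DERIV] DERIV_chain2[OF a_DERIV(1) \<phi>])
      then show ?thesis
        by (rule DERIV_cong) (simp add: G'_def b_def px_pt_commute[OF \<psi> that] algebra_simps)
    qed
    have dG: "((\<lambda>t. G \<xi> t) has_real_derivative G' \<xi> t) (at t within {0..})" if "0 \<le> t" for \<xi> t
    proof -
      have dX: "((\<lambda>s. X \<xi> s) has_real_derivative - a (\<phi> \<xi>)) (at t within {0..})"
        unfolding X_def by (auto intro!: derivative_eq_intros)
      have "((\<lambda>s. px \<psi> (X \<xi> s, s)) has_real_derivative px (px \<psi>) (X \<xi> t, t) * (- a (\<phi> \<xi>)) + pt (px \<psi>) (X \<xi> t, t)) (at t within {0..})"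
      proof (rule has_real_derivative_along_curve[where f = "\<lambda>x t. px \<psi> (x,t)" and fx = "\<lambda>x t. px (px \<psi>) (x,t)" and ft = "\<lambda>x t. pt (px \<psi>) (x,t)",
            OF test_fun2_DERIV_x[OF \<psi>x] has_field_derivative_at_within[OF test_fun2_DERIV_t[OF \<psi>x]] _ _ _ dX])
        show "continuous_on (UNIV \<times> {0..}) (\<lambda>(x, t). pt (px \<psi>) (x, t))"
          using test_fun2_pt_cont[OF \<psi>x] by (simp add: case_prod_unfold)
      qed (use that in auto)
      moreover have "((\<lambda>s. J \<xi> s) has_real_derivative - b \<xi>) (at t within {0..})"
        unfolding J_def by (auto intro!: derivative_eq_intros)
      ultimately show ?thesis unfolding G_def
        by (rule DERIV_cong[OF DERIV_mult]) (simp add: G'_def algebra_simps)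
    qed
    have T'_ti: "t \<in> time_interval T \<Longrightarrow> 0 \<le> t" for t by (simp add: time_interval_def)
    let ?D = "\<lambda>z. pt \<psi> z - a (v (fst z) (snd z)) * px \<psi> z"
    let ?S = "\<lambda>z. \<sigma> (\<Xi> (fst z) (snd z)) (snd z) * px \<psi> z"
    have cD: "continuous_on (strip T) ?D"
      using a_v_cont by (intro continuous_on_diff continuous_on_mult test_fun2_px_cont[OF \<psi>] test_fun2_pt_cont[OF \<psi>]) (simp add: case_prod_unfold)
    have Dm[measurable]: "(\<lambda>z. indicator (strip T) z *\<^sub>R ?D z) \<in> borel_measurable borel"
      by (rule borel_measurable_continuous_on_indicator[OF strip_borel cD])
    \<comment> \<open>This is v1 (\<psi>_t - a(v) \<psi>_x), cut off outside the strip so that it is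
      Borel on the plane.\<close>
    define F where "F z = V z * (indicator (strip T) z *\<^sub>R ?D z)" for z
    have Fm[measurable]: "F \<in> borel_measurable borel" unfolding F_def by measurable
    have F_lagrange: "F (lagrange_map z) * J (fst z) (snd z) = hx (fst z) (snd z) * Q (fst z) (snd z)" if "z \<in> strip T" for z
    proof -
      obtain \<xi> t where z: "z = (\<xi>,t)" "t \<in> time_interval T" using \<open>z \<in> strip T\<close> by (cases z) (auto simp: mem_strip_iff)
      have "indicator (strip T) (lagrange_map z) *\<^sub>R ?D (lagrange_map z) = Q \<xi> t"
        using z by (simp add: lagrange_map_def mem_strip_iff Q_def v_X)
      then have "F (lagrange_map z) * J (fst z) (snd z) = (V (lagrange_map z) * J (fst z) (snd z)) * Q \<xi> t"
        by (simp add: F_def)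
      then have "F (lagrange_map z) * J (fst z) (snd z) = hx (fst z) (snd z) * Q \<xi> t"
        by (simp only: V_lagrange[OF that])
      then show ?thesis by (simp add: z)
    qed
    have i_hxQ: "set_integrable lborel (strip T) (\<lambda>z. hx (fst z) (snd z) * Q (fst z) (snd z))"
    proof (rule set_integrable_superset_zero[THEN iffD2, OF strip_rectangle_subset[OF T']])
      show "set_integrable lborel ({-R1..R1} \<times> {0..T'}) (\<lambda>z. hx (fst z) (snd z) * Q (fst z) (snd z))"
        by (rule set_integrable_mult_continuous[OF _ hx_int[OF T'] continuous_on_subset[OF cQ]]) (auto intro: compact_Times)
      fix z assume z: "z \<in> strip T" "z \<notin> {-R1..R1} \<times> {0..T'}"
      have "R1 < \<bar>fst z\<bar> \<or> T' < snd z" "0 \<le> snd z" using z by (cases z, auto simp: strip_def)+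
      then show "hx (fst z) (snd z) * Q (fst z) (snd z) = 0" using zero by simp
    qed
    have i_hG': "set_integrable lborel (strip T) (\<lambda>z. h (fst z) (snd z) * G' (fst z) (snd z))"
    proof (rule set_integrable_strip_compact_support(1)[OF continuous_on_mult[OF h_cont continuous_on_subset[OF cG']] T', of R1])
      show "h (fst (\<xi>,t)) (snd (\<xi>,t)) * G' (fst (\<xi>,t)) (snd (\<xi>,t)) = 0" if "(\<xi>,t) \<in> strip T" "R1 < \<bar>\<xi>\<bar> \<or> T' < t" for \<xi> t
        using zero(3)[of t \<xi>] that by (simp add: strip_def)
    qed simp
    have i_F: "set_integrable lborel (strip T) F"
      unfolding set_integrable_lagrange[OF Fm]
      by (rule set_integrable_cong[THEN iffD2, OF refl refl _ i_hxQ]) (rule F_lagrange)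
    have cS: "continuous_on (strip T) ?S"
      by (intro continuous_on_mult continuous_on_strip_compose_\<Xi> \<sigma>_cont test_fun2_px_cont[OF \<psi>])
    have i_S: "set_integrable lborel (strip T) ?S"
      by (rule set_integrable_strip_compact_support(1)[OF cS T', of R]) (use zU1 inU in auto)
    have "(LINT z:strip T|lborel. F z) = (LINT z:strip T|lborel. hx (fst z) (snd z) * Q (fst z) (snd z))"
      unfolding set_integral_lagrange[OF Fm]
      by (rule set_lebesgue_integral_cong) (simp, use F_lagrange in blast)
    also have "\<dots> = - (LINT z:strip T|lborel. h (fst z) (snd z) * G' (fst z) (snd z))"
    proof -
      \<comment> \<open>Integration by parts in \<xi> takes place at a fixed time, so both double
        integrals are sliced by Fubini with t outermost.\<close>
      let ?H1 = "\<lambda>\<xi> t. indicator (strip T) (\<xi>,t) * (hx \<xi> t * Q \<xi> t)"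
      let ?H2 = "\<lambda>\<xi> t. indicator (strip T) (\<xi>,t) * (h \<xi> t * G' \<xi> t)"
      have i: "integrable (lborel \<Otimes>\<^sub>M lborel) (case_prod ?H1)" "integrable (lborel \<Otimes>\<^sub>M lborel) (case_prod ?H2)"
        using i_hxQ i_hG' by (simp_all add: set_integrable_def lborel_prod case_prod_unfold)
      have inner: "(LINT \<xi>|lborel. ?H1 \<xi> t) = - (LINT \<xi>|lborel. ?H2 \<xi> t)" for t
      proof (cases "t \<in> time_interval T")
        case True
        have "continuous_on UNIV (\<lambda>\<xi>. (\<xi>, t))" by (intro continuous_intros)
        from continuous_on_compose2[OF cG' this] have "continuous_on UNIV (\<lambda>\<xi>. G' \<xi> t)" by simp
        from integral_h\<xi>_by_parts[OF g w p q h True dQ[OF T'_ti[OF True]] this, of R1]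
        have "(LINT \<xi>|lborel. hx \<xi> t * Q \<xi> t) = - (LINT \<xi>|lborel. h \<xi> t * G' \<xi> t)"
          using zero T'_ti[OF True] by (simp add: hx_def)
        then show ?thesis using True by (simp add: mem_strip_iff)
      qed (simp add: mem_strip_iff)
      have "(LINT z:strip T|lborel. hx (fst z) (snd z) * Q (fst z) (snd z)) = (LINT t|lborel. LINT \<xi>|lborel. ?H1 \<xi> t)"
        using lborel_pair.integral_snd[OF i(1)] by (simp add: set_lebesgue_integral_def lborel_prod case_prod_unfold)
      also have "\<dots> = - (LINT t|lborel. LINT \<xi>|lborel. ?H2 \<xi> t)" unfolding inner by simp
      also have "(LINT t|lborel. LINT \<xi>|lborel. ?H2 \<xi> t) = (LINT z:strip T|lborel. h (fst z) (snd z) * G' (fst z) (snd z))"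
        using lborel_pair.integral_snd[OF i(2)] by (simp add: set_lebesgue_integral_def lborel_prod case_prod_unfold)
      finally show ?thesis .
    qed
    also have "\<dots> = (LINT z:strip T|lborel. \<sigma> (fst z) (snd z) * G (fst z) (snd z))"
    proof (rule integral_\<sigma>_by_parts[symmetric, OF _ _ _ T' T])
      show "continuous_on (strip T) (\<lambda>z. G (fst z) (snd z))" "continuous_on (strip T) (\<lambda>z. G' (fst z) (snd z))"
        using continuous_on_subset[OF cG] continuous_on_subset[OF cG'] by auto
      show "((\<lambda>t. G \<xi> t) has_real_derivative G' \<xi> t) (at t within {0..})" if "t \<in> time_interval T" for \<xi> t
        by (rule dG[OF T'_ti[OF that]])
      show "G \<xi> t = 0" "G' \<xi> t = 0" if "t \<in> time_interval T" "R1 < \<bar>\<xi>\<bar> \<or> T' < t" for \<xi> t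
        using zero[OF T'_ti[OF that(1)] that(2)] by auto
    qed
    also have "\<dots> = (LINT z:strip T|lborel. ?S z)"
      unfolding set_integral_lagrange_continuous[OF cS]
    proof (rule set_lebesgue_integral_cong, simp, intro allI impI)
      fix z assume "z \<in> strip T"
      then obtain \<xi> t where z: "z = (\<xi>,t)" "t \<in> time_interval T" by (cases z) (auto simp: mem_strip_iff)
      then show "\<sigma> (fst z) (snd z) * G (fst z) (snd z) =
        \<sigma> (\<Xi> (fst (lagrange_map z)) (snd (lagrange_map z))) (snd (lagrange_map z)) * px \<psi> (lagrange_map z) * J (fst z) (snd z)"
        by (simp add: lagrange_map_def \<Xi>_X G_def)
    qed
    finally have "(LINT z:strip T|lborel. F z) = (LINT z:strip T|lborel. ?S z)" .
    then have "(LINT z:strip T|lborel. F z - ?S z) = 0"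
      using i_F i_S by (simp add: set_integral_diff)
    moreover have "(LINT z:strip T|lborel. (\<lambda>(x,t). v1 x t * pt \<psi> (x,t) - (a (v x t) * v1 x t + source_term a c v x t) * px \<psi> (x,t)) z)
      = (LINT z:strip T|lborel. F z - ?S z)"
      by (rule set_lebesgue_integral_cong) (auto simp: F_def V_def source_eq mem_strip_iff algebra_simps)
    ultimately show "(LINT z:strip T|lborel. (\<lambda>(x,t). v1 x t * pt \<psi> (x,t) - (a (v x t) * v1 x t + source_term a c v x t) * px \<psi> (x,t)) z) = 0"
      by simp
  qed
  then show ?thesis by blast
qed

end

text \<open>Test functions supported in times \<ge> \<delta> > 0 do not distinguish the open strip
  from the closed one. The potential is a parameter that has to agree with \<open>h\<close> at
  (\<Xi>, t), so one argument serves the explicit formula and the variational derivative.\<close>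

lemma (in C2_transport) weak_sol_dist_dx_eq:
  assumes T: "0 < T" and w: "weak_sol_transport (\<lambda>x t. a (v x t)) (source_term a c v) T v1"
    and H: "\<And>x t. t \<in> time_interval T \<Longrightarrow> H x t = h (\<Xi> x t) t"
  shows "dist_dx_eq v1 H T"
  unfolding dist_dx_eq_def
proof (intro allI impI)
  fix \<eta> \<delta> T'
  assume "test_fun2 \<eta> \<and> 0 < \<delta> \<and> ereal T' < T \<and> (\<forall>p. \<eta> p \<noteq> 0 \<longrightarrow> \<delta> \<le> snd p \<and> snd p \<le> T')"
  then have \<eta>: "test_fun2 \<eta>" and \<delta>: "0 < \<delta>" and T': "ereal T' < T"
    and supp: "\<And>p. \<eta> p \<noteq> 0 \<Longrightarrow> \<delta> \<le> snd p \<and> snd p \<le> T'" by auto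
  obtain R where R: "\<And>p. \<eta> p \<noteq> 0 \<Longrightarrow> norm p \<le> R" using \<eta> unfolding test_fun2_def by blast
  have sub: "open_strip T \<subseteq> strip T" by (auto simp: open_strip_def strip_def)
  have z: "\<eta> p = 0" "px \<eta> p = 0" if "p \<in> strip T" "p \<notin> open_strip T" for p
  proof -
    have "snd p < \<delta>" using that \<delta> by (auto simp: open_strip_def strip_def)
    then show "\<eta> p = 0" "px \<eta> p = 0" using px_support_bounded[OF R supp] by blast+
  qed
  have "(LINT p:open_strip T|lborel. v1 (fst p) (snd p) * \<eta> p) = (LINT p:strip T|lborel. v1 (fst p) (snd p) * \<eta> p)"
    by (rule set_integral_superset_zero[OF sub, symmetric]) (simp add: z)
  also have "\<dots> = - (LINT p:strip T|lborel. h (\<Xi> (fst p) (snd p)) (snd p) * px \<eta> p)"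
    by (rule weak_sol_integral_test_fun[OF T w \<eta> T' supp])
  also have "(LINT p:strip T|lborel. h (\<Xi> (fst p) (snd p)) (snd p) * px \<eta> p) = (LINT p:strip T|lborel. H (fst p) (snd p) * px \<eta> p)"
    by (rule set_lebesgue_integral_cong) (simp, auto simp: H strip_eq_Times)
  also have "\<dots> = (LINT p:open_strip T|lborel. H (fst p) (snd p) * px \<eta> p)"
    by (rule set_integral_superset_zero[OF sub]) (simp add: z)
  finally show "(LINT p:open_strip T|lborel. (\<lambda>(x,t). v1 x t * \<eta> (x,t)) p)
      = - (LINT p:open_strip T|lborel. (\<lambda>(x,t). H x t * px \<eta> (x,t)) p)"
    by (simp add: case_prod_unfold)
qed

text \<open>The initial value of a classical solution is differentiable in x, hence continuous; this
  singles out the representative of the Sobolev class to which the regularity result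
  applies.\<close>

lemma classical_sol_imp_C2_transport:
  assumes a: "smooth_fun a" and c: "smooth_fun c" and s: "3 \<le> s" and \<phi>: "sobolevH s \<phi>"
    and v: "classical_sol a \<phi> T v" and T: "0 < T"
  shows "\<exists>\<phi>1 \<phi>2 vx vt g. C2_transport a c \<phi> \<phi>1 \<phi>2 v vx vt T \<and> locally_integrable g \<and> C1_weak_derivative \<phi>2 g"
proof -
  obtain vx vt where sol: "\<forall>x t. 0 \<le> t \<and> ereal t < T \<longrightarrow>
            ((\<lambda>y. v y t) has_real_derivative vx x t) (at x) \<and>
            ((\<lambda>s. v x s) has_real_derivative vt x t) (at t within {0..}) \<and>
            vt x t = a (v x t) * vx x t"
      "continuous_on (strip T) (\<lambda>(x,t). v x t)" "continuous_on (strip T) (\<lambda>(x,t). vx x t)"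
      "continuous_on (strip T) (\<lambda>(x,t). vt x t)" and v0: "\<forall>x. v x 0 = \<phi> x"
    using v unfolding classical_sol_def by (elim exE conjE)
  have "((\<lambda>y. v y 0) has_real_derivative vx x 0) (at x)" for x
    using sol(1)[rule_format, of 0 x] T by (simp add: zero_ereal_def)
  then have "(\<phi> has_real_derivative vx x 0) (at x)" for x by (simp add: v0)
  then have "continuous_on UNIV \<phi>" by (meson DERIV_isCont continuous_at_imp_continuous_on)
  from sobolevH_regularity[OF \<phi> s this] obtain \<phi>1 \<phi>2 g where r:
    "\<And>x. (\<phi> has_real_derivative \<phi>1 x) (at x)" "\<And>x. (\<phi>1 has_real_derivative \<phi>2 x) (at x)"
    "continuous_on UNIV \<phi>2" "locally_integrable g" "C1_weak_derivative \<phi>2 g" by blast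
  have d: "((\<lambda>y. v y t) has_real_derivative vx x t) (at x)"
    "((\<lambda>s. v x s) has_real_derivative vt x t) (at t within {0..})"
    "vt x t = a (v x t) * vx x t" if "t \<in> time_interval T" for x t
    using sol(1)[rule_format, of t x] that by (auto simp: time_interval_def)
  have "C2_transport a c \<phi> \<phi>1 \<phi>2 v vx vt T"
    by unfold_locales (fact a c r(1) r(2) r(3) d sol(2) sol(3) sol(4) v0[rule_format])+
  with r show ?thesis by blast
qed

text \<open>Existence keeps the second claim from being vacuous. Conversely,
  \<open>dist_dx_eq\<close> fixes the pairing with every test function compactly supported in the
  open strip, so it also determines the weak solution there up to a null set.\<close>

theorem mainTheorem9:
  fixes a c \<phi> :: "real \<Rightarrow> real" and s :: real and v0 :: "real \<Rightarrow> real \<Rightarrow> real"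
  assumes "smooth_fun a" and "smooth_fun c"
    and "3 \<le> s" and "sobolevH s \<phi>"
    and "classical_sol a \<phi> (critical_time a \<phi>) v0"
  shows "(\<exists>v1. weak_sol_transport (\<lambda>x t. a (v0 x t)) (source_term a c v0) (critical_time a \<phi>) v1)
       \<and> (\<forall>v1. weak_sol_transport (\<lambda>x t. a (v0 x t)) (source_term a c v0) (critical_time a \<phi>) v1 \<longrightarrow>
              dist_dx_eq v1 (formula_H a c v0) (critical_time a \<phi>)
            \<and> dist_dx_eq v1 (\<lambda>x t. var_deriv1 (Kdens a c t) (\<lambda>y. v0 y t) x) (critical_time a \<phi>))"
proof (cases "0 < critical_time a \<phi>")
  case True
  obtain \<phi>1 \<phi>2 vx vt g where l: "C2_transport a c \<phi> \<phi>1 \<phi>2 v0 vx vt (critical_time a \<phi>)"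
    and g: "locally_integrable g" "C1_weak_derivative \<phi>2 g"
    using classical_sol_imp_C2_transport[OF assms True] by blast
  interpret C2_transport a c \<phi> \<phi>1 \<phi>2 v0 vx vt "critical_time a \<phi>" by (rule l)
  show ?thesis
    using weak_sol_exists[OF True g] weak_sol_dist_dx_eq[OF True _ formula_H_eq] weak_sol_dist_dx_eq[OF True _ var_deriv1_eq]
    by blast
next
  case False
  \<comment> \<open>The supremum of the empty set of lifespans is \<open>-\<infinity>\<close>; then the statement is about an empty strip.\<close>
  have "strip (critical_time a \<phi>) = {}"
  proof -
    have "\<not> ereal t < critical_time a \<phi>" if "0 \<le> t" for t
      using False that le_less_trans[of 0 "ereal t" "critical_time a \<phi>"] by auto
    then show ?thesis by (auto simp: strip_def)
  qed
  moreover from this have "open_strip (critical_time a \<phi>) = {}" by (auto simp: open_strip_def strip_def)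
  ultimately show ?thesis
    by (auto simp: weak_sol_transport_def dist_dx_eq_def set_lebesgue_integral_def set_integrable_def)
qed

end
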